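(* Fix $(\varepsilon_1,\varepsilon_2)\in(0,1)^2$, $P>0$, $\alpha\in(0,1)$, and let $\dagger\in\{\mathrm{SIC},\mathrm{JNN}\}$. Let $(L_1,L_2)\in\mathbb{R}^2$ satisfy $$L_1\ge \sqrt{\mathrm{V}_1(\alpha P)}\,Q^{-1}(\varepsilon_1),\qquad L_2\ge \sqrt{\mathrm{V}_2(\bar\alpha P,\alpha P)}\,Q^{-1}(\varepsilon_2).$$ Then there exist sequences of codebook sizes $M_{1,n},M_{2,n}$ such that the random spherical-codebook $(n,M_{1,n},M_{2,n})$-$\dagger$ codes satisfy $$\limsup_{n\to\infty}\frac{1}{\sqrt n}\Big(n\,\mathrm{C}\big(\tfrac{\alpha P}{\beta}\big)-\log M_{1,n}\Big)\le L_1,\qquad \limsup_{n\to\infty}\frac{1}{\sqrt n}\Big(n\,\mathrm{C}\big(\tfrac{\bar\alpha P}{\alpha P+1}\big)-\log M_{2,n}\Big)\le L_2,$$ and $\limsup_{n\to\infty}\mathrm{P}^n_{\mathrm{e},i}\le\varepsilon_i$ for each $i\in\{1,2\}$ (i.e., $(L_1,L_2)$ is second-order achievable under the separate error probability criterion, for both SIC and JNN decoding at user 1).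
   Context: Setup (two-user broadcast channel with degraded message sets and additive, not necessarily Gaussian, noise). Fix $n\in\mathbb{N}$, power $P>0$, power split $\alpha\in(0,1)$ with $\bar\alpha=1-\alpha$, and $\beta\in(0,1)$. Outputs: $Y_1^n=X^n+Z_1^n$ (user 1, strong) and $Y_2^n=X^n+Z_2^n$ (user 2, weak), where $Z_{1,1},\dots,Z_{1,n}$ are i.i.d. with an arbitrary distribution satisfying $\mathbb{E}[Z_1^2]=\beta$, $\zeta_1:=\mathbb{E}[Z_1^4]<\infty$, $\mathbb{E}[Z_1^6]<\infty$, and $Z_{2,1},\dots,Z_{2,n}$ are i.i.d. with an arbitrary distribution satisfying $\mathbb{E}[Z_2^2]=1$, $\zeta_2:=\mathbb{E}[Z_2^4]<\infty$, $\mathbb{E}[Z_2^6]<\infty$; the noise is independent of messages and codebooks. Random code: codewords $V^n(1),\dots,V^n(M_1)$ are i.i.d. uniform on the sphere $\{v\in\mathbb{R}^n:\|v\|^2=n\alpha P\}$, codewords $U^n(1),\dots,U^n(M_2)$ are i.i.d. uniform on the sphere $\{u\in\mathbb{R}^n:\|u\|^2=n\bar\alpha P\}$, all independent. Messages $W_1,W_2$ are independent and uniform on $[M_1]$, $[M_2]$; the transmitted signal is $X^n=V^n(W_1)+U^n(W_2)$. User 2 decodes $\hat W_2=\arg\min_{w_2}\|Y_2^n-U^n(w_2)\|^2$. Under SIC, user 1 decodes $\bar W_2=\arg\min_{w_2}\|Y_1^n-U^n(w_2)\|^2$ and then $\hat W_1=\arg\min_{w_1}\|Y_1^n-U^n(\bar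 W_2)-V^n(w_1)\|^2$. Under JNN, user 1 decodes $(\hat W_1,\bar W_2)=\arg\min_{(w_1,w_2)}\|Y_1^n-U^n(w_2)-V^n(w_1)\|^2$. Ensemble error probabilities (averaged over messages, codebooks and noise): $\mathrm{P}^n_{\mathrm{e},1}=\Pr\{\hat W_1\ne W_1\text{ or }\bar W_2\ne W_2\}$, $\mathrm{P}^n_{\mathrm{e},2}=\Pr\{\hat W_2\ne W_2\}$. Notation: $\mathrm{C}(x)=\frac12\log(1+x)$ (natural log); $Q$ is the standard Gaussian complementary cdf and $Q^{-1}$ its inverse. Dispersions: $$\mathrm{V}_1(\alpha P)=\frac{(\alpha P)^2(\zeta_1-\beta^2)+4\alpha P\beta^3}{4\beta^2(\alpha P+\beta)^2},\qquad \mathrm{V}_2(\bar\alpha P,\alpha P)=\frac{(\bar\alpha P)^2(\zeta_2-1+4\alpha P)+4\bar\alpha P(\alpha P+1)^3}{4(\alpha P+1)^2(P+1)^2}.$$ *)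

theory Defs
  imports "HOL-Probability.Probability"
begin

datatype decoder = SIC | JNN

text \<open>Vectors of R^n are functions nat => real, only coordinates i < n matter.\<close>
definition sqnorm :: "nat \<Rightarrow> (nat \<Rightarrow> real) \<Rightarrow> real" where
  "sqnorm n x = (\<Sum>i<n. (x i)\<^sup>2)"

definition std_gauss :: "real measure" where
  "std_gauss = density lborel std_normal_density"

definition Qfun :: "real \<Rightarrow> real" where
  "Qfun x = measure std_gauss {x<..}"

definition Qinv :: "real \<Rightarrow> real" where
  "Qinv e = (THE x. Qfun x = e)"

definition Ccap :: "real \<Rightarrow> real" where
  "Ccap x = ln (1 + x) / 2"

definition V1 :: "real \<Rightarrow> real \<Rightarrow> real \<Rightarrow> real" where
  "V1 a \<beta> \<zeta> = (a\<^sup>2 * (\<zeta> - \<beta>\<^sup>2) + 4 * a * \<beta>^3) / (4 * \<beta>\<^sup>2 * (a + \<beta>)\<^sup>2)"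

text \<open>V2 abar a zeta, with P = abar + a.\<close>
definition V2 :: "real \<Rightarrow> real \<Rightarrow> real \<Rightarrow> real" where
  "V2 b a \<zeta> = (b\<^sup>2 * (\<zeta> - 1 + 4 * a) + 4 * b * (a + 1)^3) / (4 * (a + 1)\<^sup>2 * (b + a + 1)\<^sup>2)"

text \<open>Uniform distribution on the sphere of radius r in R^n, realised as the law of
  r G / |G| with G a standard Gaussian vector (rotation-invariant probability on the sphere).\<close>
definition sphere_unif :: "nat \<Rightarrow> real \<Rightarrow> (nat \<Rightarrow> real) measure" where
  "sphere_unif n r = distr (PiM {..<n} (\<lambda>_. std_gauss)) (PiM {..<n} (\<lambda>_. borel))
     (\<lambda>g. restrict (\<lambda>i. r * g i / sqrt (sqnorm n g)) {..<n})"

definition codebook :: "nat \<Rightarrow> nat \<Rightarrow> real \<Rightarrow> (nat \<Rightarrow> nat \<Rightarrow> real) measure" where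
  "codebook n M pw = PiM {..<M} (\<lambda>_. sphere_unif n (sqrt (real n * pw)))"

definition noise :: "nat \<Rightarrow> real measure \<Rightarrow> (nat \<Rightarrow> real) measure" where
  "noise n D = PiM {..<n} (\<lambda>_. D)"

definition ens :: "nat \<Rightarrow> real measure \<Rightarrow> real \<Rightarrow> real \<Rightarrow> nat \<Rightarrow> nat
    \<Rightarrow> (((nat \<Rightarrow> nat \<Rightarrow> real) \<times> (nat \<Rightarrow> nat \<Rightarrow> real)) \<times> (nat \<Rightarrow> real)) measure" where
  "ens n D P \<alpha> M1 M2 = (codebook n M1 (\<alpha> * P) \<Otimes>\<^sub>M codebook n M2 ((1 - \<alpha>) * P)) \<Otimes>\<^sub>M noise n D"

text \<open>Minimum-distance decoding succeeds iff the true index is the unique (strict) minimiser.\<close>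
definition succ2 :: "nat \<Rightarrow> nat \<Rightarrow> (nat \<Rightarrow> nat \<Rightarrow> real) \<Rightarrow> (nat \<Rightarrow> real) \<Rightarrow> nat \<Rightarrow> bool" where
  "succ2 n M2 u y w2 = (\<forall>w'<M2. w' \<noteq> w2 \<longrightarrow>
      sqnorm n (\<lambda>i. y i - u w2 i) < sqnorm n (\<lambda>i. y i - u w' i))"

definition succ1 :: "decoder \<Rightarrow> nat \<Rightarrow> nat \<Rightarrow> nat \<Rightarrow> (nat \<Rightarrow> nat \<Rightarrow> real) \<Rightarrow> (nat \<Rightarrow> nat \<Rightarrow> real)
    \<Rightarrow> (nat \<Rightarrow> real) \<Rightarrow> nat \<Rightarrow> nat \<Rightarrow> bool" where
  "succ1 dec n M1 M2 v u y w1 w2 = (case dec of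
     SIC \<Rightarrow> succ2 n M2 u y w2 \<and>
            (\<forall>w'<M1. w' \<noteq> w1 \<longrightarrow>
               sqnorm n (\<lambda>i. y i - u w2 i - v w1 i) < sqnorm n (\<lambda>i. y i - u w2 i - v w' i))
   | JNN \<Rightarrow> (\<forall>w1'<M1. \<forall>w2'<M2. (w1', w2') \<noteq> (w1, w2) \<longrightarrow>
               sqnorm n (\<lambda>i. y i - u w2 i - v w1 i) < sqnorm n (\<lambda>i. y i - u w2' i - v w1' i)))"

definition Pe1 :: "decoder \<Rightarrow> nat \<Rightarrow> real measure \<Rightarrow> real \<Rightarrow> real \<Rightarrow> nat \<Rightarrow> nat \<Rightarrow> real" where
  "Pe1 dec n D1 P \<alpha> M1 M2 = (\<Sum>w1<M1. \<Sum>w2<M2.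
     measure (ens n D1 P \<alpha> M1 M2)
       {((v, u), z) \<in> space (ens n D1 P \<alpha> M1 M2).
          \<not> succ1 dec n M1 M2 v u (\<lambda>i. v w1 i + u w2 i + z i) w1 w2}) / (real M1 * real M2)"

definition Pe2 :: "nat \<Rightarrow> real measure \<Rightarrow> real \<Rightarrow> real \<Rightarrow> nat \<Rightarrow> nat \<Rightarrow> real" where
  "Pe2 n D2 P \<alpha> M1 M2 = (\<Sum>w1<M1. \<Sum>w2<M2.
     measure (ens n D2 P \<alpha> M1 M2)
       {((v, u), z) \<in> space (ens n D2 P \<alpha> M1 M2).
          \<not> succ2 n M2 u (\<lambda>i. v w1 i + u w2 i + z i) w2}) / (real M1 * real M2)"

end

theory Submission
  imports Defs
begin

text \<open>For a wrong codeword, a Chernoff bound with the exponent that is optimal for Gaussian noise of the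
  same power shows that it beats the sent one with probability at most \<open>exp (K - i)\<close>. Here \<open>i\<close> is the
  Gaussian information density, a linear function of the energies of the output and of the residual, and \<open>K\<close>
  is bounded on typical outputs: the moments of a Gaussian vector weighted by a function of its
  direction compare the sphere with the Gaussian law at the cost of a constant factor.

  With codebooks of log-size \<open>n C - sqrt n L - 2 n powr (3/8)\<close> and a union bound, only the event that \<open>i\<close>
  falls below \<open>n C - sqrt n L - n powr (3/8)\<close> matters. Writing codewords as normalised Gaussian
  vectors, \<open>i - n C\<close> is, up to \<open>o(sqrt n)\<close> on typical triples, a sum of independent identically distributed
  terms, so the central limit theorem gives the limit \<open>Q (L / sqrt V)\<close>. The strong user's decoding of the weak
  user's message and its joint errors have first-order slack because \<open>\<beta> < 1\<close>, so their probabilities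
  vanish. The noise need not be centred: all cross
  terms contain a symmetric Gaussian factor.\<close>

text \<open>The coordinates of a uniform point on a sphere are dependent, so the Chernoff integral
  does not factorise there as it does for a Gaussian vector. Comparing the two needs the
  independence of radius and direction of a Gaussian vector. It is obtained without polar
  coordinates: tilting the law by \<open>exp (- \<theta> * sqnorm n g)\<close> amounts to rescaling
  \<open>g\<close>, and functions of the direction do not notice this.

  The powers of n fit together as follows. Chebyshev's inequality needs deviations above n powr
  (1/2), and 5/8 is taken. Projecting to the sphere then perturbs inner products by n powr (-3/8) *
  n powr (5/8) = n powr (1/4). The margin n powr (3/8) dominates this error and is itself o(sqrt n),
  so it costs nothing at second order.

  Errors that involve the weak message at the strong user are bounded more crudely, with a loss of
  order n powr (5/8) in the exponent, because a gap linear in n pays for it.\<close>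

lemma std_gauss_prob: "prob_space std_gauss"
  unfolding std_gauss_def by (rule prob_space_normal_density) simp

lemma sets_std_gauss [simp, measurable_cong]: "sets std_gauss = sets borel"
  by (simp add: std_gauss_def)

lemma space_std_gauss [simp]: "space std_gauss = UNIV"
  by (simp add: std_gauss_def)

interpretation gauss: prob_space std_gauss by (rule std_gauss_prob)
interpretation gauss_prod: product_prob_space "\<lambda>_. std_gauss" UNIV
  by standard

abbreviation gauss_vec :: "nat \<Rightarrow> (nat \<Rightarrow> real) measure" where
  "gauss_vec n \<equiv> PiM {..<n} (\<lambda>_. std_gauss)"

abbreviation borel_vec :: "nat \<Rightarrow> (nat \<Rightarrow> real) measure" where
  "borel_vec n \<equiv> PiM {..<n} (\<lambda>_. borel)"

lemma sets_gauss_vec [simp, measurable_cong]: "sets (gauss_vec n) = sets (borel_vec n)"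
  by (rule sets_PiM_cong) simp_all

lemma prob_gauss_vec: "prob_space (gauss_vec n)"
  by (rule prob_space_PiM) (rule std_gauss_prob)

interpretation gv: prob_space "gauss_vec n" for n by (rule prob_gauss_vec)

section \<open>Energies and inner products of vectors\<close>

lemma sqnorm_nonneg [simp]: "0 \<le> sqnorm n x"
  by (simp add: sqnorm_def sum_nonneg)

lemma sqnorm_cong: "(\<And>i. i < n \<Longrightarrow> x i = y i) \<Longrightarrow> sqnorm n x = sqnorm n y"
  by (simp add: sqnorm_def)

lemma sqnorm_scale: "sqnorm n (\<lambda>i. c * x i) = c\<^sup>2 * sqnorm n x"
  by (simp add: sqnorm_def power_mult_distrib sum_distrib_left)

definition dot :: "nat \<Rightarrow> (nat \<Rightarrow> real) \<Rightarrow> (nat \<Rightarrow> real) \<Rightarrow> real" where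
  "dot n x y = (\<Sum>i<n. x i * y i)"

lemma sqnorm_add: "sqnorm n (\<lambda>i. x i + y i) = sqnorm n x + 2 * dot n x y + sqnorm n y"
  by (simp add: sqnorm_def dot_def power2_sum sum.distrib sum_distrib_left algebra_simps)

lemma sqnorm_diff: "sqnorm n (\<lambda>i. x i - y i) = sqnorm n x - 2 * dot n x y + sqnorm n y"
  by (simp add: sqnorm_def dot_def power2_diff sum.distrib sum_subtractf sum_distrib_left algebra_simps)

lemma dot_add_left: "dot n (\<lambda>i. x i + y i) z = dot n x z + dot n y z"
  by (simp add: dot_def sum.distrib algebra_simps)

lemma dot_commute: "dot n x y = dot n y x"
  by (simp add: dot_def mult.commute)

lemma dot_le: "\<bar>dot n x y\<bar> \<le> sqrt (sqnorm n x) * sqrt (sqnorm n y)"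
proof -
  have "(dot n x y)\<^sup>2 \<le> sqnorm n x * sqnorm n y"
    unfolding dot_def sqnorm_def by (rule Cauchy_Schwarz_ineq_sum)
  then have "sqrt ((dot n x y)\<^sup>2) \<le> sqrt (sqnorm n x * sqnorm n y)"
    by (rule real_sqrt_le_mono)
  then show ?thesis by (simp add: real_sqrt_mult)
qed

lemma dot_eq_0: "sqnorm n x = 0 \<Longrightarrow> dot n x y = 0"
  using dot_le[of n x y] by simp

lemma sqnorm_diff_le: "sqnorm n (\<lambda>i. x i - y i) \<le> 2 * sqnorm n x + 2 * sqnorm n y"
proof -
  have "0 \<le> sqnorm n (\<lambda>i. x i + y i)" by simp
  then show ?thesis unfolding sqnorm_add sqnorm_diff by simp
qed

lemma sqnorm_measurable [measurable (raw)]: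
  assumes [measurable]: "\<And>i. i < n \<Longrightarrow> (\<lambda>w. f w i) \<in> borel_measurable M"
  shows "(\<lambda>w. sqnorm n (f w)) \<in> borel_measurable M"
  unfolding sqnorm_def by measurable

lemma dot_measurable [measurable (raw)]:
  assumes [measurable]: "\<And>i. i < n \<Longrightarrow> (\<lambda>w. f w i) \<in> borel_measurable M"
    "\<And>i. i < n \<Longrightarrow> (\<lambda>w. g w i) \<in> borel_measurable M"
  shows "(\<lambda>w. dot n (f w) (g w)) \<in> borel_measurable M"
  unfolding dot_def by measurable

section \<open>Projection of a vector to the sphere\<close>

definition sph :: "nat \<Rightarrow> real \<Rightarrow> (nat \<Rightarrow> real) \<Rightarrow> nat \<Rightarrow> real" where
  "sph n r g = restrict (\<lambda>i. r * g i / sqrt (sqnorm n g)) {..<n}"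

lemma sph_measurable [measurable]: "sph n r \<in> borel_vec n \<rightarrow>\<^sub>M borel_vec n"
  unfolding sph_def by measurable

lemma sphere_unif_eq: "sphere_unif n r = distr (gauss_vec n) (borel_vec n) (sph n r)"
  by (simp add: sphere_unif_def sph_def[abs_def])

lemma sph_apply: "i < n \<Longrightarrow> sph n r g i = r / sqrt (sqnorm n g) * g i"
  by (simp add: sph_def)

lemma sqnorm_sph: "sqnorm n (sph n r g) = (if sqnorm n g = 0 then 0 else r\<^sup>2)"
proof -
  have "sqnorm n (sph n r g) = (r / sqrt (sqnorm n g))\<^sup>2 * sqnorm n g"
    by (subst sqnorm_scale[symmetric]) (rule sqnorm_cong, simp add: sph_apply)
  then show ?thesis by (simp add: power_divide)
qed

lemma dot_sph: "dot n y (sph n r g) = r / sqrt (sqnorm n g) * dot n y g"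
  by (simp add: dot_def sph_apply sum_distrib_left mult_ac)

text \<open>The reason for realising the sphere through Gaussian vectors: whatever is computed from
  \<open>sph n r g\<close> depends on the direction of \<open>g\<close> only, as
  \<open>dirfun\<close> demands.\<close>

lemma sph_scale: "0 < c \<Longrightarrow> sph n r (restrict (\<lambda>i. g i / c) {..<n}) = sph n r g"
proof -
  assume c: "0 < c"
  have "sqnorm n (restrict (\<lambda>i. g i / c) {..<n}) = (1/c)\<^sup>2 * sqnorm n g"
    by (subst sqnorm_scale[symmetric]) (rule sqnorm_cong, simp)
  then show ?thesis using c
    by (auto simp: sph_def fun_eq_iff restrict_def real_sqrt_mult real_sqrt_divide power_divide)
qed

subsection \<open>Scaling of Gaussian vectors\<close>

text \<open>An exponential tilt by the square keeps a Gaussian Gaussian and changes its variance to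
  1 / (1 + 2 \<theta>). At \<theta> = -1/2 the tilted density stops being integrable.\<close>

lemma std_gauss_scale:
  assumes "-1/2 < \<theta>"
  shows "distr std_gauss std_gauss (\<lambda>x. x / sqrt (1 + 2*\<theta>)) =
    density std_gauss (\<lambda>x. ennreal (sqrt (1 + 2*\<theta>) * exp (- \<theta> * x\<^sup>2)))"
proof -
  let ?q = "sqrt (1 + 2*\<theta>)"
  have q: "0 < ?q" "?q\<^sup>2 = 1 + 2*\<theta>" using assms by auto
  have "distributed std_gauss lborel (\<lambda>x. x) (normal_density 0 1)"
    unfolding distributed_def std_gauss_def by (auto simp: distr_id2)
  from gauss.normal_density_affine[OF this, of "1/?q" 0]
  have "distributed std_gauss lborel (\<lambda>x. x/?q) (normal_density 0 (1/?q))"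
    using q by simp
  then have "distr std_gauss lborel (\<lambda>x. x/?q) = density lborel (normal_density 0 (1/?q))"
    unfolding distributed_def by auto
  also have "normal_density 0 (1/?q) = (\<lambda>x. std_normal_density x * (?q * exp (- \<theta> * x\<^sup>2)))"
  proof
    fix x
    have e: "- x\<^sup>2 / (2 * (1/?q)\<^sup>2) = - x\<^sup>2 / 2 + - \<theta> * x\<^sup>2"
      using q(2) by (simp add: power_divide field_simps del: real_sqrt_pow2 real_sqrt_pow2_iff)
    have s: "sqrt (2 * pi * (1/?q)\<^sup>2) = sqrt (2*pi) / ?q"
      using q(1) by (simp add: real_sqrt_mult power_divide real_sqrt_divide)
    show "normal_density 0 (1/?q) x = std_normal_density x * (?q * exp (- \<theta> * x\<^sup>2))"
      unfolding normal_density_def s diff_0_right e exp_add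
      using q(1) by (simp add: field_simps)
  qed
  finally have "distr std_gauss lborel (\<lambda>x. x/?q) =
      density lborel (\<lambda>x. ennreal (std_normal_density x * (?q * exp (- \<theta> * x\<^sup>2))))" .
  also have "\<dots> = density std_gauss (\<lambda>x. ennreal (?q * exp (- \<theta> * x\<^sup>2)))"
    unfolding std_gauss_def by (subst density_density_eq) (auto simp: ennreal_mult' q)
  finally show ?thesis
    by (simp cong: distr_cong)
qed

text \<open>The energy is a sum over coordinates, so \<open>std_gauss_scale\<close> tensorises:
  tilting a Gaussian vector by its energy is a mere change of radius.\<close>

lemma gauss_vec_scale:
  assumes "-1/2 < \<theta>"
  shows "distr (gauss_vec n) (gauss_vec n) (\<lambda>g. restrict (\<lambda>i. g i / sqrt (1 + 2*\<theta>)) {..<n}) =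
    density (gauss_vec n) (\<lambda>g. ennreal (sqrt (1 + 2*\<theta>) ^ n * exp (- \<theta> * sqnorm n g)))"
proof -
  let ?q = "sqrt (1 + 2*\<theta>)"
  let ?f = "\<lambda>x. ennreal (?q * exp (- \<theta> * x\<^sup>2))"
  have q: "0 \<le> ?q" using assms by auto
  \<comment> \<open>Sigma-finiteness of the tilted factor, needed to identify the product measure on
    rectangles, holds because the factor is the law of a rescaled Gaussian.\<close>
  interpret D: product_sigma_finite "\<lambda>_::nat. density std_gauss ?f"
  proof (rule product_sigma_finite.intro)
    fix i :: nat
    have "prob_space (density std_gauss ?f)"
      unfolding std_gauss_scale[OF assms, symmetric] by (rule gauss.prob_space_distr) simp
    then show "sigma_finite_measure (density std_gauss ?f)"
      by (simp add: prob_space_imp_sigma_finite)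
  qed
  have "distr (gauss_vec n) (gauss_vec n) (compose {..<n} (\<lambda>x. x / ?q)) =
      PiM {..<n} (\<lambda>_. distr std_gauss std_gauss (\<lambda>x. x / ?q))"
    by (rule distr_PiM_finite_prob_space') (auto intro: std_gauss_prob)
  also have "\<dots> = PiM {..<n} (\<lambda>_. density std_gauss ?f)"
    by (simp only: std_gauss_scale[OF assms])
  also have "\<dots> = density (gauss_vec n) (\<lambda>g. ennreal (?q ^ n * exp (- \<theta> * sqnorm n g)))"
  proof (rule D.PiM_eqI[symmetric])
    show "finite {..<n}" by simp
    show "sets (density (gauss_vec n) (\<lambda>g. ennreal (?q ^ n * exp (- \<theta> * sqnorm n g)))) =
        sets (PiM {..<n} (\<lambda>_. density std_gauss ?f))"
      unfolding sets_density by (rule sets_PiM_cong) simp_all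
    fix A :: "nat \<Rightarrow> real set"
    assume A: "\<And>i. i \<in> {..<n} \<Longrightarrow> A i \<in> sets (density std_gauss ?f)"
    have [measurable]: "Pi\<^sub>E {..<n} A \<in> sets (gauss_vec n)"
      unfolding sets_gauss_vec by (rule sets_PiM_I_finite) (use A in auto)
    have "emeasure (density (gauss_vec n) (\<lambda>g. ennreal (?q ^ n * exp (- \<theta> * sqnorm n g)))) (Pi\<^sub>E {..<n} A)
       = (\<integral>\<^sup>+ g. ennreal (?q ^ n * exp (- \<theta> * sqnorm n g)) * indicator (Pi\<^sub>E {..<n} A) g \<partial>gauss_vec n)"
      by (rule emeasure_density; measurable)
    also have "\<dots> = (\<integral>\<^sup>+ g. (\<Prod>i<n. ?f (g i) * indicator (A i) (g i)) \<partial>gauss_vec n)"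
    proof (rule nn_integral_cong)
      fix g assume "g \<in> space (gauss_vec n)"
      then have "indicator (Pi\<^sub>E {..<n} A) g = (\<Prod>i<n. indicator (A i) (g i) :: ennreal)"
        by (auto simp: space_PiM indicator_def PiE_iff prod_zero_iff split: if_splits)
      moreover have "ennreal (?q ^ n * exp (- \<theta> * sqnorm n g)) = (\<Prod>i<n. ?f (g i))"
        using q by (subst prod_ennreal) (auto simp: sqnorm_def prod.distrib exp_sum sum_distrib_left)
      ultimately show "ennreal (?q ^ n * exp (- \<theta> * sqnorm n g)) * indicator (Pi\<^sub>E {..<n} A) g =
          (\<Prod>i<n. ?f (g i) * indicator (A i) (g i))"
        by (simp add: prod.distrib)
    qed
    also have "\<dots> = (\<Prod>i<n. \<integral>\<^sup>+ x. ?f x * indicator (A i) x \<partial>std_gauss)"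
      using A by (intro gauss_prod.product_nn_integral_prod) auto
    also have "\<dots> = (\<Prod>i<n. emeasure (density std_gauss ?f) (A i))"
      using A by (intro prod.cong refl emeasure_density[symmetric]) auto
    finally show "emeasure (density (gauss_vec n) (\<lambda>g. ennreal (?q ^ n * exp (- \<theta> * sqnorm n g)))) (Pi\<^sub>E {..<n} A)
       = (\<Prod>i<n. emeasure (density std_gauss ?f) (A i))" .
  qed
  finally show ?thesis by (simp add: compose_def[abs_def])
qed

section \<open>Radial moments of a Gaussian vector, weighted by a function of its direction\<close>

definition dirfun :: "nat \<Rightarrow> ((nat \<Rightarrow> real) \<Rightarrow> real) \<Rightarrow> bool" where
  "dirfun n F \<longleftrightarrow> F \<in> borel_measurable (borel_vec n) \<and>
     (\<forall>c>0. \<forall>g. F (restrict (\<lambda>i. g i / c) {..<n}) = F g)"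

text \<open>Independence of radius and direction, in transform form. Rescaling fixes
  \<open>F\<close> and turns the Gaussian law into its tilt, so the Laplace transform of a
  chi-square variable with n degrees of freedom splits off. The case c = 1 of the invariance in
  \<open>dirfun\<close> also makes \<open>F\<close> blind to coordinates outside
  \<open>{..<n}\<close>.\<close>

lemma dirfun_exp_moment:
  assumes F: "dirfun n F" and t: "-1/2 < \<theta>"
  shows "(\<integral>g. F g * exp (- \<theta> * sqnorm n g) \<partial>gauss_vec n) =
      (\<integral>g. F g \<partial>gauss_vec n) / sqrt (1 + 2*\<theta>) ^ n"
    and "integrable (gauss_vec n) F \<Longrightarrow> integrable (gauss_vec n) (\<lambda>g. F g * exp (- \<theta> * sqnorm n g))"
proof -
  let ?q = "sqrt (1 + 2*\<theta>)"
  let ?S = "\<lambda>g. restrict (\<lambda>i. g i / ?q) {..<n}"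
  let ?d = "\<lambda>g. ?q ^ n * exp (- \<theta> * sqnorm n g)"
  have q: "0 < ?q" using t by auto
  have [measurable]: "F \<in> borel_measurable (borel_vec n)" using F by (simp add: dirfun_def)
  have S[measurable]: "?S \<in> gauss_vec n \<rightarrow>\<^sub>M gauss_vec n" by measurable
  have inv: "F (?S g) = F g" for g using F q unfolding dirfun_def by blast
  have e: "F g * exp (- \<theta> * sqnorm n g) = (1 / ?q^n) * (?d g * F g)" for g
    using q by simp
  have "(\<integral>g. F g \<partial>gauss_vec n) = (\<integral>g. F (?S g) \<partial>gauss_vec n)" by (simp only: inv)
  also have "\<dots> = (\<integral>g. F g \<partial>distr (gauss_vec n) (gauss_vec n) ?S)"
    by (rule integral_distr[symmetric]) measurable
  also have "\<dots> = (\<integral>g. ?d g * F g \<partial>gauss_vec n)"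
    unfolding gauss_vec_scale[OF t] using q by (subst integral_density) auto
  finally show "(\<integral>g. F g * exp (- \<theta> * sqnorm n g) \<partial>gauss_vec n) =
      (\<integral>g. F g \<partial>gauss_vec n) / sqrt (1 + 2*\<theta>) ^ n"
    unfolding e integral_mult_right_zero by simp
  assume "integrable (gauss_vec n) F"
  then have "integrable (gauss_vec n) (\<lambda>g. F (?S g))" by (simp only: inv)
  then have "integrable (distr (gauss_vec n) (gauss_vec n) ?S) F"
    by (subst integrable_distr_eq) auto
  then have "integrable (gauss_vec n) (\<lambda>g. ?d g * F g)"
    unfolding gauss_vec_scale[OF t] using q by (subst (asm) integrable_density) auto
  then show "integrable (gauss_vec n) (\<lambda>g. F g * exp (- \<theta> * sqnorm n g))"
    unfolding e by (rule integrable_mult_right)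
qed

text \<open>A quadratic lower bound for the logarithm near 1, for both signs because the energy
  deviates both ways; it makes the centred transform of the energy sub-Gaussian.\<close>

lemma exp_le_one_minus:
  fixes x :: real
  assumes "\<bar>x\<bar> \<le> 1/2"
  shows "exp (- x - 2 * x\<^sup>2) \<le> 1 - x"
proof -
  have "- x - 2 * x\<^sup>2 \<le> ln (1 - x)"
  proof (cases "0 \<le> x")
    case True
    then show ?thesis using assms ln_one_minus_pos_lower_bound[of x] by simp
  next
    case False
    then have "- x - (-x)\<^sup>2 \<le> ln (1 + - x)"
      using assms by (intro ln_one_plus_pos_lower_bound) auto
    then have "- x - x\<^sup>2 \<le> ln (1 - x)" by simp
    then show ?thesis using zero_le_power2[of x] by linarith
  qed
  then show ?thesis using assms by (subst (asm) ln_ge_iff) auto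
qed

text \<open>The right-hand side is the square of 2 sinh (x/2), so this is sinh y >= y for y >= 0. It
  bounds a second moment by exponential moments of both signs.\<close>

lemma square_le_exp_sum: "(x::real)\<^sup>2 \<le> exp x + exp (- x) - 2"
proof -
  have pos: "(2*y)\<^sup>2 \<le> exp (2*y) + exp (- (2*y)) - 2" if y: "0 \<le> y" for y :: real
  proof -
    have 1: "1 + y + y\<^sup>2 / 2 \<le> exp y" by (rule exp_lower_Taylor_quadratic[OF y])
    have p: "0 < 1 + y + y\<^sup>2/2" using y by (simp add: add_pos_nonneg)
    \<comment> \<open>The product equals 1 + y^4 / 4.\<close>
    have "1 \<le> (1 + y + y\<^sup>2/2) * (1 - y + y\<^sup>2/2)"
      using y by (simp add: algebra_simps power2_eq_square)
    then have "1 / (1 + y + y\<^sup>2/2) \<le> 1 - y + y\<^sup>2/2"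
      using p by (simp add: divide_le_eq mult.commute)
    moreover have "exp (- y) \<le> 1 / (1 + y + y\<^sup>2/2)"
      unfolding exp_minus inverse_eq_divide using 1 p by (intro divide_left_mono) auto
    ultimately have "2 * y \<le> exp y - exp (- y)" using 1 by simp
    then have "(2*y)\<^sup>2 \<le> (exp y - exp (- y))\<^sup>2" using y by (intro power_mono) auto
    also have "\<dots> = exp (2*y) + exp (- (2*y)) - 2"
      by (simp add: power2_eq_square algebra_simps flip: exp_add)
    finally show ?thesis .
  qed
  show ?thesis
    using pos[of "x/2"] pos[of "- x/2"] by (cases "0 \<le> x") auto
qed

lemma dirfun_exp_centered:
  fixes n :: nat and \<theta> :: real
  assumes F: "dirfun n F" "\<And>g. 0 \<le> F g" "integrable (gauss_vec n) F" and t: "\<bar>\<theta>\<bar> \<le> 1/4"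
  shows "(\<integral>g. F g * exp (\<theta> * (sqnorm n g - n)) \<partial>gauss_vec n) \<le>
      exp (4 * n * \<theta>\<^sup>2) * (\<integral>g. F g \<partial>gauss_vec n)"
    and "integrable (gauss_vec n) (\<lambda>g. F g * exp (\<theta> * (sqnorm n g - n)))"
proof -
  let ?q = "sqrt (1 + 2 * (- \<theta>))"
  have q: "0 < ?q" using t by (auto simp: abs_le_iff)
  have e: "F g * exp (\<theta> * (sqnorm n g - n)) =
      exp (- \<theta> * n) * (F g * exp (- (- \<theta>) * sqnorm n g))" for g
    by (simp add: algebra_simps flip: exp_add)
  have t': "-1/2 < - \<theta>" using t by linarith
  show "integrable (gauss_vec n) (\<lambda>g. F g * exp (\<theta> * (sqnorm n g - n)))"
    unfolding e by (intro integrable_mult_right dirfun_exp_moment(2)[OF F(1) t'] F(3))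
  \<comment> \<open>One coordinate: after squaring, this is \<open>exp_le_one_minus\<close> at 2
    \<theta>. The n-th power yields the factor exp (4 n \<theta>^2).\<close>
  have "exp (- \<theta>) \<le> exp (4 * \<theta>\<^sup>2) * ?q"
  proof (rule power2_le_imp_le)
    have "exp (- (2*\<theta>) - 2 * (2*\<theta>)\<^sup>2) \<le> 1 - 2*\<theta>"
      by (rule exp_le_one_minus) (use t in auto)
    then have "exp (8*\<theta>\<^sup>2) * exp (- (2*\<theta>) - 2 * (2*\<theta>)\<^sup>2) \<le> exp (8*\<theta>\<^sup>2) * (1 - 2*\<theta>)"
      by (rule mult_left_mono) simp
    then have "exp (- (2*\<theta>)) \<le> exp (8*\<theta>\<^sup>2) * (1 - 2*\<theta>)"
      by (simp add: power_mult_distrib flip: exp_add)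
    moreover have "?q\<^sup>2 = 1 - 2*\<theta>" using q by simp
    ultimately show "(exp (- \<theta>))\<^sup>2 \<le> (exp (4 * \<theta>\<^sup>2) * ?q)\<^sup>2"
      by (simp add: power_mult_distrib flip: exp_double del: real_sqrt_pow2_iff)
  qed (use q in simp)
  then have "exp (- \<theta>) / ?q \<le> exp (4 * \<theta>\<^sup>2)" using q by (simp add: divide_le_eq)
  then have "(exp (- \<theta>) / ?q) ^ n \<le> exp (4 * \<theta>\<^sup>2) ^ n"
    by (rule power_mono) (use q in simp)
  then have le: "exp (- \<theta> * n) / ?q ^ n \<le> exp (4 * n * \<theta>\<^sup>2)"
    by (simp add: power_divide mult_ac flip: exp_of_nat_mult)
  have "(\<integral>g. F g * exp (\<theta> * (sqnorm n g - n)) \<partial>gauss_vec n) =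
      exp (- \<theta> * n) * ((\<integral>g. F g \<partial>gauss_vec n) / ?q ^ n)"
    unfolding e integral_mult_right_zero dirfun_exp_moment(1)[OF F(1) t'] ..
  also have "\<dots> = (exp (- \<theta> * n) / ?q ^ n) * (\<integral>g. F g \<partial>gauss_vec n)" by simp
  also have "\<dots> \<le> exp (4 * n * \<theta>\<^sup>2) * (\<integral>g. F g \<partial>gauss_vec n)"
    by (rule mult_right_mono[OF le]) (simp add: F(2))
  finally show "(\<integral>g. F g * exp (\<theta> * (sqnorm n g - n)) \<partial>gauss_vec n) \<le>
      exp (4 * n * \<theta>\<^sup>2) * (\<integral>g. F g \<partial>gauss_vec n)" .
qed

lemma dirfun_second_moment:
  fixes n :: nat
  assumes F: "dirfun n F" "\<And>g. 0 \<le> F g" "integrable (gauss_vec n) F" and n: "0 < n"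
  shows "integrable (gauss_vec n) (\<lambda>g. F g * (sqnorm n g - n)\<^sup>2)"
    and "(\<integral>g. F g * (sqnorm n g - n)\<^sup>2 \<partial>gauss_vec n) \<le> 11 * n * (\<integral>g. F g \<partial>gauss_vec n)"
proof -
  note [measurable] = F(1)[unfolded dirfun_def, THEN conjunct1]
  \<comment> \<open>At this scale 4 n \<theta>^2 = 1/4, so the exponentials stay bounded, while
    \<theta>^2 = 1 / (16 n) turns them back into a variance of order n. The constant 11 bounds 16 (2
    exp (1/4) - 2).\<close>
  define \<theta> where "\<theta> = 1 / (4 * sqrt n)"
  have "1 \<le> sqrt n" using n by simp
  then have t: "\<bar>\<theta>\<bar> \<le> 1/4" "\<bar>- \<theta>\<bar> \<le> 1/4" "0 < \<theta>" using n
    by (auto simp: \<theta>_def field_simps abs_if)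
  have t2: "\<theta>\<^sup>2 = 1 / (16 * real n)" "4 * n * \<theta>\<^sup>2 = 1/4"
    using n by (auto simp: \<theta>_def power_divide power_mult_distrib)
  let ?G = "\<lambda>g. (F g * exp (\<theta> * (sqnorm n g - n)) + F g * exp (- \<theta> * (sqnorm n g - n)) - 2 * F g) * (16 * real n)"
  note i1 = dirfun_exp_centered[OF F t(1)] and i2 = dirfun_exp_centered[OF F t(2)]
  have iG: "integrable (gauss_vec n) ?G"
    by (intro Bochner_Integration.integrable_diff Bochner_Integration.integrable_add i1 i2 integrable_mult_left integrable_mult_right F(3))
  have le: "F g * (sqnorm n g - n)\<^sup>2 \<le> ?G g" for g
  proof -
    let ?x = "\<theta> * (sqnorm n g - n)"
    have "?x\<^sup>2 \<le> exp ?x + exp (- ?x) - 2" by (rule square_le_exp_sum)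
    then have "(sqnorm n g - n)\<^sup>2 \<le> (exp ?x + exp (- ?x) - 2) * (16 * real n)"
    proof -
      have "(sqnorm n g - n)\<^sup>2 = ?x\<^sup>2 * (16 * real n)" using n by (simp add: power_mult_distrib t2)
      also have "\<dots> \<le> (exp ?x + exp (- ?x) - 2) * (16 * real n)"
        using \<open>?x\<^sup>2 \<le> _\<close> by (rule mult_right_mono) simp
      finally show ?thesis .
    qed
    then have "F g * (sqnorm n g - n)\<^sup>2 \<le> F g * ((exp ?x + exp (- ?x) - 2) * (16 * real n))"
      by (rule mult_left_mono) (rule F)
    then show ?thesis by (simp add: algebra_simps)
  qed
  show i: "integrable (gauss_vec n) (\<lambda>g. F g * (sqnorm n g - n)\<^sup>2)"
  proof (rule Bochner_Integration.integrable_bound[OF iG])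
    show "AE g in gauss_vec n. norm (F g * (sqnorm n g - n)\<^sup>2) \<le> norm (?G g)"
    proof (rule AE_I2)
      fix g
      have "0 \<le> F g * (sqnorm n g - n)\<^sup>2" by (simp add: F)
      then show "norm (F g * (sqnorm n g - n)\<^sup>2) \<le> norm (?G g)"
        using le[of g] by (simp only: real_norm_def abs_of_nonneg order_trans)
    qed
  qed measurable
  let ?E = "\<integral>g. F g \<partial>gauss_vec n"
  have E: "0 \<le> ?E" by (simp add: F)
  have ex: "exp (1/4::real) \<le> 1 + 1/4 + (1/4)\<^sup>2" by (rule exp_bound) auto
  have "(\<integral>g. F g * (sqnorm n g - n)\<^sup>2 \<partial>gauss_vec n) \<le> (\<integral>g. ?G g \<partial>gauss_vec n)"
    by (rule integral_mono[OF i iG le])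
  also have "\<dots> = ((\<integral>g. F g * exp (\<theta> * (sqnorm n g - n)) \<partial>gauss_vec n) +
      (\<integral>g. F g * exp (- \<theta> * (sqnorm n g - n)) \<partial>gauss_vec n) - 2 * ?E) * (16 * real n)"
    using i1(2) i2(2) F(3) by simp
  also have "\<dots> \<le> (exp (1/4) * ?E + exp (1/4) * ?E - 2 * ?E) * (16 * real n)"
    using i1(1) i2(1) unfolding power2_minus t2(2)
    by (intro mult_right_mono diff_right_mono add_mono) auto
  also have "\<dots> = (2 * exp (1/4) - 2) * ?E * (16 * real n)" by (simp add: algebra_simps)
  also have "\<dots> \<le> (11/16) * ?E * (16 * real n)"
    using ex E by (intro mult_right_mono) (auto simp: power2_eq_square)
  finally show "(\<integral>g. F g * (sqnorm n g - n)\<^sup>2 \<partial>gauss_vec n) \<le> 11 * n * ?E" by simp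
qed

text \<open>As radius and direction are independent, the weighted mean is in fact 0. A constant is
  enough, and it follows from 1 + x <= exp x at \<theta> = 1 / (4 n) and its negative, where the
  transform exceeds 1 by O(1/n) only.\<close>

lemma dirfun_first_moment:
  fixes n :: nat
  assumes F: "dirfun n F" "\<And>g. 0 \<le> F g" "integrable (gauss_vec n) F" and n: "0 < n"
  shows "integrable (gauss_vec n) (\<lambda>g. F g * (sqnorm n g - n))"
    and "\<bar>\<integral>g. F g * (sqnorm n g - n) \<partial>gauss_vec n\<bar> \<le> 2 * (\<integral>g. F g \<partial>gauss_vec n)"
proof -
  note [measurable] = F(1)[unfolded dirfun_def, THEN conjunct1]
  let ?E = "\<integral>g. F g \<partial>gauss_vec n"
  have E: "0 \<le> ?E" by (simp add: F)
  show i: "integrable (gauss_vec n) (\<lambda>g. F g * (sqnorm n g - n))"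
  proof (rule Bochner_Integration.integrable_bound)
    show "integrable (gauss_vec n) (\<lambda>g. F g + F g * (sqnorm n g - n)\<^sup>2)"
      by (intro Bochner_Integration.integrable_add F(3) dirfun_second_moment[OF F n])
    show "AE g in gauss_vec n. norm (F g * (sqnorm n g - n)) \<le> norm (F g + F g * (sqnorm n g - n)\<^sup>2)"
    proof (rule AE_I2)
      fix g
      have a: "\<bar>x\<bar> \<le> 1 + x\<^sup>2" for x :: real
        using zero_le_power2[of "\<bar>x\<bar> - 1"] by (simp add: power2_diff)
      have "F g * \<bar>sqnorm n g - n\<bar> \<le> F g * (1 + (sqnorm n g - n)\<^sup>2)"
        by (intro mult_left_mono a F)
      moreover have "0 \<le> F g + F g * (sqnorm n g - n)\<^sup>2" by (simp add: F)
      ultimately show "norm (F g * (sqnorm n g - n)) \<le> norm (F g + F g * (sqnorm n g - n)\<^sup>2)"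
        using F(2)[of g] by (simp add: abs_mult distrib_left)
    qed
  qed measurable
  have key: "\<theta> * (\<integral>g. F g * (sqnorm n g - n) \<partial>gauss_vec n) \<le> 2 / (4*real n) * ?E"
    if t: "\<bar>\<theta>\<bar> = 1 / (4*real n)" for \<theta> :: real
  proof -
    have t': "\<bar>\<theta>\<bar> \<le> 1/4" unfolding t using n by (simp add: field_simps)
    have "\<bar>\<theta>\<bar>\<^sup>2 = (1 / (4*real n))\<^sup>2" by (simp only: t)
    then have t2: "4 * n * \<theta>\<^sup>2 = 1 / (4*real n)" using n by (simp add: power2_eq_square)
    note i1 = dirfun_exp_centered[OF F t']
    have "\<theta> * (\<integral>g. F g * (sqnorm n g - n) \<partial>gauss_vec n) = (\<integral>g. \<theta> * (F g * (sqnorm n g - n)) \<partial>gauss_vec n)"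
      by simp
    also have "\<dots> \<le> (\<integral>g. F g * exp (\<theta> * (sqnorm n g - n)) - F g \<partial>gauss_vec n)"
    proof (rule integral_mono)
      fix g
      have "F g * (1 + \<theta> * (sqnorm n g - n)) \<le> F g * exp (\<theta> * (sqnorm n g - n))"
        by (intro mult_left_mono exp_ge_add_one_self F)
      then show "\<theta> * (F g * (sqnorm n g - n)) \<le> F g * exp (\<theta> * (sqnorm n g - n)) - F g"
        by (simp add: algebra_simps)
    qed (use i i1(2) F(3) in auto)
    also have "\<dots> = (\<integral>g. F g * exp (\<theta> * (sqnorm n g - n)) \<partial>gauss_vec n) - ?E"
      using i1(2) F(3) by simp
    also have "\<dots> \<le> exp (1/(4*real n)) * ?E - ?E" using i1(1) t2 by simp
    also have "\<dots> = (exp (1/(4*real n)) - 1) * ?E" by (simp add: algebra_simps)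
    also have "\<dots> \<le> (2 / (4*real n)) * ?E"
    proof (rule mult_right_mono[OF _ E])
      let ?x = "1/(4*real n)"
      have x: "0 \<le> ?x" "?x \<le> 1" using n by (auto simp: field_simps)
      have "exp ?x \<le> 1 + ?x + ?x\<^sup>2" by (rule exp_bound[OF x])
      moreover have "?x\<^sup>2 \<le> ?x" unfolding power2_eq_square by (rule mult_left_le[OF x(2) x(1)])
      ultimately show "exp ?x - 1 \<le> 2 / (4*real n)" by simp
    qed
    finally show ?thesis .
  qed
  have "1/(4*real n) * (\<integral>g. F g * (sqnorm n g - n) \<partial>gauss_vec n) \<le> 2 / (4*real n) * ?E"
    "- (1/(4*real n)) * (\<integral>g. F g * (sqnorm n g - n) \<partial>gauss_vec n) \<le> 2 / (4*real n) * ?E"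
    using key[of "1/(4*real n)"] key[of "- (1/(4*real n))"] by simp_all
  then show "\<bar>\<integral>g. F g * (sqnorm n g - n) \<partial>gauss_vec n\<bar> \<le> 2 * ?E"
    using n by (simp add: field_simps abs_le_iff)
qed

text \<open>The relative radius has mean 1 + O(1/n) although it fluctuates by 1 / sqrt n. This gain
  keeps the comparison with the sphere bounded, since the radius multiplies inner products that may
  be of order n.\<close>

lemma dirfun_radius:
  fixes n :: nat
  assumes F: "dirfun n F" "\<And>g. 0 \<le> F g" "integrable (gauss_vec n) F" and n: "0 < n"
  shows "integrable (gauss_vec n) (\<lambda>g. F g * (sqrt (sqnorm n g / n) - 1))"
    and "- (7/n) * (\<integral>g. F g \<partial>gauss_vec n) \<le> (\<integral>g. F g * (sqrt (sqnorm n g / n) - 1) \<partial>gauss_vec n)"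
    and "(\<integral>g. F g * (sqrt (sqnorm n g / n) - 1) \<partial>gauss_vec n) \<le> (1/n) * (\<integral>g. F g \<partial>gauss_vec n)"
proof -
  note [measurable] = F(1)[unfolded dirfun_def, THEN conjunct1]
  let ?E = "\<integral>g. F g \<partial>gauss_vec n"
  have E: "0 \<le> ?E" by (simp add: F)
  let ?r = "\<lambda>g. sqrt (sqnorm n g / n) - 1"
  let ?U = "\<lambda>g. F g * (sqnorm n g - n) * (1 / (2*real n))"
  let ?L = "\<lambda>g. F g * (sqnorm n g - n) * (1 / (2*real n)) - F g * (sqnorm n g - n)\<^sup>2 * (1 / (2*(real n)\<^sup>2))"
  note m1 = dirfun_first_moment[OF F n] and m2 = dirfun_second_moment[OF F n]
  have iU: "integrable (gauss_vec n) ?U" using m1 by simp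
  have iL: "integrable (gauss_vec n) ?L" using m1 m2 by simp
  \<comment> \<open>Bounds by polynomials in r^2 that touch r at 1, so that only the energy enters.
    With r^2 = 1 + u they read 1 + u/2 - u^2/2 <= r <= 1 + u/2.\<close>
  have tang: "(3 * r\<^sup>2 - (r\<^sup>2)\<^sup>2) / 2 \<le> r" "r \<le> (1 + r\<^sup>2)/2" if "0 \<le> r" for r :: real
  proof -
    have "0 \<le> r * (r - 1)\<^sup>2 * (r + 2) / 2" using that by simp
    also have "\<dots> = r - (3 * r\<^sup>2 - (r\<^sup>2)\<^sup>2) / 2"
      by (simp add: power2_eq_square field_simps)
    finally show "(3 * r\<^sup>2 - (r\<^sup>2)\<^sup>2) / 2 \<le> r" by simp
    show "r \<le> (1 + r\<^sup>2)/2" using zero_le_power2[of "r - 1"] by (simp add: power2_diff)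
  qed
  have bd: "?L g \<le> F g * ?r g" "F g * ?r g \<le> ?U g" for g
  proof -
    define u where "u = (sqnorm n g - n) / n"
    have u: "(sqrt (sqnorm n g / n))\<^sup>2 = 1 + u" using n by (simp add: u_def field_simps)
    have r0: "0 \<le> sqrt (sqnorm n g / n)" by simp
    note tt = tang[OF r0, unfolded u]
    have "u/2 - u\<^sup>2/2 \<le> ?r g" using tt(1) by (simp add: power2_eq_square field_simps)
    then have "F g * (u/2 - u\<^sup>2/2) \<le> F g * ?r g" by (rule mult_left_mono) (rule F)
    moreover have "F g * (u/2 - u\<^sup>2/2) = ?L g"
      by (simp add: u_def power_divide field_simps)
    ultimately show "?L g \<le> F g * ?r g" by simp
    have "?r g \<le> u/2" using tt(2) by simp
    then have "F g * ?r g \<le> F g * (u/2)" by (rule mult_left_mono) (rule F)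
    then show "F g * ?r g \<le> ?U g" by (simp add: u_def)
  qed
  show i: "integrable (gauss_vec n) (\<lambda>g. F g * ?r g)"
  proof (rule Bochner_Integration.integrable_bound)
    show "integrable (gauss_vec n) (\<lambda>g. \<bar>?L g\<bar> + \<bar>?U g\<bar>)"
      by (intro Bochner_Integration.integrable_add integrable_abs iL iU)
    show "AE g in gauss_vec n. norm (F g * ?r g) \<le> norm (\<bar>?L g\<bar> + \<bar>?U g\<bar>)"
    proof (rule AE_I2)
      fix g show "norm (F g * ?r g) \<le> norm (\<bar>?L g\<bar> + \<bar>?U g\<bar>)"
        using bd[of g] unfolding real_norm_def by linarith
    qed
  qed measurable
  \<comment> \<open>Here 13 = 2 + 11 collects the constants of the first and of the second
    moment.\<close>
  have "- (7/n) * ?E \<le> - (13/(2*real n)) * ?E"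
    using E n by (intro mult_right_mono) (auto simp: field_simps)
  also have "\<dots> = (- 2 * ?E) * (1/(2*real n)) - (11 * n * ?E) * (1/(2*(real n)\<^sup>2))"
    using n by (simp add: field_simps power2_eq_square)
  also have "\<dots> \<le> (\<integral>g. F g * (sqnorm n g - n) \<partial>gauss_vec n) * (1/(2*real n)) -
      (\<integral>g. F g * (sqnorm n g - n)\<^sup>2 \<partial>gauss_vec n) * (1/(2*(real n)\<^sup>2))"
    using m1(2) m2(2) by (intro diff_mono mult_right_mono) (auto simp: abs_le_iff)
  also have "\<dots> = (\<integral>g. ?L g \<partial>gauss_vec n)" using m1(1) m2(1) by simp
  also have "\<dots> \<le> (\<integral>g. F g * ?r g \<partial>gauss_vec n)" by (rule integral_mono[OF iL i bd(1)])
  finally show "- (7/n) * ?E \<le> (\<integral>g. F g * ?r g \<partial>gauss_vec n)" .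
  have "(\<integral>g. F g * ?r g \<partial>gauss_vec n) \<le> (\<integral>g. ?U g \<partial>gauss_vec n)" by (rule integral_mono[OF i iU bd(2)])
  also have "\<dots> = (\<integral>g. F g * (sqnorm n g - n) \<partial>gauss_vec n) * (1/(2*real n))" by simp
  also have "\<dots> \<le> (2 * ?E) * (1/(2*real n))"
    using m1(2) by (intro mult_right_mono) (auto simp: abs_le_iff)
  finally show "(\<integral>g. F g * ?r g \<partial>gauss_vec n) \<le> (1/n) * ?E" by simp
qed

section \<open>Chernoff integrals for Gaussian and for spherical codewords\<close>

lemma gauss_quadratic:
  assumes s: "0 \<le> s" and b: "0 \<le> b"
  shows "(\<integral>x. exp (- s * (c - sqrt b * x)\<^sup>2) \<partial>std_gauss) = exp (- s * c\<^sup>2 / (1 + 2 * s * b)) / sqrt (1 + 2 * s * b)"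
proof -
  define q where "q = 1 + 2 * s * b"
  have q: "0 < q" using s b by (simp add: q_def add_pos_nonneg)
  \<comment> \<open>Completing the square: the integrand is a multiple of the normal density with
    mean m and variance 1/q.\<close>
  define m where "m = 2 * s * sqrt b * c / q"
  have "std_normal_density x * exp (- s * (c - sqrt b * x)\<^sup>2) =
      exp (- s * c\<^sup>2 / q) / sqrt q * normal_density m (1 / sqrt q) x" for x
  proof -
    have bb: "sqrt b * sqrt b = b" using b by simp
    have "(x - m)\<^sup>2 * q = q * x\<^sup>2 - 2 * x * (2 * s * sqrt b * c) + (2 * s * sqrt b * c)\<^sup>2 / q"
      using q unfolding m_def by (simp add: power2_eq_square field_simps)
    also have "(2 * s * sqrt b * c)\<^sup>2 = 2 * s * c\<^sup>2 * (q - 1)"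
      using b by (simp add: power2_eq_square q_def algebra_simps bb)
    also have "2 * s * c\<^sup>2 * (q - 1) / q = 2 * s * c\<^sup>2 - 2 * s * c\<^sup>2 / q"
      using q by (simp add: field_simps)
    finally have "(x - m)\<^sup>2 * q = x\<^sup>2 + 2 * s * (c - sqrt b * x)\<^sup>2 - 2 * s * c\<^sup>2 / q"
      using b by (simp add: q_def power2_eq_square algebra_simps bb)
    then have e: "- x\<^sup>2 / 2 + - s * (c - sqrt b * x)\<^sup>2 = - s * c\<^sup>2 / q + - (x - m)\<^sup>2 / (2 * (1 / sqrt q)\<^sup>2)"
      using q by (simp add: power_divide field_simps)
    have sq: "sqrt (2 * pi * (1 / sqrt q)\<^sup>2) = sqrt (2 * pi) / sqrt q"
      using q by (simp add: real_sqrt_mult power_divide real_sqrt_divide)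
    have "std_normal_density x * exp (- s * (c - sqrt b * x)\<^sup>2) =
        1 / sqrt (2 * pi) * exp (- x\<^sup>2 / 2 + - s * (c - sqrt b * x)\<^sup>2)"
      by (simp add: normal_density_def flip: exp_add)
    also have "\<dots> = exp (- s * c\<^sup>2 / q) / sqrt q * normal_density m (1 / sqrt q) x"
      unfolding e exp_add normal_density_def sq using q by simp
    finally show ?thesis .
  qed
  then have "(\<integral>x. std_normal_density x * exp (- s * (c - sqrt b * x)\<^sup>2) \<partial>lborel) = exp (- s * c\<^sup>2 / q) / sqrt q"
    using q by (simp add: integral_normal_density)
  then show ?thesis
    unfolding std_gauss_def q_def by (subst integral_density) auto
qed

lemma gauss_vec_quadratic:
  assumes s: "0 \<le> s" and b: "0 \<le> b"
  shows "(\<integral>g. exp (- s * sqnorm n (\<lambda>i. y i - sqrt b * g i)) \<partial>gauss_vec n) =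
      exp (- s * sqnorm n y / (1 + 2 * s * b)) / sqrt (1 + 2 * s * b) ^ n"
proof -
  have "(\<integral>g. exp (- s * sqnorm n (\<lambda>i. y i - sqrt b * g i)) \<partial>gauss_vec n) =
      (\<integral>g. (\<Prod>i<n. exp (- s * (y i - sqrt b * g i)\<^sup>2)) \<partial>gauss_vec n)"
    by (simp add: sqnorm_def sum_distrib_left exp_sum flip: sum_negf)
  also have "\<dots> = (\<Prod>i<n. \<integral>x. exp (- s * (y i - sqrt b * x)\<^sup>2) \<partial>std_gauss)"
  proof (rule gauss_prod.product_integral_prod)
    fix i
    show "integrable std_gauss (\<lambda>x. exp (- s * (y i - sqrt b * x)\<^sup>2))"
      by (rule gauss.integrable_const_bound[where B = 1]) (use s in auto)
  qed simp
  also have "\<dots> = (\<Prod>i<n. exp (- s * (y i)\<^sup>2 / (1 + 2 * s * b)) / sqrt (1 + 2 * s * b))"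
    by (simp only: gauss_quadratic[OF s b])
  also have "\<dots> = exp (- s * sqnorm n y / (1 + 2 * s * b)) / sqrt (1 + 2 * s * b) ^ n"
    by (simp add: prod_dividef sqnorm_def sum_distrib_left sum_divide_distrib exp_sum flip: sum_negf)
  finally show ?thesis .
qed

text \<open>At zero energy \<open>sph\<close> divides by 0 and returns the zero vector instead of a
  point of the sphere, so exact energy identities hold only off this null set.\<close>

lemma AE_sqnorm_gauss_vec_nonzero:
  assumes "0 < n" shows "AE g in gauss_vec n. sqnorm n g \<noteq> 0"
proof -
  have "AE x in std_gauss. x \<noteq> 0"
    unfolding std_gauss_def by (subst AE_density) (auto intro: AE_mp[OF AE_lborel_singleton[of 0]])
  then have "AE g in gauss_vec n. g 0 \<noteq> 0"
    using assms by (intro AE_PiM_component) (auto intro: std_gauss_prob)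
  then show ?thesis
  proof eventually_elim
    case (elim g)
    have "(g 0)\<^sup>2 \<le> sqnorm n g" unfolding sqnorm_def
      using assms by (intro member_le_sum) auto
    then show ?case using elim by auto
  qed
qed

text \<open>Jensen's inequality for exp under the unnormalised measure with density
  \<open>F\<close>, from the tangent line at m; no division by the mass of \<open>F\<close>
  occurs.\<close>

lemma exp_tangent_integral:
  fixes F X :: "'a \<Rightarrow> real"
  assumes F: "\<And>x. 0 \<le> F x" "integrable M F" and FX: "integrable M (\<lambda>x. F x * X x)"
    and FeX: "integrable M (\<lambda>x. F x * exp (X x))"
    and m: "m * (\<integral>x. F x \<partial>M) \<le> (\<integral>x. F x * X x \<partial>M)"
  shows "exp m * (\<integral>x. F x \<partial>M) \<le> (\<integral>x. F x * exp (X x) \<partial>M)"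
proof -
  have "exp m * (\<integral>x. F x \<partial>M) \<le> exp m * ((1 - m) * (\<integral>x. F x \<partial>M) + (\<integral>x. F x * X x \<partial>M))"
    using m by (intro mult_left_mono) (auto simp: algebra_simps)
  also have "\<dots> = (\<integral>x. exp m * ((1 - m) * F x + F x * X x) \<partial>M)"
    using F FX by simp
  also have "\<dots> \<le> (\<integral>x. F x * exp (X x) \<partial>M)"
  proof (rule integral_mono)
    fix x
    have "exp m * (1 + (X x - m)) \<le> exp m * exp (X x - m)"
      by (intro mult_left_mono exp_ge_add_one_self) simp
    also have "\<dots> = exp (X x)" by (simp flip: exp_add)
    finally have "F x * (exp m * (1 + (X x - m))) \<le> F x * exp (X x)"
      by (rule mult_left_mono) (rule F)
    then show "exp m * ((1 - m) * F x + F x * X x) \<le> F x * exp (X x)"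
      by (simp add: algebra_simps)
  qed (use F FX FeX in auto)
  finally show ?thesis .
qed

lemma sqrt_le_one_plus: "0 \<le> x \<Longrightarrow> sqrt x \<le> 1 + x"
  by (rule real_le_lsqrt) (auto simp: power2_sum)

text \<open>The part 2 b stems from the energy (\<open>dirfun_first_moment\<close>). The part 30 =
  2*7*2 + 2*1 stems from the radius: \<open>dirfun_radius\<close> is applied to a weight of mass at
  most 2 B times that of \<open>F\<close>, and to \<open>F\<close> itself, where B is an upper bound
  of the inner products.\<close>

definition sph_const :: "real \<Rightarrow> real \<Rightarrow> real" where
  "sph_const s b = s * (2 * b + 30 * sqrt b)"

text \<open>Conditionally on its direction, a Gaussian vector has expected radius \<open>sqrt n - O(1 / sqrt n)\<close>;
  by Jensen's inequality the sphere therefore loses only a constant factor against the Gaussian law.\<close>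

lemma sphere_exp_integral:
  fixes n :: nat and s b :: real
  assumes n: "0 < n" and s: "0 \<le> s" and b: "0 \<le> b"
  shows "(\<integral>g. exp (- s * sqnorm n (\<lambda>i. y i - sph n (sqrt (n * b)) g i)) \<partial>gauss_vec n) \<le>
    exp (sph_const s b * (1 + sqnorm n y / n)) * (exp (- s * sqnorm n y / (1 + 2 * s * b)) / sqrt (1 + 2 * s * b) ^ n)"
proof -
  define B where "B = sqrt (n * b) * sqrt (sqnorm n y)"
  define p where "p g = dot n y (sph n (sqrt (n * b)) g)" for g
  \<comment> \<open>\<open>F\<close> is the integrand on the sphere and \<open>X\<close> is what the
    exponent gains when the vector keeps its own radius, so that \<open>F g * exp (X g)\<close> is
    the Gaussian integrand.\<close>
  define F where "F g = exp (- s * (sqnorm n y + n * b - 2 * p g))" for g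
  define r where "r g = sqrt (sqnorm n g / n)" for g
  define X where "X g = - s * (b * (sqnorm n g - n) - 2 * (r g - 1) * p g)" for g
  have B0: "0 \<le> B" using b by (simp add: B_def)
  have [measurable]: "p \<in> borel_measurable (borel_vec n)" unfolding p_def by measurable
  have [measurable]: "F \<in> borel_measurable (borel_vec n)" unfolding F_def by measurable
  have [measurable]: "X \<in> borel_measurable (borel_vec n)" unfolding X_def r_def by measurable
  have pB: "\<bar>p g\<bar> \<le> B" for g
  proof -
    have "\<bar>p g\<bar> \<le> sqrt (sqnorm n y) * sqrt (sqnorm n (sph n (sqrt (n * b)) g))"
      unfolding p_def by (rule dot_le)
    also have "\<dots> \<le> sqrt (sqnorm n y) * sqrt (n * b)"
      using b by (intro mult_left_mono real_sqrt_le_mono) (auto simp: sqnorm_sph)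
    finally show ?thesis by (simp add: B_def mult.commute)
  qed
  have p_inv: "p (restrict (\<lambda>i. g i / c) {..<n}) = p g" if "0 < c" for c g
    unfolding p_def sph_scale[OF that] ..
  have dF: "dirfun n F" unfolding dirfun_def F_def using p_inv by simp
  \<comment> \<open>The inner product \<open>p\<close> changes sign, while the radial bounds want a
    nonnegative weight. Adding its bound B repairs this, and the surplus is treated with the weight
    \<open>F\<close>.\<close>
  have dG: "dirfun n (\<lambda>g. F g * (p g + B))"
    unfolding dirfun_def F_def using p_inv by simp
  have F0: "0 \<le> F g" for g by (simp add: F_def)
  have G0: "0 \<le> F g * (p g + B)" for g using pB[of g] F0[of g] by (auto simp: abs_le_iff)
  have Fle: "F g \<le> exp (s * (2 * B))" for g
  proof -
    have "s * (2 * p g) \<le> s * (2 * B)" using pB[of g] s by (intro mult_left_mono) (auto simp: abs_le_iff)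
    moreover have "0 \<le> s * (sqnorm n y + n * b)" using s b by simp
    ultimately show ?thesis unfolding F_def by (simp add: algebra_simps)
  qed
  have iF: "integrable (gauss_vec n) F"
    by (rule gv.integrable_const_bound[where B = "exp (s * (2 * B))"]) (use Fle F0 in auto)
  have iG: "integrable (gauss_vec n) (\<lambda>g. F g * (p g + B))"
  proof (rule gv.integrable_const_bound[where B = "exp (s * (2 * B)) * (2 * B)"])
    show "AE g in gauss_vec n. norm (F g * (p g + B)) \<le> exp (s * (2 * B)) * (2 * B)"
    proof (rule AE_I2)
      fix g
      have "F g * (p g + B) \<le> exp (s * (2 * B)) * (2 * B)"
        using Fle[of g] pB[of g] F0[of g] by (intro mult_mono) (auto simp: abs_le_iff)
      then show "norm (F g * (p g + B)) \<le> exp (s * (2 * B)) * (2 * B)"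
        using G0[of g] by simp
    qed
  qed measurable
  let ?E = "\<integral>g. F g \<partial>gauss_vec n"
  have E: "0 \<le> ?E" by (simp add: F0)
  have sq_expand: "sqnorm n (\<lambda>i. y i - sqrt b * g i) = sqnorm n y + n * b - 2 * p g - X g / s"
    if "s \<noteq> 0" for g
  proof -
    have rp: "r g * p g = sqrt b * dot n y g"
    proof (cases "sqnorm n g = 0")
      case True
      then have "dot n y g = 0" using dot_eq_0[of n g y] by (simp add: dot_commute)
      then show ?thesis using True by (simp add: r_def)
    next
      case False
      then show ?thesis using n unfolding r_def p_def dot_sph
        by (simp add: real_sqrt_divide real_sqrt_mult)
    qed
    have d: "dot n y (\<lambda>i. sqrt b * g i) = sqrt b * dot n y g"
      by (simp add: dot_def sum_distrib_left mult_ac)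
    have "X g = s * (- (b * (sqnorm n g - n)) + 2 * (r g * p g) - 2 * p g)"
      unfolding X_def by (simp add: algebra_simps)
    then have "X g / s = - (b * (sqnorm n g - n)) + 2 * (r g * p g) - 2 * p g"
      using that by simp
    then show ?thesis unfolding sqnorm_diff sqnorm_scale d rp using b by (simp add: algebra_simps)
  qed
  have FeX: "F g * exp (X g) = exp (- s * sqnorm n (\<lambda>i. y i - sqrt b * g i))" for g
  proof (cases "s = 0")
    case True then show ?thesis by (simp add: F_def X_def)
  next
    case False
    then show ?thesis unfolding sq_expand[OF False] F_def
      by (simp add: algebra_simps flip: exp_add)
  qed
  have "exp (- (sph_const s b * (1 + sqnorm n y / n))) * ?E \<le> (\<integral>g. F g * exp (X g) \<partial>gauss_vec n)"
  proof (rule exp_tangent_integral[OF F0 iF])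
    show "integrable (gauss_vec n) (\<lambda>g. F g * exp (X g))"
      unfolding FeX by (rule gv.integrable_const_bound[where B = 1]) (use s in auto)
    note m1 = dirfun_first_moment[OF dF F0 iF n]
    note rF = dirfun_radius[OF dF F0 iF n, folded r_def]
    note rG = dirfun_radius[OF dG G0 iG n, folded r_def]
    have FXe: "F g * X g = - s * b * (F g * (sqnorm n g - n)) +
        2 * s * (F g * (p g + B) * (r g - 1)) - 2 * s * B * (F g * (r g - 1))" for g
      unfolding X_def by (simp add: algebra_simps)
    show "integrable (gauss_vec n) (\<lambda>g. F g * X g)"
      unfolding FXe using m1 rF rG by simp
    have IG: "(\<integral>g. F g * (p g + B) \<partial>gauss_vec n) \<le> 2 * B * ?E"
    proof -
      have "(\<integral>g. F g * (p g + B) \<partial>gauss_vec n) \<le> (\<integral>g. 2 * B * F g \<partial>gauss_vec n)"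
      proof (rule integral_mono[OF iG])
        fix g
        have "F g * (p g + B) \<le> F g * (2 * B)"
          using pB[of g] F0[of g] by (intro mult_left_mono) (auto simp: abs_le_iff)
        then show "F g * (p g + B) \<le> 2 * B * F g" by (simp add: mult_ac)
      qed (use iF in simp)
      then show ?thesis by simp
    qed
    have Bn: "B / n \<le> sqrt b * (1 + sqnorm n y / n)"
    proof -
      have "B / n = sqrt b * sqrt (sqnorm n y / n)"
        using n by (simp add: B_def real_sqrt_mult real_sqrt_divide field_simps)
      also have "sqrt (sqnorm n y / n) \<le> 1 + sqnorm n y / n"
        by (rule sqrt_le_one_plus) simp
      then have "sqrt b * sqrt (sqnorm n y / n) \<le> sqrt b * (1 + sqnorm n y / n)"
        by (rule mult_left_mono) (use b in simp)
      finally show ?thesis .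
    qed
    have "- (sph_const s b * (1 + sqnorm n y / n)) * ?E \<le> - (s * b * 2 + 30 * s * (B / n)) * ?E"
    proof (rule mult_right_mono[OF _ E])
      have "s * b * 2 + 30 * s * (B / n) \<le> s * b * 2 * (1 + sqnorm n y / n) + 30 * s * (sqrt b * (1 + sqnorm n y / n))"
      proof (rule add_mono)
        have "s * b * 2 * 1 \<le> s * b * 2 * (1 + sqnorm n y / n)"
          by (rule mult_left_mono) (use s b in auto)
        then show "s * b * 2 \<le> s * b * 2 * (1 + sqnorm n y / n)" by simp
        show "30 * s * (B / n) \<le> 30 * s * (sqrt b * (1 + sqnorm n y / n))"
          by (rule mult_left_mono[OF Bn]) (use s in simp)
      qed
      also have "\<dots> = sph_const s b * (1 + sqnorm n y / n)"
        by (simp add: sph_const_def algebra_simps)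
      finally show "- (sph_const s b * (1 + sqnorm n y / n)) \<le> - (s * b * 2 + 30 * s * (B / n))" by simp
    qed
    also have "\<dots> = - s * b * (2 * ?E) + 2 * s * (- (7/n) * (2 * B * ?E)) - 2 * s * B * ((1/n) * ?E)"
      by (simp add: algebra_simps)
    also have "\<dots> \<le> - s * b * (\<integral>g. F g * (sqnorm n g - n) \<partial>gauss_vec n) +
        2 * s * (\<integral>g. F g * (p g + B) * (r g - 1) \<partial>gauss_vec n) -
        2 * s * B * (\<integral>g. F g * (r g - 1) \<partial>gauss_vec n)"
    proof (intro diff_mono add_mono)
      show "- s * b * (2 * ?E) \<le> - s * b * (\<integral>g. F g * (sqnorm n g - n) \<partial>gauss_vec n)"
        using m1(2) s b by (intro mult_left_mono_neg) (auto simp: abs_le_iff)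
      have "- (7/n) * (2 * B * ?E) \<le> - (7/n) * (\<integral>g. F g * (p g + B) \<partial>gauss_vec n)"
        by (rule mult_left_mono_neg[OF IG]) simp
      also note rG(2)
      finally show "2 * s * (- (7/n) * (2 * B * ?E)) \<le> 2 * s * (\<integral>g. F g * (p g + B) * (r g - 1) \<partial>gauss_vec n)"
        by (rule mult_left_mono) (use s in simp)
      show "2 * s * B * (\<integral>g. F g * (r g - 1) \<partial>gauss_vec n) \<le> 2 * s * B * ((1/n) * ?E)"
        by (rule mult_left_mono[OF rF(3)]) (use s B0 in simp)
    qed
    also have "\<dots> = (\<integral>g. F g * X g \<partial>gauss_vec n)"
      unfolding FXe using m1(1) rF(1) rG(1) by simp
    finally show "- (sph_const s b * (1 + sqnorm n y / n)) * ?E \<le> (\<integral>g. F g * X g \<partial>gauss_vec n)" .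
  qed
  then have "exp (sph_const s b * (1 + sqnorm n y / n)) * (exp (- (sph_const s b * (1 + sqnorm n y / n))) * ?E) \<le>
      exp (sph_const s b * (1 + sqnorm n y / n)) * (\<integral>g. F g * exp (X g) \<partial>gauss_vec n)"
    by (rule mult_left_mono) simp
  then have "?E \<le> exp (sph_const s b * (1 + sqnorm n y / n)) * (\<integral>g. F g * exp (X g) \<partial>gauss_vec n)"
    by (simp flip: mult.assoc exp_add)
  moreover have "(\<integral>g. exp (- s * sqnorm n (\<lambda>i. y i - sph n (sqrt (n * b)) g i)) \<partial>gauss_vec n) = ?E"
  proof (rule integral_cong_AE)
    show "AE g in gauss_vec n. exp (- s * sqnorm n (\<lambda>i. y i - sph n (sqrt (n * b)) g i)) = F g"
      using AE_sqnorm_gauss_vec_nonzero[OF n]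
    proof eventually_elim
      case (elim g)
      then show ?case using b by (simp add: F_def p_def sqnorm_diff sqnorm_sph)
    qed
  qed measurable
  ultimately show ?thesis unfolding FeX gauss_vec_quadratic[OF s b] by simp
qed

section \<open>Probability that random wrong codewords beat a given residual\<close>

lemma sets_sphere_unif [simp, measurable_cong]: "sets (sphere_unif n r) = sets (borel_vec n)"
  by (simp add: sphere_unif_eq)

lemma space_sphere_unif [simp]: "space (sphere_unif n r) = space (borel_vec n)"
  by (simp add: sphere_unif_eq)

lemma prob_sphere_unif: "prob_space (sphere_unif n r)"
  unfolding sphere_unif_eq by (rule gv.prob_space_distr) simp

interpretation sp: prob_space "sphere_unif n r" for n r by (rule prob_sphere_unif)

lemma AE_sqnorm_sphere_le:
  fixes b :: real
  assumes "0 \<le> b" shows "AE u in sphere_unif n (sqrt (n * b)). sqnorm n u \<le> n * b"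
  unfolding sphere_unif_eq by (subst AE_distr_iff) (use assms in \<open>auto simp: sqnorm_sph\<close>)

lemma sphere_exp_nn_integral:
  fixes n :: nat and s b :: real
  assumes n: "0 < n" and s: "0 \<le> s" and b: "0 \<le> b"
  shows "(\<integral>\<^sup>+u. ennreal (exp (- s * sqnorm n (\<lambda>i. y i - u i))) \<partial>sphere_unif n (sqrt (n * b))) \<le>
    ennreal (exp (sph_const s b * (1 + sqnorm n y / n)) * (exp (- s * sqnorm n y / (1 + 2 * s * b)) / sqrt (1 + 2 * s * b) ^ n))"
proof -
  have "(\<integral>\<^sup>+u. ennreal (exp (- s * sqnorm n (\<lambda>i. y i - u i))) \<partial>sphere_unif n (sqrt (n * b))) =
      (\<integral>\<^sup>+g. ennreal (exp (- s * sqnorm n (\<lambda>i. y i - sph n (sqrt (n * b)) g i))) \<partial>gauss_vec n)"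
    unfolding sphere_unif_eq by (rule nn_integral_distr) measurable
  also have "\<dots> = ennreal (\<integral>g. exp (- s * sqnorm n (\<lambda>i. y i - sph n (sqrt (n * b)) g i)) \<partial>gauss_vec n)"
    by (intro nn_integral_eq_integral gv.integrable_const_bound[where B = 1]) (use s in auto)
  finally show ?thesis
    using sphere_exp_integral[OF assms, of y] by (simp add: ennreal_leI)
qed

text \<open>The logarithm of the ratio of the Gaussian likelihoods of an output of energy \<open>Y\<close>
  with residual of energy \<open>W\<close>, when noise of power \<open>\<tau>\<close> is added to a codeword of power \<open>b\<close>.\<close>

definition info :: "nat \<Rightarrow> real \<Rightarrow> real \<Rightarrow> real \<Rightarrow> real \<Rightarrow> real" where
  "info n \<tau> b Y W = n * Ccap (b / \<tau>) + Y / (2 * (\<tau> + b)) - W / (2 * \<tau>)"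

lemma sqrt_power_Ccap:
  assumes "0 \<le> x" shows "sqrt (1 + x) ^ n = exp (n * Ccap x)"
proof -
  have "sqrt (1 + x) = exp (Ccap x)"
    using assms by (simp add: Ccap_def powr_half_sqrt[symmetric] powr_def)
  then show ?thesis by (simp add: exp_of_nat_mult)
qed

text \<open>For the Chernoff parameter s = 1 / (2 \<tau>) one has 1 + 2 s b = 1 + b / \<tau>, and
  the Gaussian transform becomes exactly a likelihood ratio; this is how \<open>info\<close>
  arises.\<close>

lemma exp_gaussian_factor:
  assumes "0 < \<tau>" "0 \<le> b"
  shows "exp (W / (2*\<tau>)) * (exp (- (1/(2*\<tau>)) * Y / (1 + 2 * (1/(2*\<tau>)) * b)) / sqrt (1 + 2 * (1/(2*\<tau>)) * b) ^ n) =
    exp (- info n \<tau> b Y W)"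
proof -
  have q: "1 + 2 * (1/(2*\<tau>)) * b = 1 + b / \<tau>" "0 \<le> b / \<tau>" using assms by auto
  have t: "2 * (\<tau> + b) \<noteq> 0" using assms by auto
  have y: "- (1/(2*\<tau>)) * Y / (1 + b/\<tau>) = - (Y / (2 * (\<tau> + b)))"
  proof -
    have "1 + b/\<tau> = (2 * (\<tau> + b)) / (2 * \<tau>)" using assms by (simp add: field_simps)
    then show ?thesis using assms t by simp
  qed
  show ?thesis unfolding q(1) y sqrt_power_Ccap[OF q(2)] info_def
    by (simp add: exp_diff exp_minus exp_add field_simps)
qed

lemma emeasure_le_exp:
  fixes s N :: real
  assumes [measurable]: "f \<in> borel_measurable M" and s: "0 \<le> s"
  shows "emeasure M {u\<in>space M. f u \<le> N} \<le> (\<integral>\<^sup>+u. ennreal (exp (s * N)) * ennreal (exp (- s * f u)) \<partial>M)"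
proof -
  have "emeasure M {u\<in>space M. f u \<le> N} = (\<integral>\<^sup>+u. indicator {u\<in>space M. f u \<le> N} u \<partial>M)"
    by (rule nn_integral_indicator[symmetric]) measurable
  also have "\<dots> \<le> (\<integral>\<^sup>+u. ennreal (exp (s * N)) * ennreal (exp (- s * f u)) \<partial>M)"
  proof (rule nn_integral_mono)
    fix u
    show "indicator {u\<in>space M. f u \<le> N} u \<le> ennreal (exp (s * N)) * ennreal (exp (- s * f u))"
    proof (cases "f u \<le> N")
      case True
      then have "s * f u \<le> s * N" using s by (rule mult_left_mono)
      then have "1 \<le> exp (s * N) * exp (- s * f u)" by (simp flip: exp_add)
      then show ?thesis by (auto simp: indicator_def simp flip: ennreal_mult)
    qed simp
  qed
  finally show ?thesis .
qed

text \<open>By rotation invariance the output enters through its energy only, so typicality of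
  energies is all that later steps have to know about it.\<close>

lemma sphere_error:
  fixes n :: nat and \<tau> b :: real
  assumes n: "0 < n" and t: "0 < \<tau>" and b: "0 \<le> b"
  shows "emeasure (sphere_unif n (sqrt (n * b))) {u \<in> space (borel_vec n). sqnorm n (\<lambda>i. y i - u i) \<le> W} \<le>
    ennreal (exp (sph_const (1/(2*\<tau>)) b * (1 + sqnorm n y / n) - info n \<tau> b (sqnorm n y) W))"
proof -
  let ?s = "1/(2*\<tau>)"
  let ?C = "exp (sph_const ?s b * (1 + sqnorm n y / n))"
  let ?D = "exp (- ?s * sqnorm n y / (1 + 2 * ?s * b)) / sqrt (1 + 2 * ?s * b) ^ n"
  have s: "0 \<le> ?s" using t by simp
  have "emeasure (sphere_unif n (sqrt (n * b))) {u \<in> space (sphere_unif n (sqrt (n * b))). sqnorm n (\<lambda>i. y i - u i) \<le> W} \<le>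
     (\<integral>\<^sup>+u. ennreal (exp (?s * W)) * ennreal (exp (- ?s * sqnorm n (\<lambda>i. y i - u i))) \<partial>sphere_unif n (sqrt (n * b)))"
    by (rule emeasure_le_exp[OF _ s]) measurable
  also have "\<dots> = ennreal (exp (?s * W)) * (\<integral>\<^sup>+u. ennreal (exp (- ?s * sqnorm n (\<lambda>i. y i - u i))) \<partial>sphere_unif n (sqrt (n * b)))"
    by (rule nn_integral_cmult) measurable
  also have "\<dots> \<le> ennreal (exp (?s * W)) * ennreal (?C * ?D)"
    by (intro mult_left_mono sphere_exp_nn_integral[OF n s b]) simp
  also have "\<dots> = ennreal (?C * (exp (W/(2*\<tau>)) * ?D))"
    using t b by (subst ennreal_mult[symmetric]) (auto simp: mult_ac)
  also have "\<dots> = ennreal (exp (sph_const ?s b * (1 + sqnorm n y / n) - info n \<tau> b (sqnorm n y) W))"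
    unfolding exp_gaussian_factor[OF t b] by (simp flip: exp_add)
  finally show ?thesis by simp
qed

text \<open>First summand: the constant of the inner sphere, where the energy of y - v is replaced
  by twice those of y and v. Second summand: the outer sphere, whose effective noise power is \<tau>
  + b.\<close>

definition sph_const2 :: "real \<Rightarrow> real \<Rightarrow> real \<Rightarrow> real" where
  "sph_const2 \<tau> a b = 2 * sph_const (1/(2*\<tau>)) b * (1 + a) + sph_const (1/(2*(\<tau>+b))) a"

lemma sph_const_nonneg: "0 \<le> s \<Longrightarrow> 0 \<le> b \<Longrightarrow> 0 \<le> sph_const s b"
  by (simp add: sph_const_def)

text \<open>The factors 1 + b / \<tau> and 1 + a / (\<tau> + b) telescope. This is the chain rule of
  mutual information for two superposed Gaussian signals, of which the one of power a sees the other
  as noise.\<close>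

lemma Ccap_add:
  assumes t: "0 < \<tau>" and b: "0 \<le> b" and a: "0 \<le> a"
  shows "Ccap ((b + a) / \<tau>) = Ccap (b / \<tau>) + Ccap (a / (\<tau> + b))"
proof -
  have t': "0 < \<tau> + b" using t b by simp
  have q: "1 + b/\<tau> = (\<tau> + b)/\<tau>" "1 + a/(\<tau>+b) = (\<tau> + b + a)/(\<tau> + b)"
    using t t' by (simp_all add: add_divide_distrib)
  have "1 + (b+a)/\<tau> = (1 + b/\<tau>) * (1 + a/(\<tau>+b))"
  proof -
    have "(\<tau> + b)/\<tau> * ((\<tau> + b + a)/(\<tau> + b)) = (\<tau> + b + a)/\<tau>" using t' by simp
    then show ?thesis unfolding q using t by (simp add: add_divide_distrib)
  qed
  moreover have "0 < 1 + b/\<tau>" "0 < 1 + a/(\<tau>+b)" using t t' a b by (auto intro: add_pos_nonneg)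
  ultimately show ?thesis by (simp add: Ccap_def ln_mult)
qed

text \<open>Given v, \<open>sphere_error\<close> for the output y - v bounds the inner probability
  by an exponential of the energy of y - v. That is again a Chernoff integrand, now for noise power
  \<tau> + b, and the two information densities add up by \<open>Ccap_add\<close>.\<close>

lemma sphere_error2:
  fixes n :: nat and \<tau> a b :: real
  assumes n: "0 < n" and t: "0 < \<tau>" and a: "0 \<le> a" and b: "0 \<le> b"
  shows "(\<integral>\<^sup>+v. emeasure (sphere_unif n (sqrt (n * b)))
       {u \<in> space (borel_vec n). sqnorm n (\<lambda>i. y i - v i - u i) \<le> W} \<partial>sphere_unif n (sqrt (n * a))) \<le>
    ennreal (exp (sph_const2 \<tau> a b * (1 + sqnorm n y / n) - info n \<tau> (b + a) (sqnorm n y) W))"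
proof -
  let ?K = "sph_const (1/(2*\<tau>)) b" and ?K' = "sph_const (1/(2*(\<tau>+b))) a"
  have t': "0 < \<tau> + b" using t b by simp
  have K: "0 \<le> ?K" using t b by (intro sph_const_nonneg) auto
  have split: "info n \<tau> b Y W = info n \<tau> (b + a) Z W + Y / (2*(\<tau>+b)) - Z / (2 * (\<tau> + b + a)) - n * Ccap (a / (\<tau> + b))" for Y Z
  proof -
    show ?thesis using Ccap_add[OF t b a] by (simp add: info_def algebra_simps)
  qed
  have "(\<integral>\<^sup>+v. emeasure (sphere_unif n (sqrt (n * b)))
       {u \<in> space (borel_vec n). sqnorm n (\<lambda>i. y i - v i - u i) \<le> W} \<partial>sphere_unif n (sqrt (n * a))) \<le>
    (\<integral>\<^sup>+v. ennreal (exp (2 * ?K * (1 + a) * (1 + sqnorm n y / n) - info n \<tau> b 0 W)) *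
       ennreal (exp (- (1/(2*(\<tau>+b))) * sqnorm n (\<lambda>i. y i - v i))) \<partial>sphere_unif n (sqrt (n * a)))"
  proof (rule nn_integral_mono_AE, use AE_sqnorm_sphere_le[OF a] in eventually_elim)
    case (elim v)
    let ?y = "\<lambda>i. y i - v i"
    have "sqnorm n ?y / n \<le> (2 * sqnorm n y + 2 * (n * a)) / n"
      using sqnorm_diff_le[of n y v] elim by (intro divide_right_mono) auto
    also have "\<dots> = 2 * (sqnorm n y / n) + 2 * a" using n by (simp add: field_simps)
    finally have **: "1 + sqnorm n ?y / n \<le> 1 + 2 * (sqnorm n y / n) + 2 * a" by simp
    have "1 + 2 * e + 2 * a \<le> 2 * ((1 + a) * (1 + e))" if "0 \<le> e" for e :: real
      using a that mult_nonneg_nonneg[OF a that] by (simp add: algebra_simps)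
    from this[of "sqnorm n y / n"]
    have *: "1 + 2 * (sqnorm n y / n) + 2 * a \<le> 2 * ((1 + a) * (1 + sqnorm n y / n))" by simp
    have "1 + sqnorm n ?y / n \<le> 2 * ((1 + a) * (1 + sqnorm n y / n))"
      using ** * by (rule order_trans)
    then have "?K * (1 + sqnorm n ?y / n) \<le> ?K * (2 * ((1 + a) * (1 + sqnorm n y / n)))"
      using K by (rule mult_left_mono)
    then have "?K * (1 + sqnorm n ?y / n) - info n \<tau> b (sqnorm n ?y) W \<le>
        (2 * ?K * (1 + a) * (1 + sqnorm n y / n) - info n \<tau> b 0 W) + - (1/(2*(\<tau>+b))) * sqnorm n ?y"
    proof -
      have "?K * (2 * ((1 + a) * (1 + sqnorm n y / n))) = 2 * ?K * (1 + a) * (1 + sqnorm n y / n)"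
        by (simp only: mult_ac)
      moreover have "info n \<tau> b (sqnorm n ?y) W = info n \<tau> b 0 W + 1/(2*(\<tau>+b)) * sqnorm n ?y"
        by (simp add: info_def)
      ultimately show ?thesis using \<open>?K * (1 + sqnorm n ?y / n) \<le> _\<close> by linarith
    qed
    then have "exp (?K * (1 + sqnorm n ?y / n) - info n \<tau> b (sqnorm n ?y) W) \<le>
        exp (2 * ?K * (1 + a) * (1 + sqnorm n y / n) - info n \<tau> b 0 W) * exp (- (1/(2*(\<tau>+b))) * sqnorm n ?y)"
      by (subst exp_add[symmetric]) simp
    then show ?case
      by (intro order_trans[OF sphere_error[OF n t b]]) (simp add: ennreal_leI flip: ennreal_mult)
  qed
  also have "\<dots> = ennreal (exp (2 * ?K * (1 + a) * (1 + sqnorm n y / n) - info n \<tau> b 0 W)) *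
      (\<integral>\<^sup>+v. ennreal (exp (- (1/(2*(\<tau>+b))) * sqnorm n (\<lambda>i. y i - v i))) \<partial>sphere_unif n (sqrt (n * a)))"
    by (rule nn_integral_cmult) measurable
  also have "\<dots> \<le> ennreal (exp (2 * ?K * (1 + a) * (1 + sqnorm n y / n) - info n \<tau> b 0 W)) *
      ennreal (exp (?K' * (1 + sqnorm n y / n)) * exp (- info n (\<tau> + b) a (sqnorm n y) 0))"
  proof (intro mult_left_mono)
    show "(\<integral>\<^sup>+v. ennreal (exp (- (1/(2*(\<tau>+b))) * sqnorm n (\<lambda>i. y i - v i))) \<partial>sphere_unif n (sqrt (n * a)))
      \<le> ennreal (exp (?K' * (1 + sqnorm n y / n)) * exp (- info n (\<tau> + b) a (sqnorm n y) 0))"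
      using sphere_exp_nn_integral[OF n _ a, of "1/(2*(\<tau>+b))" y] t'
      by (simp add: exp_gaussian_factor[OF t' a, of 0, simplified])
  qed simp
  also have "\<dots> = ennreal (exp (sph_const2 \<tau> a b * (1 + sqnorm n y / n) - info n \<tau> (b + a) (sqnorm n y) W))"
    unfolding split[of 0 "sqnorm n y"]
    by (simp add: sph_const2_def info_def algebra_simps flip: ennreal_mult exp_add)
  finally show ?thesis .
qed

subsection \<open>Bounds by sections\<close>

lemma (in prob_space) nn_integral_le_const':
  assumes "\<And>x. x \<in> space M \<Longrightarrow> f x \<le> c" shows "(\<integral>\<^sup>+x. f x \<partial>M) \<le> c"
proof -
  have "(\<integral>\<^sup>+x. f x \<partial>M) \<le> (\<integral>\<^sup>+x. c \<partial>M)" by (rule nn_integral_mono) (rule assms)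
  then show ?thesis by (simp add: emeasure_space_1)
qed

lemma nn_integral_codebook_le:
  assumes w: "w < M" and f[measurable]: "f \<in> borel_measurable (codebook n M pw)"
    and le: "\<And>v. v \<in> space (PiM ({..<M} - {w}) (\<lambda>_. borel_vec n)) \<Longrightarrow>
      (\<integral>\<^sup>+x. f (v(w := x)) \<partial>sphere_unif n (sqrt (n * pw))) \<le> c"
  shows "(\<integral>\<^sup>+v. f v \<partial>codebook n M pw) \<le> c"
proof -
  let ?S = "sphere_unif n (sqrt (n * pw))"
  interpret P: product_prob_space "\<lambda>_::nat. ?S" UNIV by standard
  interpret R: prob_space "PiM ({..<M} - {w}) (\<lambda>_. ?S)"
    by (rule prob_space_PiM) (rule prob_sphere_unif)
  have I: "insert w ({..<M} - {w}) = {..<M}" using w by auto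
  have f': "f \<in> borel_measurable (PiM (insert w ({..<M} - {w})) (\<lambda>_. ?S))"
    using f unfolding I codebook_def .
  have "(\<integral>\<^sup>+v. f v \<partial>codebook n M pw) = (\<integral>\<^sup>+v. f v \<partial>PiM (insert w ({..<M} - {w})) (\<lambda>_. ?S))"
    unfolding I codebook_def ..
  also have "\<dots> = (\<integral>\<^sup>+v. (\<integral>\<^sup>+x. f (v(w := x)) \<partial>?S) \<partial>PiM ({..<M} - {w}) (\<lambda>_. ?S))"
    by (rule P.product_nn_integral_insert) (use f' in simp_all)
  also have "\<dots> \<le> c"
    by (rule R.nn_integral_le_const') (rule le, simp add: space_PiM)
  finally show ?thesis .
qed

lemma prob_codebook: "prob_space (codebook n M pw)"
  unfolding codebook_def by (rule prob_space_PiM) (rule prob_sphere_unif)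

lemma sets_codebook [simp, measurable_cong]: "sets (codebook n M pw) = sets (PiM {..<M} (\<lambda>_. borel_vec n))"
  unfolding codebook_def by (rule sets_PiM_cong) simp_all

lemma distr_codebook: "w < M \<Longrightarrow> distr (codebook n M pw) (borel_vec n) (\<lambda>v. v w) = sphere_unif n (sqrt (n * pw))"
proof -
  assume "w < M"
  then have "distr (codebook n M pw) (sphere_unif n (sqrt (n * pw))) (\<lambda>v. v w) = sphere_unif n (sqrt (n * pw))"
    unfolding codebook_def by (intro distr_PiM_component) (auto intro: prob_sphere_unif)
  then show ?thesis by (simp cong: distr_cong)
qed

section \<open>The Gaussian tail function and its inverse\<close>

lemma std_gauss_isCont: "isCont (cdf std_gauss) x"
proof -
  interpret real_distribution std_gauss by standard (simp_all)
  have "emeasure std_gauss {x} = 0"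
    unfolding std_gauss_def by (subst emeasure_density) (auto intro!: nn_integral_0_iff_AE[THEN iffD2]
        AE_mp[OF AE_lborel_singleton[of x]])
  then show ?thesis by (simp add: isCont_cdf measure_def)
qed

lemma Qfun_cdf: "Qfun x = 1 - cdf std_gauss x"
proof -
  have "{x<..} = space std_gauss - {..x}" by auto
  then show ?thesis unfolding Qfun_def cdf_def
    using gauss.prob_compl[of "{..x}"] by simp
qed

lemma cdf_minus: "cdf std_gauss (- x) = Qfun x"
proof -
  interpret real_distribution std_gauss by standard (simp_all)
  have "distributed std_gauss lborel (\<lambda>x. x) (normal_density 0 1)"
    unfolding distributed_def std_gauss_def by (auto simp: distr_id2)
  from gauss.normal_density_affine[OF this, of "-1" 0]
  have "distr std_gauss lborel uminus = std_gauss"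
    unfolding distributed_def std_gauss_def by (auto simp: fun_eq_iff)
  then have "measure std_gauss {..<-x} = measure (distr std_gauss lborel uminus) {..<-x}" by simp
  also have "\<dots> = measure std_gauss (uminus -` {..<-x} \<inter> space std_gauss)"
    by (rule measure_distr) auto
  also have "uminus -` {..<-x} \<inter> space std_gauss = {x<..}" by auto
  finally have 1: "measure std_gauss {..<-x} = Qfun x" by (simp add: Qfun_def)
  \<comment> \<open>The lower tail contains its end point while \<open>Qfun\<close> omits it; the
    point has measure 0.\<close>
  have "{..-x} = {..<-x} \<union> {-x}" by auto
  then have "measure std_gauss {..-x} = measure std_gauss {..<-x} + measure std_gauss {-x}"
    by (simp only:) (rule gauss.finite_measure_Union; auto)
  also have "measure std_gauss {-x} = 0" using std_gauss_isCont[of "-x"] isCont_cdf by blast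
  finally show ?thesis using 1 by (simp add: cdf_def)
qed

lemma Qfun_strict_antimono:
  assumes xy: "x < y" shows "Qfun y < Qfun x"
proof -
  have pos: "ennreal (std_normal_density t) \<noteq> 0" for t
  proof -
    have "0 < std_normal_density t" by (rule normal_density_pos) simp
    then show ?thesis by (simp only: ennreal_eq_0_iff not_le)
  qed
  have "emeasure std_gauss {x<..y} \<noteq> 0"
  proof
    assume "emeasure std_gauss {x<..y} = 0"
    moreover have "emeasure std_gauss {x<..y} = (\<integral>\<^sup>+t. ennreal (std_normal_density t) * indicator {x<..y} t \<partial>lborel)"
      unfolding std_gauss_def by (rule emeasure_density) simp_all
    ultimately have "AE t in lborel. ennreal (std_normal_density t) * indicator {x<..y} t = 0"
      by (simp add: nn_integral_0_iff_AE)
    then have "AE t in lborel. (indicator {x<..y} t :: ennreal) = 0"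
      by eventually_elim (use pos in \<open>simp only: mult_eq_0_iff simp_thms\<close>)
    then have "(\<integral>\<^sup>+t. indicator {x<..y} t \<partial>lborel) = 0"
      by (intro nn_integral_0_iff_AE[THEN iffD2]) simp_all
    then have "emeasure lborel {x<..y} = 0"
      by (subst (asm) nn_integral_indicator) simp_all
    then show False using xy by simp
  qed
  then have "0 < measure std_gauss {x<..y}"
    by (simp add: gauss.emeasure_eq_measure zero_less_measure_iff)
  moreover have "measure std_gauss ({x<..y} \<union> {y<..}) = measure std_gauss {x<..y} + measure std_gauss {y<..}"
    by (rule gauss.finite_measure_Union) auto
  then have "measure std_gauss {x<..} = measure std_gauss {x<..y} + measure std_gauss {y<..}"
    using xy by (simp add: ivl_disj_un)
  ultimately show ?thesis unfolding Qfun_def by linarith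
qed

text \<open>\<open>Qinv\<close> is a definite description: existence is the intermediate value
  theorem for the continuous cdf, uniqueness is strict monotonicity, which comes from the positive
  density.\<close>

lemma Qfun_Qinv:
  assumes "0 < e" "e < 1" shows "Qfun (Qinv e) = e"
proof -
  interpret real_distribution std_gauss by standard (simp_all)
  have "\<forall>\<^sub>F x in at_bot. cdf std_gauss x < 1 - e"
    using cdf_lim_at_bot by (rule order_tendstoD) (use assms in simp)
  then obtain a where a: "cdf std_gauss a < 1 - e" by (auto simp: eventually_at_bot_linorder)
  have "\<forall>\<^sub>F x in at_top. 1 - e < cdf std_gauss x"
    using cdf_lim_at_top_prob by (rule order_tendstoD) (use assms in simp)
  then obtain b where b: "1 - e < cdf std_gauss b" by (auto simp: eventually_at_top_linorder)
  have "a \<le> b" using a b cdf_nondecreasing[of b a] by (rule_tac ccontr) auto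
  then obtain x where "cdf std_gauss x = 1 - e"
    using IVT[of "cdf std_gauss" a "1 - e" b] a b std_gauss_isCont by auto
  then have x: "Qfun x = e" by (simp add: Qfun_cdf)
  show ?thesis unfolding Qinv_def
  proof (rule theI)
    show "Qfun x = e" by (rule x)
    fix z assume "Qfun z = e"
    then show "z = x"
      using x Qfun_strict_antimono[of x z] Qfun_strict_antimono[of z x] by (cases x z rule: linorder_cases) auto
  qed
qed

lemma Qfun_antimono: "x \<le> y \<Longrightarrow> Qfun y \<le> Qfun x"
  using Qfun_strict_antimono[of x y] by (cases "x = y") auto

section \<open>Sums of centred independent variables with a common law\<close>

locale centered_law = prob_space \<nu> for \<nu> :: "real measure" +
  assumes sets_nu [measurable_cong]: "sets \<nu> = sets borel"
    and sq_int: "integrable \<nu> (\<lambda>x. x\<^sup>2)" and mean0: "(\<integral>x. x \<partial>\<nu>) = 0"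
begin

abbreviation "seq \<equiv> PiM UNIV (\<lambda>_::nat. \<nu>)"

lemma prob_seq: "prob_space seq" by (rule prob_space_PiM) (rule prob_space_axioms)

interpretation S: prob_space seq by (rule prob_seq)

lemma int1: "integrable \<nu> (\<lambda>x. x)"
proof (rule square_integrable_imp_integrable)
  show "(\<lambda>x. x) \<in> borel_measurable \<nu>"
    unfolding measurable_cong_sets[OF sets_nu refl] by measurable
qed (rule sq_int)

lemma distr_coord: "distr seq borel (\<lambda>w. w i) = \<nu>"
proof -
  have "distr seq \<nu> (\<lambda>w. w i) = \<nu>" by (rule distr_PiM_component) (auto intro: prob_space_axioms)
  moreover have "distr seq \<nu> (\<lambda>w. w i) = distr seq borel (\<lambda>w. w i)"
    by (rule distr_cong) (auto simp: sets_nu)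
  ultimately show ?thesis by simp
qed

lemma coord_measurable [measurable]: "(\<lambda>w. w i) \<in> borel_measurable seq"
  by measurable

lemma coord_integral:
  fixes f :: "real \<Rightarrow> real"
  assumes [measurable]: "f \<in> borel_measurable borel"
  shows "(\<integral>w. f (w i) \<partial>seq) = (\<integral>x. f x \<partial>\<nu>)" "integrable seq (\<lambda>w. f (w i)) \<longleftrightarrow> integrable \<nu> f"
proof -
  have "(\<integral>x. f x \<partial>distr seq borel (\<lambda>w. w i)) = (\<integral>w. f (w i) \<partial>seq)"
    by (rule integral_distr) (rule coord_measurable, rule assms)
  then show "(\<integral>w. f (w i) \<partial>seq) = (\<integral>x. f x \<partial>\<nu>)" unfolding distr_coord by (rule sym)
  have "integrable (distr seq borel (\<lambda>w. w i)) f \<longleftrightarrow> integrable seq (\<lambda>w. f (w i))"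
    by (rule integrable_distr_eq) (rule coord_measurable, rule assms)
  then show "integrable seq (\<lambda>w. f (w i)) \<longleftrightarrow> integrable \<nu> f" unfolding distr_coord by (rule sym)
qed

lemma indep_coord: "S.indep_vars (\<lambda>_. borel) (\<lambda>i w. w i) UNIV"
proof (subst S.indep_vars_iff_distr_eq_PiM)
  have "distr seq (PiM UNIV (\<lambda>_. borel)) (\<lambda>w. \<lambda>i\<in>UNIV. w i) = seq"
    by (simp add: restrict_UNIV) (rule distr_id2, rule sets_PiM_cong; simp add: sets_nu)
  then show "distr seq (PiM UNIV (\<lambda>_. borel)) (\<lambda>w. \<lambda>i\<in>UNIV. w i) = PiM UNIV (\<lambda>i. distr seq borel (\<lambda>w. w i))"
    by (simp add: distr_coord)
qed simp_all

lemma coord_moments: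
  "integrable seq (\<lambda>w. w i)" "(\<integral>w. w i \<partial>seq) = 0"
  "integrable seq (\<lambda>w. (w i)\<^sup>2)" "(\<integral>w. (w i)\<^sup>2 \<partial>seq) = (\<integral>x. x\<^sup>2 \<partial>\<nu>)"
proof -
  have m: "(\<lambda>x. x) \<in> borel_measurable (borel :: real measure)" "(\<lambda>x. x\<^sup>2) \<in> borel_measurable (borel :: real measure)"
    by measurable
  show "integrable seq (\<lambda>w. w i)" using coord_integral(2)[OF m(1)] int1 by (rule iffD2)
  show "(\<integral>w. w i \<partial>seq) = 0" using coord_integral(1)[OF m(1)] mean0 by (rule trans)
  show "integrable seq (\<lambda>w. (w i)\<^sup>2)" using coord_integral(2)[OF m(2)] sq_int by (rule iffD2)
  show "(\<integral>w. (w i)\<^sup>2 \<partial>seq) = (\<integral>x. x\<^sup>2 \<partial>\<nu>)" by (rule coord_integral(1)[OF m(2)])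
qed

lemma coord_prod_moment:
  assumes "i \<noteq> j"
  shows "integrable seq (\<lambda>w. w i * w j)" "(\<integral>w. w i * w j \<partial>seq) = 0"
proof -
  have ind: "S.indep_vars (\<lambda>_. borel) (\<lambda>i w. w i) {i, j}"
    by (rule S.indep_vars_subset[OF indep_coord]) simp
  have p: "(\<Prod>k\<in>{i, j}. f k) = f i * f j" for f :: "nat \<Rightarrow> real" using assms by simp
  have "integrable seq (\<lambda>w. \<Prod>k\<in>{i, j}. w k)"
    by (rule S.indep_vars_integrable[OF _ ind coord_moments(1)]) simp
  then show "integrable seq (\<lambda>w. w i * w j)" unfolding p .
  have "(\<integral>w. (\<Prod>k\<in>{i, j}. w k) \<partial>seq) = (\<Prod>k\<in>{i, j}. \<integral>w. w k \<partial>seq)"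
    by (rule S.indep_vars_lebesgue_integral[OF _ ind coord_moments(1)]) simp
  then show "(\<integral>w. w i * w j \<partial>seq) = 0" unfolding p coord_moments(2) by (simp only: mult_zero_left)
qed

lemma sum_second_moment:
  shows "integrable seq (\<lambda>w. (\<Sum>i<n. w i)\<^sup>2)"
    and "(\<integral>w. (\<Sum>i<n. w i)\<^sup>2 \<partial>seq) = n * (\<integral>x. x\<^sup>2 \<partial>\<nu>)"
proof -
  let ?v = "\<integral>x. x\<^sup>2 \<partial>\<nu>"
  have ij: "integrable seq (\<lambda>w. w i * w j)" for i j
    using coord_prod_moment(1)[of i j] coord_moments(3)[of i] unfolding power2_eq_square
    by (cases "i = j") simp_all
  have ij': "(\<integral>w. w i * w j \<partial>seq) = (if i = j then ?v else 0)" for i j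
    using coord_prod_moment(2)[of i j] coord_moments(4)[of i, unfolded power2_eq_square[of "_ i"]]
    by (cases "i = j") simp_all
  have e: "(\<Sum>i<n. w i)\<^sup>2 = (\<Sum>i<n. \<Sum>j<n. w i * w j)" for w :: "nat \<Rightarrow> real"
    by (simp add: power2_eq_square sum_product)
  show "integrable seq (\<lambda>w. (\<Sum>i<n. w i)\<^sup>2)" unfolding e
    by (intro Bochner_Integration.integrable_sum ij)
  have "(\<integral>w. (\<Sum>i<n. w i)\<^sup>2 \<partial>seq) = (\<Sum>i<n. \<Sum>j<n. \<integral>w. w i * w j \<partial>seq)"
    unfolding e by (simp only: Bochner_Integration.integral_sum Bochner_Integration.integrable_sum ij)
  also have "\<dots> = n * ?v" unfolding ij' by simp
  finally show "(\<integral>w. (\<Sum>i<n. w i)\<^sup>2 \<partial>seq) = n * ?v" .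
qed

lemma chebyshev_sum:
  assumes c: "0 < c"
  shows "S.prob {w\<in>space seq. c \<le> \<bar>\<Sum>i<n. w i\<bar>} \<le> n * (\<integral>x. x\<^sup>2 \<partial>\<nu>) / c\<^sup>2"
proof -
  have m: "(\<integral>w. (\<Sum>i<n. w i) \<partial>seq) = 0"
    by (simp only: Bochner_Integration.integral_sum coord_moments(1,2) sum.neutral_const)
  have "S.prob {w\<in>space seq. c \<le> \<bar>(\<Sum>i<n. w i) - (\<integral>w. (\<Sum>i<n. w i) \<partial>seq)\<bar>} \<le>
      S.variance (\<lambda>w. \<Sum>i<n. w i) / c\<^sup>2"
    by (rule S.Chebyshev_inequality[OF _ sum_second_moment(1) c]) measurable
  then show ?thesis unfolding m diff_0_right sum_second_moment(2) .
qed

text \<open>A lower tail, since decoding fails when the information density falls short;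
  \<open>cdf_minus\<close> turns it into \<open>Qfun\<close>.\<close>

lemma clt_sum:
  assumes v: "0 < (\<integral>x. x\<^sup>2 \<partial>\<nu>)"
  shows "(\<lambda>n. S.prob {w\<in>space seq. (\<Sum>i<n. w i) \<le> - (sqrt n * L)}) \<longlonglongrightarrow> Qfun (L / sqrt (\<integral>x. x\<^sup>2 \<partial>\<nu>))"
proof -
  define \<sigma> where "\<sigma> = sqrt (\<integral>x. x\<^sup>2 \<partial>\<nu>)"
  have s: "0 < \<sigma>" "\<sigma>\<^sup>2 = (\<integral>x. x\<^sup>2 \<partial>\<nu>)" using v by (auto simp: \<sigma>_def)
  have "weak_conv_m (\<lambda>n. distr seq borel (\<lambda>w. (\<Sum>i<n. w i) / sqrt (n * \<sigma>\<^sup>2))) std_normal_distribution"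
  proof (rule S.central_limit_theorem_zero_mean[OF indep_coord _ s(1)])
    fix n :: nat
    show "(\<integral>w. w n \<partial>seq) = 0" by (rule coord_moments)
    show "S.variance (\<lambda>w. w n) = \<sigma>\<^sup>2" unfolding coord_moments(2) diff_0_right coord_moments(4) s(2) ..
    show "integrable seq (\<lambda>w. (w n)\<^sup>2)" by (rule coord_moments)
    show "distr seq borel (\<lambda>w. w n) = \<nu>" by (rule distr_coord)
  qed
  then have "(\<lambda>n. cdf (distr seq borel (\<lambda>w. (\<Sum>i<n. w i) / sqrt (n * \<sigma>\<^sup>2))) (- (L / \<sigma>))) \<longlonglongrightarrow>
      cdf std_normal_distribution (- (L / \<sigma>))"
    unfolding weak_conv_m_def weak_conv_def by (elim allE impE) (rule std_gauss_isCont[unfolded std_gauss_def])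
  then have "(\<lambda>n. cdf (distr seq borel (\<lambda>w. (\<Sum>i<n. w i) / sqrt (n * \<sigma>\<^sup>2))) (- (L / \<sigma>))) \<longlonglongrightarrow> Qfun (L / \<sigma>)"
    unfolding std_gauss_def[symmetric] cdf_minus .
  then show ?thesis
    unfolding \<sigma>_def[symmetric]
  proof (rule Lim_transform_eventually)
    show "\<forall>\<^sub>F n in sequentially. cdf (distr seq borel (\<lambda>w. (\<Sum>i<n. w i) / sqrt (n * \<sigma>\<^sup>2))) (- (L / \<sigma>)) =
        S.prob {w\<in>space seq. (\<Sum>i<n. w i) \<le> - (sqrt n * L)}"
      \<comment> \<open>At n = 0 the normalisation divides by 0 and the two events may
        differ.\<close>
      using eventually_gt_at_top[of 0]
    proof eventually_elim
      case (elim n)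
      have "x / sqrt (n * \<sigma>\<^sup>2) \<le> - (L / \<sigma>) \<longleftrightarrow> x \<le> - (sqrt n * L)" for x
      proof -
        have d: "0 < sqrt (n * \<sigma>\<^sup>2)" "- (L / \<sigma>) * sqrt (n * \<sigma>\<^sup>2) = - (sqrt n * L)"
          using elim s(1) by (simp_all add: real_sqrt_mult)
        show ?thesis unfolding pos_divide_le_eq[OF d(1)] d(2) ..
      qed
      then have *: "(\<lambda>w. (\<Sum>i<n. w i) / sqrt (n * \<sigma>\<^sup>2)) -` {..- (L / \<sigma>)} \<inter> space seq =
          {w\<in>space seq. (\<Sum>i<n. w i) \<le> - (sqrt n * L)}" by auto
      show ?case unfolding cdf_def *[symmetric] by (rule measure_distr) measurable
    qed
  qed
qed

end

section \<open>Coordinates of the Gaussian triple: moments and joint law\<close>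

lemma integral_pair_product:
  fixes f :: "'a \<Rightarrow> real" and g :: "'b \<Rightarrow> real"
  assumes "sigma_finite_measure M" "sigma_finite_measure N" and f: "integrable M f" and g: "integrable N g"
  shows "integrable (M \<Otimes>\<^sub>M N) (\<lambda>x. f (fst x) * g (snd x))"
    and "(\<integral>x. f (fst x) * g (snd x) \<partial>(M \<Otimes>\<^sub>M N)) = (\<integral>x. f x \<partial>M) * (\<integral>y. g y \<partial>N)"
proof -
  interpret M: sigma_finite_measure M by fact
  interpret N: sigma_finite_measure N by fact
  interpret pair_sigma_finite M N ..
  have [measurable]: "f \<in> borel_measurable M" "g \<in> borel_measurable N" using f g by auto
  show i: "integrable (M \<Otimes>\<^sub>M N) (\<lambda>x. f (fst x) * g (snd x))"
  proof (rule Fubini_integrable)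
    show "integrable M (\<lambda>x. \<integral>y. norm (f (fst (x, y)) * g (snd (x, y))) \<partial>N)"
      using f g by (simp add: abs_mult)
    show "AE x in M. integrable N (\<lambda>y. f (fst (x, y)) * g (snd (x, y)))"
      using g by simp
  qed measurable
  show "(\<integral>x. f (fst x) * g (snd x) \<partial>(M \<Otimes>\<^sub>M N)) = (\<integral>x. f x \<partial>M) * (\<integral>y. g y \<partial>N)"
    using integral_fst'[OF i] by simp
qed

lemma std_gauss_moments:
  "integrable std_gauss (\<lambda>x. x ^ k)"
  "(\<integral>x. x ^ 1 \<partial>std_gauss) = 0" "(\<integral>x. x ^ 2 \<partial>std_gauss) = 1" "(\<integral>x. x ^ 4 \<partial>std_gauss) = 3"
proof -
  show "integrable std_gauss (\<lambda>x. x ^ k)"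
    unfolding std_gauss_def using integrable_std_normal_moment[of k] by (subst integrable_density) auto
  have e: "(\<integral>x. x ^ k \<partial>std_gauss) = (\<integral>x. std_normal_density x * x ^ k \<partial>lborel)" for k
    unfolding std_gauss_def by (subst integral_density) auto
  show "(\<integral>x. x ^ 1 \<partial>std_gauss) = 0" unfolding e using integral_std_normal_moment_odd[of 0] by simp
  show "(\<integral>x. x ^ 2 \<partial>std_gauss) = 1" unfolding e using integral_std_normal_moment_even[of 1] by (simp add: fact_numeral)
  show "(\<integral>x. x ^ 4 \<partial>std_gauss) = 3" unfolding e using integral_std_normal_moment_even[of 2] by (simp add: fact_numeral)
qed

abbreviation "hc \<omega> \<equiv> fst (fst \<omega>)"
abbreviation "gc \<omega> \<equiv> snd (fst \<omega>)"
abbreviation "zc \<omega> \<equiv> snd \<omega>"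

definition tsum :: "nat \<Rightarrow> ((real \<times> real) \<times> real \<Rightarrow> real) \<Rightarrow> ((nat \<Rightarrow> real) \<times> (nat \<Rightarrow> real)) \<times> (nat \<Rightarrow> real) \<Rightarrow> real" where
  "tsum n f \<omega> = (\<Sum>i<n. f ((hc \<omega> i, gc \<omega> i), zc \<omega> i))"

text \<open>The statistic that obeys the central limit theorem. With \<open>hc\<close> behind the
  strong user's codeword and \<open>gc\<close> behind the weak user's, the coefficients weight the
  products of the two codewords, of the weak codeword with noise, of the strong codeword with noise,
  and the fluctuation of the noise energy.\<close>

definition lin :: "real \<Rightarrow> real \<Rightarrow> real \<Rightarrow> real \<Rightarrow> real \<Rightarrow> (real \<times> real) \<times> real \<Rightarrow> real" where
  "lin p q r t s \<omega> = p * (gc \<omega> * hc \<omega>) + q * (gc \<omega> * zc \<omega>) + r * (hc \<omega> * zc \<omega>) + t * ((zc \<omega>)\<^sup>2 - s)"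

locale noise_law = prob_space D for D :: "real measure" +
  assumes sets_D [measurable_cong]: "sets D = sets borel"
    and int4: "integrable D (\<lambda>z. z ^ 4)"
begin

abbreviation "single3 \<equiv> (std_gauss \<Otimes>\<^sub>M std_gauss) \<Otimes>\<^sub>M D"
abbreviation "triple n \<equiv> (gauss_vec n \<Otimes>\<^sub>M gauss_vec n) \<Otimes>\<^sub>M noise n D"

lemma prob_gauss2: "prob_space (std_gauss \<Otimes>\<^sub>M std_gauss)"
  by (rule prob_space_pair) (rule std_gauss_prob)+

lemma prob_single: "prob_space single3"
  by (rule prob_space_pair[OF prob_gauss2 prob_space_axioms])

lemma prob_noise: "prob_space (noise n D)"
  unfolding noise_def by (rule prob_space_PiM) (rule prob_space_axioms)

lemma sets_noise [simp, measurable_cong]: "sets (noise n D) = sets (borel_vec n)"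
  unfolding noise_def by (rule sets_PiM_cong) (simp_all add: sets_D)

lemma prob_triple: "prob_space (triple n)"
  by (intro prob_space_pair prob_gauss_vec prob_noise)

lemma intk: assumes "k \<le> 4" shows "integrable D (\<lambda>z. z ^ k)"
proof (rule Bochner_Integration.integrable_bound)
  show "integrable D (\<lambda>z. 1 + z ^ 4)" using int4 by simp
  show "(\<lambda>z. z ^ k) \<in> borel_measurable D"
    unfolding measurable_cong_sets[OF sets_D refl] by measurable
  show "AE z in D. norm (z ^ k) \<le> norm (1 + z ^ 4)"
  proof (rule AE_I2)
    fix z :: real
    have "\<bar>z\<bar> ^ k \<le> 1 + \<bar>z\<bar> ^ 4"
    proof (cases "\<bar>z\<bar> \<le> 1")
      case True
      then have "\<bar>z\<bar> ^ k \<le> 1" by (intro power_le_one) auto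
      then show ?thesis by (rule order_trans) simp
    next
      case False
      then have "\<bar>z\<bar> ^ k \<le> \<bar>z\<bar> ^ 4" using assms by (intro power_increasing) auto
      then show ?thesis by simp
    qed
    then show "norm (z ^ k) \<le> norm (1 + z ^ 4)" by (simp add: power_abs)
  qed
qed

lemma monomial:
  assumes "k \<le> 4"
  shows "integrable single3 (\<lambda>\<omega>. (hc \<omega> ^ i * gc \<omega> ^ j) * zc \<omega> ^ k)"
    and "(\<integral>\<omega>. (hc \<omega> ^ i * gc \<omega> ^ j) * zc \<omega> ^ k \<partial>single3) =
      (\<integral>x. x ^ i \<partial>std_gauss) * (\<integral>x. x ^ j \<partial>std_gauss) * (\<integral>z. z ^ k \<partial>D)"
proof -
  note sf = prob_space_imp_sigma_finite
  note 1 = integral_pair_product[OF sf[OF std_gauss_prob] sf[OF std_gauss_prob] std_gauss_moments(1)[of i] std_gauss_moments(1)[of j]]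
  note 2 = integral_pair_product[OF sf[OF prob_gauss2] sf[OF prob_space_axioms] 1(1) intk[OF assms]]
  show "integrable single3 (\<lambda>\<omega>. (hc \<omega> ^ i * gc \<omega> ^ j) * zc \<omega> ^ k)" by (rule 2(1))
  show "(\<integral>\<omega>. (hc \<omega> ^ i * gc \<omega> ^ j) * zc \<omega> ^ k \<partial>single3) =
      (\<integral>x. x ^ i \<partial>std_gauss) * (\<integral>x. x ^ j \<partial>std_gauss) * (\<integral>z. z ^ k \<partial>D)"
    unfolding 2(2) 1(2) ..
qed

definition mon :: "nat \<Rightarrow> nat \<Rightarrow> nat \<Rightarrow> (real \<times> real) \<times> real \<Rightarrow> real" where
  "mon i j k \<omega> = (hc \<omega> ^ i * gc \<omega> ^ j) * zc \<omega> ^ k"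

lemma mon_integrable: "k \<le> 4 \<Longrightarrow> integrable single3 (mon i j k)"
  unfolding mon_def[abs_def] by (rule monomial)

lemma mon_integral:
  "k \<le> 4 \<Longrightarrow> (\<integral>\<omega>. mon i j k \<omega> \<partial>single3) = (\<integral>x. x ^ i \<partial>std_gauss) * (\<integral>x. x ^ j \<partial>std_gauss) * (\<integral>z. z ^ k \<partial>D)"
  unfolding mon_def by (rule monomial)

lemma gauss_moment_0: "(\<integral>x. x ^ 0 \<partial>std_gauss) = 1"
  by (simp add: gauss.prob_space[simplified])

lemma D_moment_0: "(\<integral>x. x ^ 0 \<partial>D) = 1"
  by (simp add: prob_space)

text \<open>In the expanded square, every product of two different terms contains a Gaussian
  coordinate to the first power and integrates to 0, so the four terms are uncorrelated. Odd moments
  of the noise occur only next to such a vanishing factor.\<close>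

lemma lin_moments:
  assumes s: "(\<integral>z. z ^ 2 \<partial>D) = s"
  shows "(\<integral>\<omega>. lin p q r t s \<omega> \<partial>single3) = 0"
    and "integrable single3 (\<lambda>\<omega>. (lin p q r t s \<omega>)\<^sup>2)"
    and "(\<integral>\<omega>. (lin p q r t s \<omega>)\<^sup>2 \<partial>single3) = p\<^sup>2 + q\<^sup>2 * s + r\<^sup>2 * s + t\<^sup>2 * ((\<integral>z. z ^ 4 \<partial>D) - s\<^sup>2)"
proof -
  note mm = mon_integral gauss_moment_0 D_moment_0 std_gauss_moments(2-) s
  have e1: "lin p q r t s \<omega> = p * mon 1 1 0 \<omega> + q * mon 0 1 1 \<omega> + r * mon 1 0 1 \<omega> + t * mon 0 0 2 \<omega> - t * s * mon 0 0 0 \<omega>" for \<omega>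
    by (simp add: lin_def mon_def algebra_simps)
  show "(\<integral>\<omega>. lin p q r t s \<omega> \<partial>single3) = 0"
    unfolding e1 by (simp add: mon_integrable mm del: power_0 power_one_right One_nat_def)
  have e2: "(lin p q r t s \<omega>)\<^sup>2 = p\<^sup>2 * mon 2 2 0 \<omega> + q\<^sup>2 * mon 0 2 2 \<omega> + r\<^sup>2 * mon 2 0 2 \<omega>
      + t\<^sup>2 * mon 0 0 4 \<omega> - 2 * t\<^sup>2 * s * mon 0 0 2 \<omega> + t\<^sup>2 * s\<^sup>2 * mon 0 0 0 \<omega>
      + 2 * p * q * mon 1 2 1 \<omega> + 2 * p * r * mon 2 1 1 \<omega>
      + 2 * p * t * mon 1 1 2 \<omega> - 2 * p * t * s * mon 1 1 0 \<omega>
      + 2 * q * r * mon 1 1 2 \<omega>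
      + 2 * q * t * mon 0 1 3 \<omega> - 2 * q * t * s * mon 0 1 1 \<omega>
      + 2 * r * t * mon 1 0 3 \<omega> - 2 * r * t * s * mon 1 0 1 \<omega>" for \<omega>
    unfolding lin_def mon_def
    by (simp add: power2_eq_square power3_eq_cube power4_eq_xxxx algebra_simps)
  show "integrable single3 (\<lambda>\<omega>. (lin p q r t s \<omega>)\<^sup>2)"
    unfolding e2 by (simp add: mon_integrable)
  show "(\<integral>\<omega>. (lin p q r t s \<omega>)\<^sup>2 \<partial>single3) = p\<^sup>2 + q\<^sup>2 * s + r\<^sup>2 * s + t\<^sup>2 * ((\<integral>z. z ^ 4 \<partial>D) - s\<^sup>2)"
    unfolding e2 by (simp add: mon_integrable mm del: power_0 power_one_right One_nat_def)
      (simp add: power2_eq_square algebra_simps)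
qed

lemma square_moments:
  "(\<integral>\<omega>. (hc \<omega>)\<^sup>2 - 1 \<partial>single3) = 0" "integrable single3 (\<lambda>\<omega>. ((hc \<omega>)\<^sup>2 - 1)\<^sup>2)"
  "(\<integral>\<omega>. (gc \<omega>)\<^sup>2 - 1 \<partial>single3) = 0" "integrable single3 (\<lambda>\<omega>. ((gc \<omega>)\<^sup>2 - 1)\<^sup>2)"
proof -
  note mm = mon_integral gauss_moment_0 D_moment_0 std_gauss_moments(2-)
  have e: "(hc \<omega>)\<^sup>2 - 1 = mon 2 0 0 \<omega> - mon 0 0 0 \<omega>" "(gc \<omega>)\<^sup>2 - 1 = mon 0 2 0 \<omega> - mon 0 0 0 \<omega>"
    "((hc \<omega>)\<^sup>2 - 1)\<^sup>2 = mon 4 0 0 \<omega> - 2 * mon 2 0 0 \<omega> + mon 0 0 0 \<omega>"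
    "((gc \<omega>)\<^sup>2 - 1)\<^sup>2 = mon 0 4 0 \<omega> - 2 * mon 0 2 0 \<omega> + mon 0 0 0 \<omega>" for \<omega> :: "(real \<times> real) \<times> real"
    by (simp_all add: mon_def power2_eq_square power4_eq_xxxx algebra_simps)
  show "(\<integral>\<omega>. (hc \<omega>)\<^sup>2 - 1 \<partial>single3) = 0" "(\<integral>\<omega>. (gc \<omega>)\<^sup>2 - 1 \<partial>single3) = 0"
    unfolding e(1,2) by (simp_all add: mon_integrable mm del: power_0 power_one_right One_nat_def)
  show "integrable single3 (\<lambda>\<omega>. ((hc \<omega>)\<^sup>2 - 1)\<^sup>2)" "integrable single3 (\<lambda>\<omega>. ((gc \<omega>)\<^sup>2 - 1)\<^sup>2)"
    unfolding e(3,4) by (simp_all add: mon_integrable)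
qed

text \<open>Three vectors of length n are transposed into n independent triples of reals. Both laws
  agree on rectangles, where Fubini's theorem lets the integral factorise over coordinates in each
  of the three components.\<close>

lemma triple_law:
  assumes f: "f \<in> borel_measurable ((borel \<Otimes>\<^sub>M borel) \<Otimes>\<^sub>M borel)"
  shows "distr (triple n) (borel_vec n) (\<lambda>\<omega>. \<lambda>i\<in>{..<n}. f ((hc \<omega> i, gc \<omega> i), zc \<omega> i)) =
    PiM {..<n} (\<lambda>_. distr single3 borel f)"
proof -
  note f[measurable]
  let ?\<nu> = "distr single3 borel f"
  let ?F = "\<lambda>\<omega>. \<lambda>i\<in>{..<n}. f ((hc \<omega> i, gc \<omega> i), zc \<omega> i)"
  interpret S: prob_space single3 by (rule prob_single)
  interpret N: prob_space "noise n D" by (rule prob_noise)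
  interpret nu: prob_space ?\<nu> by (rule S.prob_space_distr) measurable
  interpret P: product_sigma_finite "\<lambda>_::nat. ?\<nu>"
    by (rule product_sigma_finite.intro) (rule prob_space_imp_sigma_finite[OF nu.prob_space_axioms])
  interpret PD: product_sigma_finite "\<lambda>_::nat. D"
    by (rule product_sigma_finite.intro) (rule prob_space_imp_sigma_finite[OF prob_space_axioms])
  have F[measurable]: "?F \<in> triple n \<rightarrow>\<^sub>M borel_vec n" by measurable
  show ?thesis
  proof (rule P.PiM_eqI)
    show "sets (distr (triple n) (borel_vec n) ?F) = sets (PiM {..<n} (\<lambda>_. ?\<nu>))"
      unfolding sets_distr by (rule sets_PiM_cong) simp_all
    fix A' assume A': "\<And>i. i \<in> {..<n} \<Longrightarrow> A' i \<in> sets ?\<nu>"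
    \<comment> \<open>The sets \<open>A'\<close> are known to be measurable below n only; extended
      by the empty set, the family is measurable at every index.\<close>
    define A where "A i = (if i < n then A' i else {})" for i
    have A[measurable]: "A i \<in> sets borel" for i using A' by (auto simp: A_def)
    have AA': "Pi\<^sub>E {..<n} A' = Pi\<^sub>E {..<n} A" "(\<Prod>i<n. emeasure ?\<nu> (A' i)) = (\<Prod>i<n. emeasure ?\<nu> (A i))"
      by (auto simp: A_def intro!: PiE_cong)
    let ?k = "\<lambda>i \<omega>. indicator (A i) (f \<omega>) :: ennreal"
    have m1: "(\<lambda>\<omega>. \<Prod>i<n. ?k i ((hc \<omega> i, gc \<omega> i), zc \<omega> i)) \<in> borel_measurable (triple n)"
    proof (intro borel_measurable_prod_ennreal)
      fix i assume "i \<in> {..<n}"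
      then have [simp, measurable]: "i < n" "i \<in> {..<n}" by simp_all
      show "(\<lambda>\<omega>. ?k i ((hc \<omega> i, gc \<omega> i), zc \<omega> i)) \<in> borel_measurable (triple n)" by measurable
    qed
    have m2: "(\<lambda>hg. \<Prod>i<n. \<integral>\<^sup>+z. ?k i ((fst hg i, snd hg i), z) \<partial>D) \<in> borel_measurable (gauss_vec n \<Otimes>\<^sub>M gauss_vec n)"
    proof (intro borel_measurable_prod_ennreal)
      fix i assume "i \<in> {..<n}"
      then have [simp, measurable]: "i < n" "i \<in> {..<n}" by simp_all
      show "(\<lambda>hg. \<integral>\<^sup>+z. ?k i ((fst hg i, snd hg i), z) \<partial>D) \<in> borel_measurable (gauss_vec n \<Otimes>\<^sub>M gauss_vec n)"
        by measurable
    qed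
    have PA[measurable]: "Pi\<^sub>E {..<n} A \<in> sets (borel_vec n)"
      by (rule sets_PiM_I_finite) (use A in auto)
    have "emeasure (distr (triple n) (borel_vec n) ?F) (Pi\<^sub>E {..<n} A) =
        (\<integral>\<^sup>+\<omega>. indicator (Pi\<^sub>E {..<n} A) \<omega> \<partial>distr (triple n) (borel_vec n) ?F)"
      by (rule nn_integral_indicator[symmetric]) simp
    also have "\<dots> = (\<integral>\<^sup>+\<omega>. indicator (Pi\<^sub>E {..<n} A) (?F \<omega>) \<partial>triple n)"
      by (rule nn_integral_distr) measurable
    also have "\<dots> = (\<integral>\<^sup>+\<omega>. (\<Prod>i<n. ?k i ((hc \<omega> i, gc \<omega> i), zc \<omega> i)) \<partial>triple n)"
      by (intro nn_integral_cong) (auto simp: indicator_def PiE_iff prod_zero_iff)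
    also have "\<dots> = (\<integral>\<^sup>+hg. \<integral>\<^sup>+z. (\<Prod>i<n. ?k i ((fst hg i, snd hg i), z i)) \<partial>noise n D \<partial>(gauss_vec n \<Otimes>\<^sub>M gauss_vec n))"
      using N.nn_integral_fst[OF m1] by simp
    also have "\<dots> = (\<integral>\<^sup>+hg. (\<Prod>i<n. \<integral>\<^sup>+z. ?k i ((fst hg i, snd hg i), z) \<partial>D) \<partial>(gauss_vec n \<Otimes>\<^sub>M gauss_vec n))"
      unfolding noise_def
      by (intro nn_integral_cong PD.product_nn_integral_prod) (simp_all, measurable)
    also have "\<dots> = (\<integral>\<^sup>+h. \<integral>\<^sup>+g. (\<Prod>i<n. \<integral>\<^sup>+z. ?k i ((h i, g i), z) \<partial>D) \<partial>gauss_vec n \<partial>gauss_vec n)"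
      using gv.nn_integral_fst[OF m2] by simp
    also have "\<dots> = (\<integral>\<^sup>+h. (\<Prod>i<n. \<integral>\<^sup>+g. \<integral>\<^sup>+z. ?k i ((h i, g), z) \<partial>D \<partial>std_gauss) \<partial>gauss_vec n)"
      by (intro nn_integral_cong gauss_prod.product_nn_integral_prod) (simp_all, measurable)
    also have "\<dots> = (\<Prod>i<n. \<integral>\<^sup>+h. \<integral>\<^sup>+g. \<integral>\<^sup>+z. ?k i ((h, g), z) \<partial>D \<partial>std_gauss \<partial>std_gauss)"
      by (intro gauss_prod.product_nn_integral_prod) (simp_all, measurable)
    also have "\<dots> = (\<Prod>i<n. \<integral>\<^sup>+\<omega>. ?k i \<omega> \<partial>single3)"
    proof (intro prod.cong refl)
      fix i
      show "(\<integral>\<^sup>+h. \<integral>\<^sup>+g. \<integral>\<^sup>+z. ?k i ((h, g), z) \<partial>D \<partial>std_gauss \<partial>std_gauss) = (\<integral>\<^sup>+\<omega>. ?k i \<omega> \<partial>single3)"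
        by (subst nn_integral_fst[symmetric], measurable, subst gauss.nn_integral_fst[symmetric], measurable)
    qed
    also have "\<dots> = (\<Prod>i<n. emeasure ?\<nu> (A i))"
    proof (intro prod.cong refl)
      fix i
      show "(\<integral>\<^sup>+\<omega>. ?k i \<omega> \<partial>single3) = emeasure ?\<nu> (A i)"
        by (subst nn_integral_indicator[symmetric], measurable, subst nn_integral_distr, measurable)
    qed
    finally show "emeasure (distr (triple n) (borel_vec n) ?F) (Pi\<^sub>E {..<n} A') = (\<Prod>i<n. emeasure ?\<nu> (A' i))"
      unfolding AA' .
  qed simp
qed

end

section \<open>Limit theorems for coordinate sums over the triple\<close>

context noise_law begin

lemma tsum_measurable [measurable]:
  assumes [measurable]: "f \<in> borel_measurable ((borel \<Otimes>\<^sub>M borel) \<Otimes>\<^sub>M borel)"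
  shows "tsum n f \<in> borel_measurable (triple n)"
  unfolding tsum_def by measurable

text \<open>Every block length has its own probability space. Moving the sums to one infinite
  product of the law of a summand makes limit theorems in n applicable.\<close>

lemma triple_sum_prob:
  assumes f[measurable]: "f \<in> borel_measurable ((borel \<Otimes>\<^sub>M borel) \<Otimes>\<^sub>M borel)" and A[measurable]: "A \<in> sets borel"
  defines "\<nu> \<equiv> distr single3 borel f"
  shows "measure (triple n) {\<omega>\<in>space (triple n). tsum n f \<omega> \<in> A} =
    measure (PiM UNIV (\<lambda>_::nat. \<nu>)) {w\<in>space (PiM UNIV (\<lambda>_::nat. \<nu>)). (\<Sum>i<n. w i) \<in> A}"
proof -
  let ?F = "\<lambda>\<omega>. \<lambda>i\<in>{..<n}. f ((hc \<omega> i, gc \<omega> i), zc \<omega> i)"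
  interpret S: prob_space single3 by (rule prob_single)
  interpret nu: prob_space \<nu> unfolding \<nu>_def by (rule S.prob_space_distr) measurable
  interpret P: product_prob_space "\<lambda>_::nat. \<nu>" UNIV by standard
  have sn[measurable_cong]: "sets \<nu> = sets borel" by (simp add: \<nu>_def)
  have sP[measurable_cong]: "sets (PiM J (\<lambda>_::nat. \<nu>)) = sets (PiM J (\<lambda>_. borel))" for J
    by (rule sets_PiM_cong) (simp_all add: sn)
  have B[measurable]: "{x\<in>space (borel_vec n). (\<Sum>i<n. x i) \<in> A} \<in> sets (borel_vec n)" (is "?B \<in> _")
    by measurable
  have "measure (PiM {..<n} (\<lambda>_. \<nu>)) ?B = measure (distr (triple n) (borel_vec n) ?F) ?B"
    unfolding \<nu>_def triple_law[OF f] ..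
  also have "\<dots> = measure (triple n) (?F -` ?B \<inter> space (triple n))"
    by (rule measure_distr) measurable
  also have "?F -` ?B \<inter> space (triple n) = {\<omega>\<in>space (triple n). tsum n f \<omega> \<in> A}"
    by (auto simp: tsum_def space_PiM)
  finally have 1: "measure (PiM {..<n} (\<lambda>_. \<nu>)) ?B = measure (triple n) {\<omega>\<in>space (triple n). tsum n f \<omega> \<in> A}" .
  have "measure (PiM {..<n} (\<lambda>_. \<nu>)) ?B = measure (distr (PiM UNIV (\<lambda>_. \<nu>)) (PiM {..<n} (\<lambda>_. \<nu>)) (\<lambda>x. restrict x {..<n})) ?B"
    by (subst P.distr_PiM_restrict_finite) auto
  also have "\<dots> = measure (PiM UNIV (\<lambda>_. \<nu>)) ((\<lambda>x. restrict x {..<n}) -` ?B \<inter> space (PiM UNIV (\<lambda>_. \<nu>)))"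
    by (rule measure_distr) (use B in \<open>simp_all add: sP\<close>)
  also have "(\<lambda>x. restrict x {..<n}) -` ?B \<inter> space (PiM UNIV (\<lambda>_. \<nu>)) =
      {w\<in>space (PiM UNIV (\<lambda>_::nat. \<nu>)). (\<Sum>i<n. w i) \<in> A}"
    by (auto simp: space_PiM)
  finally show ?thesis using 1 by simp
qed

lemma centered_law_distr:
  assumes f[measurable]: "f \<in> borel_measurable ((borel \<Otimes>\<^sub>M borel) \<Otimes>\<^sub>M borel)"
    and "(\<integral>\<omega>. f \<omega> \<partial>single3) = 0" "integrable single3 (\<lambda>\<omega>. (f \<omega>)\<^sup>2)"
  shows "centered_law (distr single3 borel f)"
    and "(\<integral>x. x\<^sup>2 \<partial>distr single3 borel f) = (\<integral>\<omega>. (f \<omega>)\<^sup>2 \<partial>single3)"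
proof -
  interpret S: prob_space single3 by (rule prob_single)
  interpret nu: prob_space "distr single3 borel f" by (rule S.prob_space_distr) measurable
  show "centered_law (distr single3 borel f)"
  proof
    show "integrable (distr single3 borel f) (\<lambda>x. x\<^sup>2)"
      using assms(3) by (subst integrable_distr_eq) auto
    show "(\<integral>x. x \<partial>distr single3 borel f) = 0"
      using assms(2) by (subst integral_distr) auto
  qed simp
  show "(\<integral>x. x\<^sup>2 \<partial>distr single3 borel f) = (\<integral>\<omega>. (f \<omega>)\<^sup>2 \<partial>single3)"
    by (subst integral_distr) auto
qed

text \<open>Chebyshev's inequality: a variance of order n over the squared deviation n powr (5/4)
  leaves n powr (-1/4).\<close>

lemma triple_lln:
  assumes f: "f \<in> borel_measurable ((borel \<Otimes>\<^sub>M borel) \<Otimes>\<^sub>M borel)"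
    and m: "(\<integral>\<omega>. f \<omega> \<partial>single3) = 0" and i: "integrable single3 (\<lambda>\<omega>. (f \<omega>)\<^sup>2)"
  shows "(\<lambda>n. measure (triple n) {\<omega>\<in>space (triple n). real n powr (5/8) \<le> \<bar>tsum n f \<omega>\<bar>}) \<longlonglongrightarrow> 0"
proof -
  let ?\<nu> = "distr single3 borel f"
  interpret nu: centered_law ?\<nu> by (rule centered_law_distr[OF f m i])
  let ?v = "\<integral>x. x\<^sup>2 \<partial>?\<nu>"
  have le: "measure (triple n) {\<omega>\<in>space (triple n). real n powr (5/8) \<le> \<bar>tsum n f \<omega>\<bar>} \<le> ?v * real n powr (-1/4)"
    if n: "0 < n" for n
  proof -
    have A: "{x. real n powr (5/8) \<le> \<bar>x\<bar>} \<in> sets borel" by measurable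
    have "measure (triple n) {\<omega>\<in>space (triple n). real n powr (5/8) \<le> \<bar>tsum n f \<omega>\<bar>} =
        measure (PiM UNIV (\<lambda>_::nat. ?\<nu>)) {w\<in>space (PiM UNIV (\<lambda>_::nat. ?\<nu>)). real n powr (5/8) \<le> \<bar>\<Sum>i<n. w i\<bar>}"
      using triple_sum_prob[OF f A] by simp
    also have "\<dots> \<le> real n * ?v / (real n powr (5/8))\<^sup>2"
      by (rule nu.chebyshev_sum) (use n in simp)
    also have "\<dots> = ?v * real n powr (-1/4)"
    proof -
      have "(real n powr (5/8))\<^sup>2 = real n powr (5/4)"
        by (simp add: power2_eq_square flip: powr_add)
      moreover have "real n / real n powr (5/4) = real n powr (-1/4)"
      proof -
        have "real n powr 1 / real n powr (5/4) = real n powr (1 - 5/4)" by (rule powr_diff[symmetric])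
        then show ?thesis using n by simp
      qed
      ultimately show ?thesis by (metis mult.commute times_divide_eq_left)
    qed
    finally show ?thesis .
  qed
  show ?thesis
  proof (rule tendsto_sandwich[of "\<lambda>_. 0"])
    show "(\<lambda>n. ?v * real n powr (-1/4)) \<longlonglongrightarrow> 0"
    proof -
      have "(\<lambda>n. real n powr (-1/4)) \<longlonglongrightarrow> 0"
        by (rule tendsto_neg_powr) (auto simp: filterlim_real_sequentially)
      then show ?thesis using tendsto_mult_right_zero by blast
    qed
    show "\<forall>\<^sub>F n in sequentially. measure (triple n) {\<omega>\<in>space (triple n). real n powr (5/8) \<le> \<bar>tsum n f \<omega>\<bar>} \<le> ?v * real n powr (-1/4)"
      using eventually_gt_at_top[of 0] by eventually_elim (rule le)
  qed (simp_all)
qed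

lemma triple_clt:
  assumes f: "f \<in> borel_measurable ((borel \<Otimes>\<^sub>M borel) \<Otimes>\<^sub>M borel)"
    and m: "(\<integral>\<omega>. f \<omega> \<partial>single3) = 0" and i: "integrable single3 (\<lambda>\<omega>. (f \<omega>)\<^sup>2)"
    and v: "(\<integral>\<omega>. (f \<omega>)\<^sup>2 \<partial>single3) = V" "0 < V"
  shows "(\<lambda>n. measure (triple n) {\<omega>\<in>space (triple n). tsum n f \<omega> \<le> - (sqrt n * L)}) \<longlonglongrightarrow> Qfun (L / sqrt V)"
proof -
  let ?\<nu> = "distr single3 borel f"
  interpret nu: centered_law ?\<nu> by (rule centered_law_distr[OF f m i])
  have v': "(\<integral>x. x\<^sup>2 \<partial>?\<nu>) = V" using centered_law_distr(2)[OF f m i] v by simp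
  have A: "{x. x \<le> - (sqrt n * L)} \<in> sets borel" for n by measurable
  show ?thesis
    using nu.clt_sum[of L] v(2) triple_sum_prob[OF f A] unfolding v' by simp
qed

end

text \<open>Energy typicality up to the moderate-deviation scale \<open>n powr (5/8)\<close>, which is \<open>o(n)\<close> and
  whose relative square \<open>n * (n powr (-3/8))\<^sup>2 = n powr (1/4)\<close> is \<open>o(sqrt n)\<close>.\<close>

definition balanced :: "nat \<Rightarrow> real \<Rightarrow> real \<Rightarrow> real \<Rightarrow> real \<Rightarrow> (nat \<Rightarrow> real) \<Rightarrow> (nat \<Rightarrow> real) \<Rightarrow> (nat \<Rightarrow> real) \<Rightarrow> bool" where
  "balanced n a b s c v u z \<longleftrightarrow>
    \<bar>sqnorm n z - n * s\<bar> \<le> c * real n powr (5/8) \<and>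
    \<bar>sqnorm n (\<lambda>i. v i + z i) - n * (a + s)\<bar> \<le> c * real n powr (5/8) \<and>
    \<bar>sqnorm n (\<lambda>i. u i + z i) - n * (b + s)\<bar> \<le> c * real n powr (5/8) \<and>
    \<bar>sqnorm n (\<lambda>i. v i + u i + z i) - n * (a + b + s)\<bar> \<le> c * real n powr (5/8)"

text \<open>Stated for the Gaussian vectors before projection, where each of the six quantities is a
  sum of independent centred terms; \<open>balanced\<close> is the consequence for the projected
  codewords.\<close>

definition gtyp :: "nat \<Rightarrow> real \<Rightarrow> (nat \<Rightarrow> real) \<Rightarrow> (nat \<Rightarrow> real) \<Rightarrow> (nat \<Rightarrow> real) \<Rightarrow> bool" where
  "gtyp n s h g z \<longleftrightarrow> \<bar>sqnorm n h - n\<bar> \<le> real n powr (5/8) \<and> \<bar>sqnorm n g - n\<bar> \<le> real n powr (5/8) \<and>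
    \<bar>dot n g h\<bar> \<le> real n powr (5/8) \<and> \<bar>dot n g z\<bar> \<le> real n powr (5/8) \<and>
    \<bar>dot n h z\<bar> \<le> real n powr (5/8) \<and> \<bar>sqnorm n z - n * s\<bar> \<le> real n powr (5/8)"

text \<open>With y = x / n the relative deviation is n powr (5/8 - 1), and 1 / sqrt y - 1 = (1 - y)
  / (sqrt y * (1 + sqrt y)), whose denominator is at least 1 once y >= 1/2.\<close>

lemma inverse_sqrt_close:
  assumes n: "0 < n" and x: "\<bar>x - real n\<bar> \<le> real n powr (5/8)" and e: "real n powr (-3/8) \<le> 1/2"
  shows "\<bar>sqrt n / sqrt x - 1\<bar> \<le> real n powr (-3/8)" "0 < x"
proof -
  define y where "y = x / n"
  have "\<bar>y - 1\<bar> = \<bar>x - real n\<bar> / n" using n by (simp add: y_def field_simps)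
  also have "\<dots> \<le> real n powr (5/8) / real n powr 1"
    using x n by (simp add: divide_right_mono)
  also have "\<dots> = real n powr (5/8 - 1)" by (rule powr_diff[symmetric])
  finally have y: "\<bar>y - 1\<bar> \<le> real n powr (-3/8)" by simp
  then have y2: "1/2 \<le> y" using e by linarith
  then show "0 < x" using n by (simp add: y_def zero_less_divide_iff)
  have sy: "0 < sqrt y" "sqrt y * sqrt y = y" using y2 by auto
  have s2: "sqrt y * (1 + sqrt y) = sqrt y + y" using sy(2) by (simp add: distrib_left)
  \<comment> \<open>For 1/2 <= y <= 1 both summands of sqrt y + y are at least 1/2; for larger y the
    second alone exceeds 1.\<close>
  have one: "1 \<le> sqrt y * (1 + sqrt y)"
  proof (cases "y \<le> 1")
    case True
    then have "y * y \<le> y" using y2 by (simp add: mult_left_le)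
    then have "y \<le> sqrt y" using y2 by (intro real_le_rsqrt) (simp add: power2_eq_square)
    then show ?thesis using y2 unfolding s2 by linarith
  next
    case False
    then show ?thesis using sy(1) unfolding s2 by linarith
  qed
  have "sqrt n / sqrt x = 1 / sqrt y" using n by (simp add: y_def real_sqrt_divide)
  then have "\<bar>sqrt n / sqrt x - 1\<bar> = \<bar>1 / sqrt y - 1\<bar>" by simp
  also have "1 / sqrt y - 1 = (1 - y) / (sqrt y * (1 + sqrt y))"
  proof -
    have "(1 - y) = (1 - sqrt y) * (1 + sqrt y)" using sy(2) by (simp add: algebra_simps)
    then have "(1 - y) / (sqrt y * (1 + sqrt y)) = (1 - sqrt y) / sqrt y"
      using sy(1) less_imp_neq[of 0 "1 + sqrt y"] by auto
    then show ?thesis using sy(1) by (simp add: diff_divide_distrib)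
  qed
  also have "\<bar>(1 - y) / (sqrt y * (1 + sqrt y))\<bar> \<le> \<bar>1 - y\<bar> / 1"
    unfolding abs_divide using one by (intro divide_left_mono) auto
  finally show "\<bar>sqrt n / sqrt x - 1\<bar> \<le> real n powr (-3/8)" using y by simp
qed

section \<open>Codewords projected from a typical Gaussian triple, and their information
  densities\<close>

locale typical_triple =
  fixes n :: nat and a b s :: real and h g z v u :: "nat \<Rightarrow> real"
  assumes n: "0 < n" and a: "0 \<le> a" and b: "0 \<le> b" and e: "real n powr (-3/8) \<le> 1/2"
    and gt: "gtyp n s h g z"
    and v: "v = sph n (sqrt (n * a)) h" and u: "u = sph n (sqrt (n * b)) g"
begin

text \<open>The codeword is \<open>g\<close> times sqrt b and this factor, which tends to 1 on
  typical triples.\<close>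

definition "\<rho>g = sqrt n / sqrt (sqnorm n g)"
definition "\<rho>h = sqrt n / sqrt (sqnorm n h)"

lemma powr_prod: "real n powr (-3/8) * real n powr (5/8) = real n powr (1/4)"
  by (simp flip: powr_add)

lemma rho: "\<bar>\<rho>g - 1\<bar> \<le> real n powr (-3/8)" "\<bar>\<rho>h - 1\<bar> \<le> real n powr (-3/8)"
  and pos: "0 < sqnorm n g" "0 < sqnorm n h"
  using gt inverse_sqrt_close[OF n _ e] unfolding gtyp_def \<rho>g_def \<rho>h_def by blast+

lemma energy: "sqnorm n v = n * a" "sqnorm n u = n * b"
  using pos a b by (simp_all add: v u sqnorm_sph)

lemma dots: "dot n u v = sqrt a * sqrt b * (\<rho>g * \<rho>h * dot n g h)"
  "dot n u z = sqrt b * (\<rho>g * dot n g z)" "dot n v z = sqrt a * (\<rho>h * dot n h z)"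
proof -
  have "dot n u v = sqrt (n * a) / sqrt (sqnorm n h) * dot n u h" unfolding v dot_sph ..
  also have "dot n u h = sqrt (n * b) / sqrt (sqnorm n g) * dot n h g"
    by (subst dot_commute) (simp only: u dot_sph)
  finally show "dot n u v = sqrt a * sqrt b * (\<rho>g * \<rho>h * dot n g h)"
    by (simp add: \<rho>g_def \<rho>h_def real_sqrt_mult dot_commute[of n h g] mult_ac)
  show "dot n u z = sqrt b * (\<rho>g * dot n g z)"
    by (subst dot_commute) (simp add: u dot_sph \<rho>g_def real_sqrt_mult dot_commute[of n z g] mult_ac)
  show "dot n v z = sqrt a * (\<rho>h * dot n h z)"
    by (subst dot_commute) (simp add: v dot_sph \<rho>h_def real_sqrt_mult dot_commute[of n z h] mult_ac)
qed

lemma scaled_close: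
  assumes "\<bar>r - 1\<bar> \<le> k * real n powr (-3/8)" "\<bar>x\<bar> \<le> real n powr (5/8)" "0 \<le> c" "0 \<le> k"
  shows "\<bar>c * (r * x) - c * x\<bar> \<le> c * (k * real n powr (1/4))"
proof -
  have "\<bar>r - 1\<bar> * \<bar>x\<bar> \<le> (k * real n powr (-3/8)) * real n powr (5/8)"
    using assms by (intro mult_mono) auto
  also have "\<dots> = k * real n powr (1/4)" by (simp only: mult.assoc powr_prod)
  finally have "c * (\<bar>r - 1\<bar> * \<bar>x\<bar>) \<le> c * (k * real n powr (1/4))"
    using assms by (intro mult_left_mono) auto
  moreover have "\<bar>c * (r * x) - c * x\<bar> = c * (\<bar>r - 1\<bar> * \<bar>x\<bar>)"
  proof -
    have "c * (r * x) - c * x = c * ((r - 1) * x)" by (simp add: algebra_simps)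
    then show ?thesis using assms by (simp add: abs_mult)
  qed
  ultimately show ?thesis by simp
qed

lemma rho2: "\<bar>\<rho>g * \<rho>h - 1\<bar> \<le> 3 * real n powr (-3/8)"
proof -
  have "\<rho>g * \<rho>h - 1 = (\<rho>g - 1) * (\<rho>h - 1) + (\<rho>g - 1) + (\<rho>h - 1)" by (simp add: algebra_simps)
  moreover have "\<bar>(\<rho>g - 1) * (\<rho>h - 1)\<bar> \<le> real n powr (-3/8) * 1"
    unfolding abs_mult using rho e by (intro mult_mono) auto
  ultimately show ?thesis using rho by linarith
qed

lemma dot_close:
  "\<bar>dot n u v - sqrt a * sqrt b * dot n g h\<bar> \<le> sqrt a * sqrt b * (3 * real n powr (1/4))"
  "\<bar>dot n u z - sqrt b * dot n g z\<bar> \<le> sqrt b * (1 * real n powr (1/4))"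
  "\<bar>dot n v z - sqrt a * dot n h z\<bar> \<le> sqrt a * (1 * real n powr (1/4))"
  unfolding dots
  by (rule scaled_close; use rho rho2 gt a b in \<open>simp add: gtyp_def\<close>)+

lemma powr_quarter_le: "real n powr (1/4) \<le> real n powr (5/8)"
  using n by (intro powr_mono) auto

lemma dot_bound:
  "\<bar>dot n u v\<bar> \<le> sqrt a * sqrt b * (4 * real n powr (5/8))"
  "\<bar>dot n u z\<bar> \<le> sqrt b * (2 * real n powr (5/8))"
  "\<bar>dot n v z\<bar> \<le> sqrt a * (2 * real n powr (5/8))"
proof -
  have *: "\<bar>x\<bar> \<le> c * ((k + 1) * real n powr (5/8))"
    if "\<bar>x - c * y\<bar> \<le> c * (k * real n powr (1/4))" "\<bar>y\<bar> \<le> real n powr (5/8)" "0 \<le> c" "0 \<le> k" for x y c k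
  proof -
    have "\<bar>x\<bar> \<le> \<bar>x - c * y\<bar> + \<bar>c * y\<bar>" by linarith
    also have "\<dots> \<le> c * (k * real n powr (5/8)) + c * real n powr (5/8)"
    proof (rule add_mono)
      have "c * (k * real n powr (1/4)) \<le> c * (k * real n powr (5/8))"
        using that powr_quarter_le by (intro mult_left_mono) auto
      then show "\<bar>x - c * y\<bar> \<le> c * (k * real n powr (5/8))" using that by linarith
      show "\<bar>c * y\<bar> \<le> c * real n powr (5/8)"
        using that by (simp add: abs_mult mult_left_mono)
    qed
    finally show ?thesis by (simp add: algebra_simps)
  qed
  show "\<bar>dot n u v\<bar> \<le> sqrt a * sqrt b * (4 * real n powr (5/8))"
    using *[OF dot_close(1)] gt a b by (simp add: gtyp_def)
  show "\<bar>dot n u z\<bar> \<le> sqrt b * (2 * real n powr (5/8))"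
    using *[OF dot_close(2)] gt a b by (simp add: gtyp_def)
  show "\<bar>dot n v z\<bar> \<le> sqrt a * (2 * real n powr (5/8))"
    using *[OF dot_close(3)] gt a b by (simp add: gtyp_def)
qed

text \<open>The constant adds up the worst case: 1 for the noise energy, and twice the bounds 4, 2
  and 2 of \<open>dot_bound\<close>, since each inner product is doubled when a sum is
  squared.\<close>

lemma typical: "balanced n a b s (1 + 8 * (sqrt a * sqrt b) + 4 * sqrt a + 4 * sqrt b) v u z"
proof -
  let ?N = "real n powr (5/8)"
  have z: "\<bar>sqnorm n z - n * s\<bar> \<le> ?N" using gt by (simp add: gtyp_def)
  have N: "0 \<le> sqrt a * ?N" "0 \<le> sqrt b * ?N" "0 \<le> sqrt a * sqrt b * ?N" using a b by auto
  have d: "dot n (\<lambda>i. v i + u i) z = dot n v z + dot n u z" by (rule dot_add_left)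
  show ?thesis
    unfolding balanced_def sqnorm_add d energy dot_commute[of n v u]
    using z dot_bound N by (simp add: algebra_simps abs_le_iff)
qed

end

text \<open>The codeword has energy exactly n b, so only the cross term d and the residual energy W
  are random; a codebook of fluctuating energy would contribute a further term.\<close>

lemma info_expand:
  fixes n :: nat and \<tau> b Y W d :: real
  assumes "0 < \<tau>" "0 \<le> b" "Y = n * b + 2 * d + W"
  shows "info n \<tau> b Y W = n * Ccap (b / \<tau>) + d / (\<tau> + b) - b / (2 * \<tau> * (\<tau> + b)) * (W - n * \<tau>)"
proof -
  have t: "\<tau> \<noteq> 0" "\<tau> + b \<noteq> 0" using assms by auto
  show ?thesis unfolding info_def assms(3) using t
    by (simp add: divide_simps) (simp add: algebra_simps)
qed

text \<open>The first-order version, from energies alone. It loses c / \<tau>, which for c of order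
  n powr (5/8) is affordable only where the rate leaves a gap linear in n.\<close>

lemma info_lower:
  fixes n :: nat and \<tau> b Y W c :: real
  assumes t: "0 < \<tau>" "0 \<le> b" and Y: "\<bar>Y - n * (\<tau> + b)\<bar> \<le> c" and W: "\<bar>W - n * \<tau>\<bar> \<le> c"
  shows "info n \<tau> b Y W \<ge> n * Ccap (b / \<tau>) - c / \<tau>"
proof -
  have c: "0 \<le> c" using Y by linarith
  have "info n \<tau> b Y W = n * Ccap (b / \<tau>) + (Y - n * (\<tau> + b)) / (2 * (\<tau> + b)) - (W - n * \<tau>) / (2 * \<tau>)"
  proof -
    have "n * (\<tau> + b) / (2 * (\<tau> + b)) = n / 2" "n * \<tau> / (2 * \<tau>) = n / 2"
      using t mult_divide_mult_cancel_right[of "\<tau> + b" "real n" 2] by (auto simp: mult.commute)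
    then show ?thesis by (simp only: info_def diff_divide_distrib)
  qed
  moreover have "(W - n * \<tau>) / (2 * \<tau>) \<le> c / (2 * \<tau>)"
    using W t by (intro divide_right_mono) auto
  moreover have "- (c / (2 * \<tau>)) \<le> (Y - n * (\<tau> + b)) / (2 * (\<tau> + b))"
  proof -
    have "- (c / (2 * \<tau>)) \<le> - c / (2 * (\<tau> + b))"
      using t c by (simp add: divide_left_mono)
    also have "\<dots> \<le> (Y - n * (\<tau> + b)) / (2 * (\<tau> + b))"
      using Y t by (intro divide_right_mono) auto
    finally show ?thesis .
  qed
  moreover have "c / (2 * \<tau>) + c / (2 * \<tau>) = c / \<tau>" by simp
  ultimately show ?thesis by linarith
qed

lemma lin_measurable [measurable]: "lin p q r t s \<in> borel_measurable ((borel \<Otimes>\<^sub>M borel) \<Otimes>\<^sub>M borel)"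
  unfolding lin_def[abs_def] by measurable

lemma tsum_lin: "tsum n (lin p q r t s) ((h, g), z) =
    p * dot n g h + q * dot n g z + r * dot n h z + t * (sqnorm n z - n * s)"
  by (simp add: tsum_def lin_def dot_def sqnorm_def sum.distrib sum_subtractf flip: sum_distrib_left)

lemma tsum_square:
  "tsum n (\<lambda>\<omega>. (hc \<omega>)\<^sup>2 - 1) ((h, g), z) = sqnorm n h - n"
  "tsum n (\<lambda>\<omega>. (gc \<omega>)\<^sup>2 - 1) ((h, g), z) = sqnorm n g - n"
  by (simp_all add: tsum_def sqnorm_def sum_subtractf)

lemma gtyp_measurable [measurable]:
  "Measurable.pred ((borel_vec n \<Otimes>\<^sub>M borel_vec n) \<Otimes>\<^sub>M borel_vec n) (\<lambda>\<omega>. gtyp n s (hc \<omega>) (gc \<omega>) (zc \<omega>))"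
  unfolding gtyp_def by measurable

lemma balanced_measurable [measurable]:
  "Measurable.pred ((borel_vec n \<Otimes>\<^sub>M borel_vec n) \<Otimes>\<^sub>M borel_vec n) (\<lambda>\<omega>. balanced n a b s c (hc \<omega>) (gc \<omega>) (zc \<omega>))"
  unfolding balanced_def by measurable

context typical_triple begin

text \<open>The strong user's codeword counts as noise here. This explains \<open>\<tau>\<close>,
  and the coefficient \<open>- 2 * k * sqrt a\<close>: the residual energy contains twice the
  product of that codeword with the noise. The subtracted term collects the errors of
  \<open>dot_close\<close>.\<close>

lemma info_user2:
  assumes s: "0 < s"
  defines "\<tau> \<equiv> a + s" and "k \<equiv> b / (2 * (a + s) * (a + s + b))"
  shows "info n \<tau> b (sqnorm n (\<lambda>i. v i + u i + z i)) (sqnorm n (\<lambda>i. v i + z i)) \<ge> n * Ccap (b / \<tau>) +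
    tsum n (lin (sqrt a * sqrt b / (\<tau> + b)) (sqrt b / (\<tau> + b)) (- 2 * k * sqrt a) (- k) s) ((h, g), z) -
    (3 * (sqrt a * sqrt b) / (\<tau> + b) + sqrt b / (\<tau> + b) + 2 * k * sqrt a) * real n powr (1/4)"
proof -
  have t: "0 < \<tau>" "0 < \<tau> + b" using a b s by (auto simp: \<tau>_def)
  have k: "0 \<le> k" using a b s by (simp add: k_def)
  have "sqnorm n (\<lambda>i. v i + u i + z i) = n * b + 2 * (dot n u v + dot n u z) + sqnorm n (\<lambda>i. v i + z i)"
    unfolding sqnorm_add dot_add_left energy dot_commute[of n v u] by simp
  from info_expand[OF t(1) b this]
  have i: "info n \<tau> b (sqnorm n (\<lambda>i. v i + u i + z i)) (sqnorm n (\<lambda>i. v i + z i)) =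
    n * Ccap (b / \<tau>) + (dot n u v + dot n u z) / (\<tau> + b) - k * (2 * dot n v z + (sqnorm n z - n * s))"
    unfolding sqnorm_add energy by (simp add: k_def \<tau>_def algebra_simps)
  have d1: "(sqrt a * sqrt b * dot n g h - sqrt a * sqrt b * (3 * real n powr (1/4))) / (\<tau> + b) \<le> dot n u v / (\<tau> + b)"
    using dot_close(1) t by (intro divide_right_mono) (simp_all add: abs_le_iff)
  have d2: "(sqrt b * dot n g z - sqrt b * real n powr (1/4)) / (\<tau> + b) \<le> dot n u z / (\<tau> + b)"
    using dot_close(2) t by (intro divide_right_mono) (simp_all add: abs_le_iff)
  have d3: "(2 * k) * dot n v z \<le> (2 * k) * (sqrt a * dot n h z + sqrt a * real n powr (1/4))"
    using dot_close(3) k by (intro mult_left_mono) (simp_all add: abs_le_iff)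
  show ?thesis unfolding i tsum_lin using d1 d2 d3
    by (simp add: add_divide_distrib diff_divide_distrib algebra_simps)
qed

lemma info_user1:
  assumes s: "0 < s"
  defines "k \<equiv> a / (2 * s * (s + a))"
  shows "info n s a (sqnorm n (\<lambda>i. v i + z i)) (sqnorm n z) \<ge> n * Ccap (a / s) +
    tsum n (lin 0 0 (sqrt a / (s + a)) (- k) s) ((h, g), z) - (sqrt a / (s + a)) * real n powr (1/4)"
proof -
  have "sqnorm n (\<lambda>i. v i + z i) = n * a + 2 * dot n v z + sqnorm n z"
    unfolding sqnorm_add energy by simp
  from info_expand[OF s a this]
  have i: "info n s a (sqnorm n (\<lambda>i. v i + z i)) (sqnorm n z) =
    n * Ccap (a / s) + dot n v z / (s + a) - k * (sqnorm n z - n * s)"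
    by (simp add: k_def)
  have "(sqrt a * dot n h z - sqrt a * real n powr (1/4)) / (s + a) \<le> dot n v z / (s + a)"
    using dot_close(3) s a by (intro divide_right_mono) (simp_all add: abs_le_iff)
  then show ?thesis unfolding i tsum_lin by (simp add: diff_divide_distrib)
qed

end

section \<open>Probability that the sent codewords and the noise are favourable\<close>

lemma less_consts: "(1/4::real) < 3/8" "(0::real) < 1/2"
  by simp_all

lemma eventually_powr_small: "0 < d \<Longrightarrow> \<forall>\<^sub>F n in sequentially. real n powr (-3/8) \<le> d"
proof -
  assume d: "0 < d"
  have "(\<lambda>n. real n powr (-3/8)) \<longlonglongrightarrow> 0"
    by (rule tendsto_neg_powr) (auto simp: filterlim_real_sequentially)
  then have "\<forall>\<^sub>F n in sequentially. real n powr (-3/8) < d" using d by (rule order_tendstoD)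
  then show ?thesis by eventually_elim simp
qed

lemma eventually_powr_le:
  assumes "p < q" shows "\<forall>\<^sub>F n in sequentially. K * real n powr p \<le> real n powr q"
proof -
  have "(\<lambda>n. real n powr (p - q)) \<longlonglongrightarrow> 0"
    by (rule tendsto_neg_powr) (use assms in \<open>auto simp: filterlim_real_sequentially\<close>)
  then have "(\<lambda>n. K * real n powr (p - q)) \<longlonglongrightarrow> K * 0" by (intro tendsto_intros)
  then have "\<forall>\<^sub>F n in sequentially. K * real n powr (p - q) < 1" by (rule order_tendstoD) simp
  then show ?thesis using eventually_gt_at_top[of 0]
  proof eventually_elim
    case (elim n)
    then have "K * real n powr (p - q) * real n powr q \<le> 1 * real n powr q"
      by (intro mult_right_mono) auto
    then show ?case by (simp add: mult.assoc flip: powr_add)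
  qed
qed

definition typ_const :: "real \<Rightarrow> real \<Rightarrow> real" where
  "typ_const a b = 1 + 8 * (sqrt a * sqrt b) + 4 * sqrt a + 4 * sqrt b"

text \<open>With the weak message removed, the strong user faces noise of power s only. The
  allowance n powr (3/8) has to absorb the n powr (1/4) error of \<open>info_user1\<close>.\<close>

definition good1 :: "real \<Rightarrow> real \<Rightarrow> real \<Rightarrow> real \<Rightarrow> nat \<Rightarrow> (nat \<Rightarrow> real) \<Rightarrow> (nat \<Rightarrow> real) \<Rightarrow> (nat \<Rightarrow> real) \<Rightarrow> bool" where
  "good1 a b s L n v u z \<longleftrightarrow> balanced n a b s (typ_const a b) v u z \<and>
    n * Ccap (a / s) - sqrt n * L - real n powr (3/8) \<le> info n s a (sqnorm n (\<lambda>i. v i + z i)) (sqnorm n z)"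

definition good2 :: "real \<Rightarrow> real \<Rightarrow> real \<Rightarrow> real \<Rightarrow> nat \<Rightarrow> (nat \<Rightarrow> real) \<Rightarrow> (nat \<Rightarrow> real) \<Rightarrow> (nat \<Rightarrow> real) \<Rightarrow> bool" where
  "good2 a b s L n v u z \<longleftrightarrow> balanced n a b s (typ_const a b) v u z \<and>
    n * Ccap (b / (a + s)) - sqrt n * L - real n powr (3/8) \<le>
      info n (a + s) b (sqnorm n (\<lambda>i. v i + u i + z i)) (sqnorm n (\<lambda>i. v i + z i))"

lemma good_measurable [measurable]:
  "Measurable.pred ((borel_vec n \<Otimes>\<^sub>M borel_vec n) \<Otimes>\<^sub>M borel_vec n) (\<lambda>\<omega>. good1 a b s L n (hc \<omega>) (gc \<omega>) (zc \<omega>))"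
  "Measurable.pred ((borel_vec n \<Otimes>\<^sub>M borel_vec n) \<Otimes>\<^sub>M borel_vec n) (\<lambda>\<omega>. good2 a b s L n (hc \<omega>) (gc \<omega>) (zc \<omega>))"
  unfolding good1_def good2_def info_def by measurable

context noise_law begin

lemma gtyp_tendsto:
  assumes s: "(\<integral>z. z\<^sup>2 \<partial>D) = s"
  shows "(\<lambda>n. measure (triple n) {\<omega>\<in>space (triple n). \<not> gtyp n s (hc \<omega>) (gc \<omega>) (zc \<omega>)}) \<longlonglongrightarrow> 0"
proof -
  define fs where "fs = [\<lambda>\<omega>. (hc \<omega>)\<^sup>2 - 1, \<lambda>\<omega>. (gc \<omega>)\<^sup>2 - 1, lin 1 0 0 0 s, lin 0 1 0 0 s, lin 0 0 1 0 s, lin 0 0 0 1 s]"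
  define E where "E n f = {\<omega>\<in>space (triple n). real n powr (5/8) \<le> \<bar>tsum n f \<omega>\<bar>}" for n f
  have m[measurable]: "f \<in> borel_measurable ((borel \<Otimes>\<^sub>M borel) \<Otimes>\<^sub>M borel)" if "f \<in> set fs" for f
    using that by (auto simp: fs_def)
  have lim: "(\<lambda>n. measure (triple n) (E n f)) \<longlonglongrightarrow> 0" if f: "f \<in> set fs" for f
  proof -
    have "(\<integral>\<omega>. f \<omega> \<partial>single3) = 0 \<and> integrable single3 (\<lambda>\<omega>. (f \<omega>)\<^sup>2)"
      using f lin_moments(1,2)[OF s] square_moments unfolding fs_def by auto
    then show ?thesis unfolding E_def using m[OF f] by (intro triple_lln) auto
  qed
  have E[measurable]: "E n f \<in> sets (triple n)" if "f \<in> set fs" for n f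
    using m[OF that] unfolding E_def by measurable
  show ?thesis
  proof (rule tendsto_sandwich[of "\<lambda>_. 0"])
    show "\<forall>\<^sub>F n in sequentially. measure (triple n) {\<omega>\<in>space (triple n). \<not> gtyp n s (hc \<omega>) (gc \<omega>) (zc \<omega>)}
        \<le> (\<Sum>f\<in>set fs. measure (triple n) (E n f))"
    proof (rule always_eventually, rule allI)
      fix n
      interpret T: prob_space "triple n" by (rule prob_triple)
      have "{\<omega>\<in>space (triple n). \<not> gtyp n s (hc \<omega>) (gc \<omega>) (zc \<omega>)} \<subseteq> (\<Union>f\<in>set fs. E n f)"
        by (auto simp: E_def fs_def gtyp_def tsum_square tsum_lin not_le split: prod.splits)
      then have "measure (triple n) {\<omega>\<in>space (triple n). \<not> gtyp n s (hc \<omega>) (gc \<omega>) (zc \<omega>)} \<le> measure (triple n) (\<Union>f\<in>set fs. E n f)"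
        using E by (intro T.finite_measure_mono) auto
      also have "\<dots> \<le> (\<Sum>f\<in>set fs. measure (triple n) (E n f))"
        by (rule T.finite_measure_subadditive_finite) (use E in auto)
      finally show "measure (triple n) {\<omega>\<in>space (triple n). \<not> gtyp n s (hc \<omega>) (gc \<omega>) (zc \<omega>)}
        \<le> (\<Sum>f\<in>set fs. measure (triple n) (E n f))" .
    qed
    show "(\<lambda>n. \<Sum>f\<in>set fs. measure (triple n) (E n f)) \<longlonglongrightarrow> 0"
      using tendsto_sum[of "set fs" "\<lambda>f n. measure (triple n) (E n f)" "\<lambda>_. 0" sequentially] lim by simp
  qed simp_all
qed

text \<open>The variance of the squared noise is the second moment of \<open>lin 0 0 0 1 s\<close>,
  hence nonnegative.\<close>

lemma kurtosis:
  assumes s: "(\<integral>z. z\<^sup>2 \<partial>D) = s" shows "s\<^sup>2 \<le> (\<integral>z. z ^ 4 \<partial>D)"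
proof -
  have "0 \<le> (\<integral>\<omega>. (lin 0 0 0 1 s \<omega>)\<^sup>2 \<partial>single3)" by simp
  then show ?thesis unfolding lin_moments(3)[OF s] by simp
qed

text \<open>The central limit theorem divides by sqrt V. The product of codeword and noise keeps V
  positive even for noise of constant modulus.\<close>

lemma V1_pos:
  assumes s: "(\<integral>z. z\<^sup>2 \<partial>D) = s" "0 < s" and a: "0 < a"
  shows "0 < V1 a s (\<integral>z. z ^ 4 \<partial>D)"
  unfolding V1_def using kurtosis[OF s(1)] s a
  by (intro divide_pos_pos add_nonneg_pos) auto

lemma V2_pos:
  assumes s: "(\<integral>z. z\<^sup>2 \<partial>D) = 1" and a: "0 < a" and b: "0 < b"
  shows "0 < V2 b a (\<integral>z. z ^ 4 \<partial>D)"
  unfolding V2_def using kurtosis[OF s(1)] a b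
  by (intro divide_pos_pos add_nonneg_pos mult_nonneg_nonneg) auto

abbreviation true_law :: "nat \<Rightarrow> real \<Rightarrow> real \<Rightarrow> (((nat \<Rightarrow> real) \<times> (nat \<Rightarrow> real)) \<times> (nat \<Rightarrow> real)) measure" where
  "true_law n a b \<equiv> (sphere_unif n (sqrt (n * a)) \<Otimes>\<^sub>M sphere_unif n (sqrt (n * b))) \<Otimes>\<^sub>M noise n D"

lemma true_law_eq:
  "true_law n a b = distr (triple n) ((borel_vec n \<Otimes>\<^sub>M borel_vec n) \<Otimes>\<^sub>M borel_vec n)
    (\<lambda>\<omega>. ((sph n (sqrt (n * a)) (hc \<omega>), sph n (sqrt (n * b)) (gc \<omega>)), zc \<omega>))"
proof -
  note sf = prob_space_imp_sigma_finite
  have N: "distr (noise n D) (borel_vec n) (\<lambda>z. z) = noise n D" by (rule distr_id2) simp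
  have P: "sphere_unif n (sqrt (n * a)) \<Otimes>\<^sub>M sphere_unif n (sqrt (n * b)) =
      distr (gauss_vec n \<Otimes>\<^sub>M gauss_vec n) (borel_vec n \<Otimes>\<^sub>M borel_vec n)
        (\<lambda>(h, g). (sph n (sqrt (n * a)) h, sph n (sqrt (n * b)) g))"
    unfolding sphere_unif_eq
    by (rule pair_measure_distr) (measurable, rule sf, rule gv.prob_space_distr, measurable)
  have "true_law n a b = distr (gauss_vec n \<Otimes>\<^sub>M gauss_vec n) (borel_vec n \<Otimes>\<^sub>M borel_vec n)
        (\<lambda>(h, g). (sph n (sqrt (n * a)) h, sph n (sqrt (n * b)) g)) \<Otimes>\<^sub>M distr (noise n D) (borel_vec n) (\<lambda>z. z)"
    unfolding N P ..
  also have "\<dots> = distr (triple n) ((borel_vec n \<Otimes>\<^sub>M borel_vec n) \<Otimes>\<^sub>M borel_vec n)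
    (\<lambda>(x, z). ((\<lambda>(h, g). (sph n (sqrt (n * a)) h, sph n (sqrt (n * b)) g)) x, z))"
    by (rule pair_measure_distr) (measurable, unfold N, rule sf[OF prob_noise])
  finally show ?thesis by (simp add: case_prod_beta')
qed

text \<open>Common to both users, who differ in the coefficients of the linear statistic and in
  \<open>G\<close>. Failure of \<open>G\<close> forces either an atypical triple, of vanishing
  probability, or a small statistic, whose probability converges by the central limit
  theorem.\<close>

lemma bad_prob:
  fixes a b s L :: real
  assumes s: "(\<integral>z. z\<^sup>2 \<partial>D) = s"
    and V: "V = p\<^sup>2 + q\<^sup>2 * s + r\<^sup>2 * s + t\<^sup>2 * ((\<integral>z. z ^ 4 \<partial>D) - s\<^sup>2)" "0 < V"
    and G: "\<And>n. Measurable.pred ((borel_vec n \<Otimes>\<^sub>M borel_vec n) \<Otimes>\<^sub>M borel_vec n) (\<lambda>\<omega>. G n (hc \<omega>) (gc \<omega>) (zc \<omega>))"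
    and ev: "\<forall>\<^sub>F n in sequentially. \<forall>h g z. gtyp n s h g z \<longrightarrow> - (sqrt n * L) < tsum n (lin p q r t s) ((h, g), z) \<longrightarrow>
      G n (sph n (sqrt (n * a)) h) (sph n (sqrt (n * b)) g) z"
  shows "\<exists>R. R \<longlonglongrightarrow> Qfun (L / sqrt V) \<and>
    (\<forall>\<^sub>F n in sequentially. measure (true_law n a b) {\<omega>\<in>space (true_law n a b). \<not> G n (hc \<omega>) (gc \<omega>) (zc \<omega>)} \<le> R n)"
proof -
  let ?f = "lin p q r t s"
  let ?A = "\<lambda>n. {\<omega>\<in>space (triple n). \<not> gtyp n s (hc \<omega>) (gc \<omega>) (zc \<omega>)}"
  let ?B = "\<lambda>n. {\<omega>\<in>space (triple n). tsum n ?f \<omega> \<le> - (sqrt n * L)}"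
  let ?R = "\<lambda>n. measure (triple n) (?A n) + measure (triple n) (?B n)"
  have "?R \<longlonglongrightarrow> 0 + Qfun (L / sqrt V)"
    using lin_moments[OF s, of p q r t] V
    by (intro tendsto_add gtyp_tendsto[OF s] triple_clt) auto
  moreover have "\<forall>\<^sub>F n in sequentially. measure (true_law n a b) {\<omega>\<in>space (true_law n a b). \<not> G n (hc \<omega>) (gc \<omega>) (zc \<omega>)} \<le> ?R n"
    using ev
  proof eventually_elim
    case (elim n)
    interpret T: prob_space "triple n" by (rule prob_triple)
    let ?S = "\<lambda>\<omega>. ((sph n (sqrt (n * a)) (hc \<omega>), sph n (sqrt (n * b)) (gc \<omega>)), zc \<omega>)"
    let ?M = "(borel_vec n \<Otimes>\<^sub>M borel_vec n) \<Otimes>\<^sub>M borel_vec n"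
    note [measurable] = G
    have S: "?S \<in> triple n \<rightarrow>\<^sub>M ?M" by measurable
    have sp: "space (true_law n a b) = space ?M"
      by (simp add: space_pair_measure true_law_eq)
    have X: "{\<omega>\<in>space ?M. \<not> G n (hc \<omega>) (gc \<omega>) (zc \<omega>)} \<in> sets ?M" by measurable
    have "measure (true_law n a b) {\<omega>\<in>space ?M. \<not> G n (hc \<omega>) (gc \<omega>) (zc \<omega>)} =
      measure (triple n) (?S -` {\<omega>\<in>space ?M. \<not> G n (hc \<omega>) (gc \<omega>) (zc \<omega>)} \<inter> space (triple n))"
      unfolding true_law_eq by (rule measure_distr[OF S X])
    also have "\<dots> \<le> measure (triple n) (?A n \<union> ?B n)"
    proof (rule T.finite_measure_mono)
      show "?S -` {\<omega>\<in>space ?M. \<not> G n (hc \<omega>) (gc \<omega>) (zc \<omega>)} \<inter> space (triple n) \<subseteq> ?A n \<union> ?B n"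
        using elim by (auto simp: not_less)
      show "?A n \<union> ?B n \<in> sets (triple n)" by measurable
    qed
    also have "\<dots> \<le> ?R n" by (rule measure_Un_le) measurable
    finally show ?case unfolding sp .
  qed
  ultimately show ?thesis by auto
qed

lemma good1_prob:
  fixes a b s L :: real
  assumes s: "(\<integral>z. z\<^sup>2 \<partial>D) = s" "0 < s" and a: "0 < a" and b: "0 < b"
  shows "\<exists>R. R \<longlonglongrightarrow> Qfun (L / sqrt (V1 a s (\<integral>z. z ^ 4 \<partial>D))) \<and>
    (\<forall>\<^sub>F n in sequentially. measure (true_law n a b) {\<omega>\<in>space (true_law n a b). \<not> good1 a b s L n (hc \<omega>) (gc \<omega>) (zc \<omega>)} \<le> R n)"
proof (rule bad_prob[OF s(1)])
  let ?k = "a / (2 * s * (s + a))" and ?\<zeta> = "\<integral>z. z ^ 4 \<partial>D"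
  have nz: "s \<noteq> 0" "s + a \<noteq> 0" using s a by auto
  \<comment> \<open>The two summands of \<open>V1\<close> are the contributions of the
    codeword-noise product and of the noise energy.\<close>
  have "(sqrt a / (s + a))\<^sup>2 * s = 4 * a * s^3 / (4 * s\<^sup>2 * (a + s)\<^sup>2)"
    using a nz by (simp add: power_divide add.commute power2_eq_square power3_eq_cube)
  moreover have "?k\<^sup>2 * (?\<zeta> - s\<^sup>2) = a\<^sup>2 * (?\<zeta> - s\<^sup>2) / (4 * s\<^sup>2 * (a + s)\<^sup>2)"
    by (simp add: power_divide power_mult_distrib add.commute)
  ultimately show "V1 a s ?\<zeta> = 0\<^sup>2 + 0\<^sup>2 * s + (sqrt a / (s + a))\<^sup>2 * s + (- ?k)\<^sup>2 * (?\<zeta> - s\<^sup>2)"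
    by (simp add: V1_def add_divide_distrib)
  show "0 < V1 a s ?\<zeta>" by (rule V1_pos[OF s a])
  show "\<forall>\<^sub>F n in sequentially. \<forall>h g z. gtyp n s h g z \<longrightarrow> - (sqrt n * L) < tsum n (lin 0 0 (sqrt a / (s + a)) (- ?k) s) ((h, g), z) \<longrightarrow>
      good1 a b s L n (sph n (sqrt (n * a)) h) (sph n (sqrt (n * b)) g) z"
    using eventually_gt_at_top[of 0] eventually_powr_small[OF less_consts(2)]
      eventually_powr_le[OF less_consts(1), of "sqrt a / (s + a)"]
  proof eventually_elim
    case (elim n)
    show ?case
    proof (intro allI impI)
      fix h g z assume gt: "gtyp n s h g z" and T: "- (sqrt n * L) < tsum n (lin 0 0 (sqrt a / (s + a)) (- ?k) s) ((h, g), z)"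
      interpret typical_triple n a b s h g z "sph n (sqrt (n * a)) h" "sph n (sqrt (n * b)) g"
        by unfold_locales (use elim gt a b in auto)
      show "good1 a b s L n (sph n (sqrt (n * a)) h) (sph n (sqrt (n * b)) g) z"
        unfolding good1_def typ_const_def using typical info_user1[OF s(2)] T elim by simp
    qed
  qed
qed measurable

lemma good2_prob:
  fixes a b s L :: real
  assumes s: "(\<integral>z. z\<^sup>2 \<partial>D) = s" "s = 1" and a: "0 < a" and b: "0 < b"
  shows "\<exists>R. R \<longlonglongrightarrow> Qfun (L / sqrt (V2 b a (\<integral>z. z ^ 4 \<partial>D))) \<and>
    (\<forall>\<^sub>F n in sequentially. measure (true_law n a b) {\<omega>\<in>space (true_law n a b). \<not> good2 a b s L n (hc \<omega>) (gc \<omega>) (zc \<omega>)} \<le> R n)"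
proof (rule bad_prob[OF s(1)])
  let ?\<tau> = "a + s"
  let ?k = "b / (2 * (a + s) * (a + s + b))" and ?\<zeta> = "\<integral>z. z ^ 4 \<partial>D"
  let ?p = "sqrt a * sqrt b / (?\<tau> + b)" and ?q = "sqrt b / (?\<tau> + b)" and ?r = "- 2 * ?k * sqrt a"
  define E where "E = 4 * (a + 1)\<^sup>2 * (b + a + 1)\<^sup>2"
  have nz: "a + 1 \<noteq> 0" "b + a + 1 \<noteq> 0" using a b by auto
  then have E: "E \<noteq> 0" by (simp add: E_def)
  have k2: "?k\<^sup>2 = b\<^sup>2 / E" unfolding E_def s(2)
    by (simp add: power_divide power_mult_distrib add_ac del: distrib_left_numeral)
  \<comment> \<open>The weak codeword meets interference of power a and noise of power 1, which
    together act as noise of power a + 1.\<close>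
  have pq: "?p\<^sup>2 + ?q\<^sup>2 * s = 4 * b * (a + 1)^3 / E"
  proof -
    have "?p\<^sup>2 + ?q\<^sup>2 * s = b * (a + 1) / (b + a + 1)\<^sup>2"
      using a b unfolding s(2) by (simp add: power_divide power_mult_distrib add_ac add_divide_distrib algebra_simps)
    also have "\<dots> = 4 * b * (a + 1)^3 / E"
      using nz unfolding E_def by (simp add: power2_eq_square power3_eq_cube)
    finally show ?thesis .
  qed
  \<comment> \<open>The energy of interference plus noise fluctuates through their product; this is
    the origin of the summand 4 a in \<open>V2\<close>.\<close>
  have r2: "?r\<^sup>2 = 4 * a * (b\<^sup>2 / E)"
  proof -
    have "(- 2 * k * sqrt a)\<^sup>2 = 4 * a * k\<^sup>2" for k
      using a by (simp add: power_mult_distrib)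
    then show ?thesis unfolding k2[symmetric] .
  qed
  show "V2 b a ?\<zeta> = ?p\<^sup>2 + ?q\<^sup>2 * s + ?r\<^sup>2 * s + (- ?k)\<^sup>2 * (?\<zeta> - s\<^sup>2)"
    unfolding pq r2 power2_minus k2 unfolding V2_def E_def[symmetric] s(2)
    by (simp add: add_divide_distrib diff_divide_distrib algebra_simps)
  show "0 < V2 b a ?\<zeta>" using s a b by (intro V2_pos) auto
  show "\<forall>\<^sub>F n in sequentially. \<forall>h g z. gtyp n s h g z \<longrightarrow> - (sqrt n * L) < tsum n (lin ?p ?q ?r (- ?k) s) ((h, g), z) \<longrightarrow>
      good2 a b s L n (sph n (sqrt (n * a)) h) (sph n (sqrt (n * b)) g) z"
    using eventually_gt_at_top[of 0] eventually_powr_small[OF less_consts(2)]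
      eventually_powr_le[OF less_consts(1), of "3 * (sqrt a * sqrt b) / (?\<tau> + b) + sqrt b / (?\<tau> + b) + 2 * ?k * sqrt a"]
  proof eventually_elim
    case (elim n)
    show ?case
    proof (intro allI impI)
      fix h g z assume gt: "gtyp n s h g z" and T: "- (sqrt n * L) < tsum n (lin ?p ?q ?r (- ?k) s) ((h, g), z)"
      interpret typical_triple n a b s h g z "sph n (sqrt (n * a)) h" "sph n (sqrt (n * b)) g"
        by unfold_locales (use elim gt a b in auto)
      have s0: "0 < s" using s by simp
      show "good2 a b s L n (sph n (sqrt (n * a)) h) (sph n (sqrt (n * b)) g) z"
        unfolding good2_def typ_const_def using typical info_user2[OF s0] T elim(3) by linarith
    qed
  qed
qed measurable

end

section \<open>Integrating over the ensemble one wrong codeword at a time\<close>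

lemma nn_integral_pair_le_fst:
  assumes "prob_space M" "prob_space N" and f: "f \<in> borel_measurable (M \<Otimes>\<^sub>M N)"
    and le: "\<And>x. x \<in> space M \<Longrightarrow> (\<integral>\<^sup>+y. f (x, y) \<partial>N) \<le> c"
  shows "(\<integral>\<^sup>+p. f p \<partial>(M \<Otimes>\<^sub>M N)) \<le> c"
proof -
  interpret M: prob_space M by fact
  interpret N: prob_space N by fact
  show ?thesis
    unfolding N.nn_integral_fst[OF f, symmetric] by (rule M.nn_integral_le_const'[OF le])
qed

lemma nn_integral_pair_le_snd:
  assumes "prob_space M" "prob_space N" and f: "f \<in> borel_measurable (M \<Otimes>\<^sub>M N)"
    and le: "\<And>y. y \<in> space N \<Longrightarrow> (\<integral>\<^sup>+x. f (x, y) \<partial>M) \<le> c"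
  shows "(\<integral>\<^sup>+p. f p \<partial>(M \<Otimes>\<^sub>M N)) \<le> c"
proof -
  interpret M: prob_space M by fact
  interpret N: prob_space N by fact
  interpret pair_sigma_finite M N ..
  show ?thesis
    unfolding nn_integral_snd[OF f, symmetric] by (rule N.nn_integral_le_const'[OF le])
qed

text \<open>Fubini's theorem is used twice, to move the integration over the two wrong codewords
  inside while all others stay frozen.\<close>

lemma nn_integral_codebook_pair_le:
  assumes w1: "w1 < M1" and w2: "w2 < M2"
    and f[measurable]: "f \<in> borel_measurable (codebook n M1 a \<Otimes>\<^sub>M codebook n M2 b)"
    and le: "\<And>v u. v \<in> space (PiM ({..<M1} - {w1}) (\<lambda>_. borel_vec n)) \<Longrightarrow>
        u \<in> space (PiM ({..<M2} - {w2}) (\<lambda>_. borel_vec n)) \<Longrightarrow>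
      (\<integral>\<^sup>+x. \<integral>\<^sup>+y. f (v(w1 := x), u(w2 := y)) \<partial>sphere_unif n (sqrt (n * b)) \<partial>sphere_unif n (sqrt (n * a))) \<le> c"
  shows "(\<integral>\<^sup>+p. f p \<partial>(codebook n M1 a \<Otimes>\<^sub>M codebook n M2 b)) \<le> c"
proof -
  interpret C1: prob_space "codebook n M1 a" by (rule prob_codebook)
  interpret C2: prob_space "codebook n M2 b" by (rule prob_codebook)
  let ?S = "sphere_unif n (sqrt (n * a))" and ?T = "sphere_unif n (sqrt (n * b))"
  interpret P: pair_sigma_finite ?S "codebook n M2 b" ..
  interpret Q: pair_sigma_finite ?S ?T ..
  have upd: "(\<lambda>x. v(w := x)) \<in> borel_vec n \<rightarrow>\<^sub>M PiM {..<M} (\<lambda>_. borel_vec n)"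
    if "w < M" "v \<in> space (PiM ({..<M} - {w}) (\<lambda>_. borel_vec n))" for v w M
  proof -
    have "(\<lambda>x. v(w := x)) \<in> borel_vec n \<rightarrow>\<^sub>M PiM (insert w ({..<M} - {w})) (\<lambda>_. borel_vec n)"
      using that(2) by measurable
    then show ?thesis using that(1) by (simp add: insert_absorb)
  qed
  have "(\<integral>\<^sup>+p. f p \<partial>(codebook n M1 a \<Otimes>\<^sub>M codebook n M2 b)) = (\<integral>\<^sup>+v. \<integral>\<^sup>+u. f (v, u) \<partial>codebook n M2 b \<partial>codebook n M1 a)"
    by (rule C2.nn_integral_fst[OF f, symmetric])
  also have "\<dots> \<le> c"
  proof (rule nn_integral_codebook_le[OF w1])
    show "(\<lambda>v. \<integral>\<^sup>+u. f (v, u) \<partial>codebook n M2 b) \<in> borel_measurable (codebook n M1 a)" by measurable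
    fix v assume v: "v \<in> space (PiM ({..<M1} - {w1}) (\<lambda>_. borel_vec n))"
    have [measurable]: "(\<lambda>x. v(w1 := x)) \<in> borel_vec n \<rightarrow>\<^sub>M PiM {..<M1} (\<lambda>_. borel_vec n)" by (rule upd[OF w1 v])
    have m: "(\<lambda>(x, u). f (v(w1 := x), u)) \<in> borel_measurable (?S \<Otimes>\<^sub>M codebook n M2 b)" by measurable
    have "(\<integral>\<^sup>+x. \<integral>\<^sup>+u. f (v(w1 := x), u) \<partial>codebook n M2 b \<partial>?S) = (\<integral>\<^sup>+u. \<integral>\<^sup>+x. f (v(w1 := x), u) \<partial>?S \<partial>codebook n M2 b)"
      using P.Fubini'[OF m] by simp
    also have "\<dots> \<le> c"
    proof (rule nn_integral_codebook_le[OF w2])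
      show "(\<lambda>u. \<integral>\<^sup>+x. f (v(w1 := x), u) \<partial>?S) \<in> borel_measurable (codebook n M2 b)" by measurable
      fix u assume u: "u \<in> space (PiM ({..<M2} - {w2}) (\<lambda>_. borel_vec n))"
      have [measurable]: "(\<lambda>x. u(w2 := x)) \<in> borel_vec n \<rightarrow>\<^sub>M PiM {..<M2} (\<lambda>_. borel_vec n)" by (rule upd[OF w2 u])
      have m: "(\<lambda>(x, y). f (v(w1 := x), u(w2 := y))) \<in> borel_measurable (?S \<Otimes>\<^sub>M ?T)" by measurable
      show "(\<integral>\<^sup>+y. \<integral>\<^sup>+x. f (v(w1 := x), u(w2 := y)) \<partial>?S \<partial>?T) \<le> c"
        using Q.Fubini'[OF m] le[OF v u] by simp
    qed
    finally show "(\<integral>\<^sup>+x. \<integral>\<^sup>+u. f (v(w1 := x), u) \<partial>codebook n M2 b \<partial>?S) \<le> c" .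
  qed
  finally show ?thesis .
qed

lemma ennreal_indicator_section_le:
  assumes "{x \<in> space M. P x} \<in> sets M" "emeasure M {x \<in> space M. P x} \<le> c"
    and "\<And>x. x \<in> space M \<Longrightarrow> f x \<le> indicator {x \<in> space M. P x} x"
  shows "(\<integral>\<^sup>+x. f x \<partial>M) \<le> c"
proof -
  have "(\<integral>\<^sup>+x. f x \<partial>M) \<le> (\<integral>\<^sup>+x. indicator {x \<in> space M. P x} x \<partial>M)"
    by (rule nn_integral_mono) (rule assms(3))
  also have "\<dots> = emeasure M {x \<in> space M. P x}" by (rule nn_integral_indicator) (rule assms)
  finally show ?thesis using assms(2) by simp
qed

text \<open>One sent message pair is fixed. All bounds below are uniform in it, so the average over
  messages is left to \<open>average_le\<close>.\<close>

locale code_ensemble = noise_law D for D :: "real measure" +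
  fixes n M1 M2 w1 w2 :: nat and P \<alpha> :: real
  assumes w1: "w1 < M1" and w2: "w2 < M2"
begin

abbreviation "E \<equiv> ens n D P \<alpha> M1 M2"
abbreviation "SV \<equiv> sphere_unif n (sqrt (n * (\<alpha> * P)))"
abbreviation "SU \<equiv> sphere_unif n (sqrt (n * ((1 - \<alpha>) * P)))"
abbreviation "vec3 \<equiv> (borel_vec n \<Otimes>\<^sub>M borel_vec n) \<Otimes>\<^sub>M borel_vec n"

lemma prob_ens: "prob_space E"
  unfolding ens_def by (intro prob_space_pair prob_codebook prob_noise)

sublocale ens: prob_space E by (rule prob_ens)

lemma sets_ens [measurable_cong]:
  "sets E = sets ((PiM {..<M1} (\<lambda>_. borel_vec n) \<Otimes>\<^sub>M PiM {..<M2} (\<lambda>_. borel_vec n)) \<Otimes>\<^sub>M borel_vec n)"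
  unfolding ens_def by (intro sets_pair_measure_cong sets_codebook sets_noise)

lemma codeword_measurable [measurable]:
  "w < M1 \<Longrightarrow> (\<lambda>\<omega>. hc \<omega> w) \<in> E \<rightarrow>\<^sub>M borel_vec n" "w < M2 \<Longrightarrow> (\<lambda>\<omega>. gc \<omega> w) \<in> E \<rightarrow>\<^sub>M borel_vec n"
  "(\<lambda>\<omega>. zc \<omega>) \<in> E \<rightarrow>\<^sub>M borel_vec n"
proof -
  show "w < M1 \<Longrightarrow> (\<lambda>\<omega>. hc \<omega> w) \<in> E \<rightarrow>\<^sub>M borel_vec n"
    unfolding measurable_cong_sets[OF sets_ens refl]
    by (rule measurable_compose[OF measurable_compose[OF measurable_fst measurable_fst] measurable_component_singleton]) simp
  show "w < M2 \<Longrightarrow> (\<lambda>\<omega>. gc \<omega> w) \<in> E \<rightarrow>\<^sub>M borel_vec n"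
    unfolding measurable_cong_sets[OF sets_ens refl]
    by (rule measurable_compose[OF measurable_compose[OF measurable_fst measurable_snd] measurable_component_singleton]) simp
  show "(\<lambda>\<omega>. zc \<omega>) \<in> E \<rightarrow>\<^sub>M borel_vec n"
    unfolding measurable_cong_sets[OF sets_ens refl] by (rule measurable_snd)
qed

text \<open>The sent pair and the noise have a law free of the messages and the codebook sizes, so
  the favourable event is equally likely for all of them.\<close>

lemma ens_marginal:
  assumes Q[measurable]: "Measurable.pred vec3 (\<lambda>\<omega>. Q (hc \<omega>) (gc \<omega>) (zc \<omega>))"
  shows "measure E {\<omega>\<in>space E. Q (hc \<omega> w1) (gc \<omega> w2) (zc \<omega>)} =
    measure (true_law n (\<alpha> * P) ((1 - \<alpha>) * P)) {\<omega>\<in>space (true_law n (\<alpha> * P) ((1 - \<alpha>) * P)). Q (hc \<omega>) (gc \<omega>) (zc \<omega>)}"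
proof -
  note sf = prob_space_imp_sigma_finite
  let ?F = "\<lambda>\<omega>. ((hc \<omega> w1, gc \<omega> w2), zc \<omega>)"
  let ?T = "true_law n (\<alpha> * P) ((1 - \<alpha>) * P)"
  let ?c1 = "codebook n M1 (\<alpha> * P)" and ?c2 = "codebook n M2 ((1 - \<alpha>) * P)"
  have W: "w1 \<in> {..<M1}" "w2 \<in> {..<M2}" using w1 w2 by auto
  have m1[measurable]: "(\<lambda>v. v w1) \<in> ?c1 \<rightarrow>\<^sub>M borel_vec n" and m2[measurable]: "(\<lambda>v. v w2) \<in> ?c2 \<rightarrow>\<^sub>M borel_vec n"
    unfolding measurable_cong_sets[OF sets_codebook refl] by (rule measurable_component_singleton, rule W)+
  have N: "distr (noise n D) (borel_vec n) (\<lambda>z. z) = noise n D" by (rule distr_id2) simp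
  note d1 = distr_codebook[OF w1, of n "\<alpha> * P"] and d2 = distr_codebook[OF w2, of n "(1 - \<alpha>) * P"]
  have C: "SV \<Otimes>\<^sub>M SU = distr (?c1 \<Otimes>\<^sub>M ?c2) (borel_vec n \<Otimes>\<^sub>M borel_vec n) (\<lambda>(v, u). (v w1, u w2))"
    unfolding d1[symmetric] d2[symmetric]
    by (rule pair_measure_distr[OF m1 m2]) (unfold d2, rule sf[OF prob_sphere_unif])
  have mp: "(\<lambda>(v, u). (v w1, u w2)) \<in> ?c1 \<Otimes>\<^sub>M ?c2 \<rightarrow>\<^sub>M borel_vec n \<Otimes>\<^sub>M borel_vec n"
    unfolding case_prod_beta'
    by (rule measurable_Pair[OF measurable_compose[OF measurable_fst m1] measurable_compose[OF measurable_snd m2]])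
  have mz: "(\<lambda>z. z) \<in> noise n D \<rightarrow>\<^sub>M borel_vec n" by (rule measurable_ident_sets) simp
  have "?T = distr (?c1 \<Otimes>\<^sub>M ?c2) (borel_vec n \<Otimes>\<^sub>M borel_vec n) (\<lambda>(v, u). (v w1, u w2)) \<Otimes>\<^sub>M distr (noise n D) (borel_vec n) (\<lambda>z. z)"
    unfolding N C ..
  also have "\<dots> = distr E vec3 (\<lambda>(x, z). ((\<lambda>(v, u). (v w1, u w2)) x, z))"
    unfolding ens_def by (rule pair_measure_distr[OF mp mz]) (unfold N, rule sf[OF prob_noise])
  also have "\<dots> = distr E vec3 ?F" by (simp add: case_prod_beta')
  finally have T: "?T = distr E vec3 ?F" .
  have F: "?F \<in> E \<rightarrow>\<^sub>M vec3"
    by (intro measurable_Pair codeword_measurable w1 w2)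
  have sp: "space ?T = space vec3" by (simp add: T)
  have X: "{\<omega>\<in>space vec3. Q (hc \<omega>) (gc \<omega>) (zc \<omega>)} \<in> sets vec3" by measurable
  have "measure ?T {\<omega>\<in>space vec3. Q (hc \<omega>) (gc \<omega>) (zc \<omega>)} =
      measure E (?F -` {\<omega>\<in>space vec3. Q (hc \<omega>) (gc \<omega>) (zc \<omega>)} \<inter> space E)"
    unfolding T by (rule measure_distr[OF F X])
  also have "?F -` {\<omega>\<in>space vec3. Q (hc \<omega>) (gc \<omega>) (zc \<omega>)} \<inter> space E = {\<omega>\<in>space E. Q (hc \<omega> w1) (gc \<omega> w2) (zc \<omega>)}"
    using measurable_space[OF F] by auto
  finally show ?thesis unfolding sp by simp
qed

lemma ens_le:
  assumes A: "A \<in> sets E" and k: "0 \<le> k"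
    and le: "\<And>z. z \<in> space (borel_vec n) \<Longrightarrow>
      (\<integral>\<^sup>+p. indicator A (p, z) \<partial>(codebook n M1 (\<alpha> * P) \<Otimes>\<^sub>M codebook n M2 ((1 - \<alpha>) * P))) \<le> ennreal k"
  shows "measure E A \<le> k"
proof -
  have "emeasure E A = (\<integral>\<^sup>+p. indicator A p \<partial>E)" using A by simp
  also have "\<dots> \<le> ennreal k"
    unfolding ens_def
  proof (rule nn_integral_pair_le_snd)
    show "prob_space (codebook n M1 (\<alpha> * P) \<Otimes>\<^sub>M codebook n M2 ((1 - \<alpha>) * P))"
      by (intro prob_space_pair prob_codebook)
    show "indicator A \<in> borel_measurable ((codebook n M1 (\<alpha> * P) \<Otimes>\<^sub>M codebook n M2 ((1 - \<alpha>) * P)) \<Otimes>\<^sub>M noise n D)"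
      using A unfolding ens_def by (rule borel_measurable_indicator)
    fix z assume "z \<in> space (noise n D)"
    then have "z \<in> space (borel_vec n)" by (simp add: sets_eq_imp_space_eq[OF sets_noise])
    then show "(\<integral>\<^sup>+p. indicator A (p, z) \<partial>(codebook n M1 (\<alpha> * P) \<Otimes>\<^sub>M codebook n M2 ((1 - \<alpha>) * P))) \<le> ennreal k"
      by (rule le)
  qed (rule prob_noise)
  finally show ?thesis using k by (simp add: ens.emeasure_eq_measure)
qed

lemma section_measurable:
  assumes A: "A \<in> sets E" and z: "z \<in> space (borel_vec n)"
  shows "(\<lambda>p. indicator A (p, z) :: ennreal) \<in> borel_measurable (codebook n M1 (\<alpha> * P) \<Otimes>\<^sub>M codebook n M2 ((1 - \<alpha>) * P))"
proof -
  have z': "z \<in> space (noise n D)" using z by (simp add: sets_eq_imp_space_eq[OF sets_noise])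
  show ?thesis
    by (rule measurable_compose[OF measurable_Pair2'[OF z'] borel_measurable_indicator[OF A[unfolded ens_def]]])
qed

text \<open>As w differs from w1, resampling the w-th codeword leaves the sent triple untouched.
  With all else frozen, the event concerns a single uniform point of the sphere.\<close>

lemma wrong_v:
  assumes w: "w < M1" "w \<noteq> w1" and k: "0 \<le> k"
    and R: "{\<omega>\<in>space E. R (hc \<omega> w1) (gc \<omega> w2) (zc \<omega>) (hc \<omega> w)} \<in> sets E" (is "?A \<in> _")
    and Rx: "\<And>v u z. {x\<in>space SV. R v u z x} \<in> sets SV"
    and le: "\<And>v u z. emeasure SV {x\<in>space SV. R v u z x} \<le> ennreal k"
  shows "measure E ?A \<le> k"
proof (rule ens_le[OF R k])
  fix z assume z: "z \<in> space (borel_vec n)"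
  note m[measurable] = section_measurable[OF R z]
  show "(\<integral>\<^sup>+p. indicator ?A (p, z) \<partial>(codebook n M1 (\<alpha> * P) \<Otimes>\<^sub>M codebook n M2 ((1 - \<alpha>) * P))) \<le> ennreal k"
  proof (rule nn_integral_pair_le_snd[OF prob_codebook prob_codebook m])
    fix u assume u: "u \<in> space (codebook n M2 ((1 - \<alpha>) * P))"
    show "(\<integral>\<^sup>+v. indicator ?A ((v, u), z) \<partial>codebook n M1 (\<alpha> * P)) \<le> ennreal k"
    proof (rule nn_integral_codebook_le[OF w(1)])
      show "(\<lambda>v. indicator ?A ((v, u), z) :: ennreal) \<in> borel_measurable (codebook n M1 (\<alpha> * P))"
        using measurable_compose[OF measurable_Pair2'[OF u] m] by simp
      fix v
      show "(\<integral>\<^sup>+x. indicator ?A ((v(w := x), u), z) \<partial>SV) \<le> ennreal k"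
        by (rule ennreal_indicator_section_le[OF Rx le, of _ "v w1" "u w2" z])
          (use w in \<open>auto simp: indicator_def\<close>)
    qed
  qed
qed

lemma wrong_u:
  assumes w: "w < M2" "w \<noteq> w2" and k: "0 \<le> k"
    and R: "{\<omega>\<in>space E. R (hc \<omega> w1) (gc \<omega> w2) (zc \<omega>) (gc \<omega> w)} \<in> sets E" (is "?A \<in> _")
    and Rx: "\<And>v u z. {x\<in>space SU. R v u z x} \<in> sets SU"
    and le: "\<And>v u z. emeasure SU {x\<in>space SU. R v u z x} \<le> ennreal k"
  shows "measure E ?A \<le> k"
proof (rule ens_le[OF R k])
  fix z assume z: "z \<in> space (borel_vec n)"
  note m[measurable] = section_measurable[OF R z]
  show "(\<integral>\<^sup>+p. indicator ?A (p, z) \<partial>(codebook n M1 (\<alpha> * P) \<Otimes>\<^sub>M codebook n M2 ((1 - \<alpha>) * P))) \<le> ennreal k"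
  proof (rule nn_integral_pair_le_fst[OF prob_codebook prob_codebook m])
    fix v assume v: "v \<in> space (codebook n M1 (\<alpha> * P))"
    show "(\<integral>\<^sup>+u. indicator ?A ((v, u), z) \<partial>codebook n M2 ((1 - \<alpha>) * P)) \<le> ennreal k"
    proof (rule nn_integral_codebook_le[OF w(1)])
      show "(\<lambda>u. indicator ?A ((v, u), z) :: ennreal) \<in> borel_measurable (codebook n M2 ((1 - \<alpha>) * P))"
        using measurable_compose[OF measurable_Pair1'[OF v] m] by simp
      fix u
      show "(\<integral>\<^sup>+x. indicator ?A ((v, u(w := x)), z) \<partial>SU) \<le> ennreal k"
        by (rule ennreal_indicator_section_le[OF Rx le, of _ "v w1" "u w2" z])
          (use w in \<open>auto simp: indicator_def\<close>)
    qed
  qed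
qed

lemma wrong_vu:
  assumes w: "w < M1" "w \<noteq> w1" and w': "w' < M2" "w' \<noteq> w2" and k: "0 \<le> k"
    and R: "{\<omega>\<in>space E. R (hc \<omega> w1) (gc \<omega> w2) (zc \<omega>) (hc \<omega> w) (gc \<omega> w')} \<in> sets E" (is "?A \<in> _")
    and Rx: "\<And>v u z x. {y\<in>space SU. R v u z x y} \<in> sets SU"
    and le: "\<And>v u z. (\<integral>\<^sup>+x. emeasure SU {y\<in>space SU. R v u z x y} \<partial>SV) \<le> ennreal k"
  shows "measure E ?A \<le> k"
proof (rule ens_le[OF R k])
  fix z assume z: "z \<in> space (borel_vec n)"
  note m[measurable] = section_measurable[OF R z]
  show "(\<integral>\<^sup>+p. indicator ?A (p, z) \<partial>(codebook n M1 (\<alpha> * P) \<Otimes>\<^sub>M codebook n M2 ((1 - \<alpha>) * P))) \<le> ennreal k"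
  proof (rule nn_integral_codebook_pair_le[OF w(1) w'(1) m])
    fix v u
    have "(\<integral>\<^sup>+x. \<integral>\<^sup>+y. indicator ?A ((v(w := x), u(w' := y)), z) \<partial>SU \<partial>SV) \<le>
      (\<integral>\<^sup>+x. emeasure SU {y\<in>space SU. R (v w1) (u w2) z x y} \<partial>SV)"
      by (rule nn_integral_mono, rule ennreal_indicator_section_le[OF Rx order_refl])
        (use w w' in \<open>auto simp: indicator_def\<close>)
    then show "(\<integral>\<^sup>+x. \<integral>\<^sup>+y. indicator ?A ((v(w := x), u(w' := y)), z) \<partial>SU \<partial>SV) \<le> ennreal k"
      using le by (rule order_trans)
  qed
qed

end

section \<open>Error events of the decoders and union bounds\<close>

lemma pred_real_le:
  fixes f g :: "'a \<Rightarrow> real"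
  assumes "f \<in> borel_measurable M" "g \<in> borel_measurable M"
  shows "Measurable.pred M (\<lambda>x. f x \<le> g x)"
  using borel_measurable_le[OF assms] by (simp add: pred_def)

lemma sets_const_conj: "{x\<in>space M. B x} \<in> sets M \<Longrightarrow> {x\<in>space M. A \<and> B x} \<in> sets M"
  by (cases A) auto

context code_ensemble begin

lemma pair_event_measurable:
  assumes R: "Measurable.pred (vec3 \<Otimes>\<^sub>M borel_vec n) (\<lambda>p. R (hc (fst p)) (gc (fst p)) (zc (fst p)) (snd p))"
    and f: "f \<in> E \<rightarrow>\<^sub>M borel_vec n"
  shows "{\<omega>\<in>space E. R (hc \<omega> w1) (gc \<omega> w2) (zc \<omega>) (f \<omega>)} \<in> sets E"
proof -
  have "(\<lambda>\<omega>. (((hc \<omega> w1, gc \<omega> w2), zc \<omega>), f \<omega>)) \<in> E \<rightarrow>\<^sub>M vec3 \<Otimes>\<^sub>M borel_vec n"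
    by (intro measurable_Pair codeword_measurable w1 w2 f)
  from measurable_compose[OF this R] show ?thesis by (simp add: pred_def)
qed

lemma pair_event_measurable2:
  assumes R: "Measurable.pred ((vec3 \<Otimes>\<^sub>M borel_vec n) \<Otimes>\<^sub>M borel_vec n)
      (\<lambda>p. R (hc (fst (fst p))) (gc (fst (fst p))) (zc (fst (fst p))) (snd (fst p)) (snd p))"
    and f: "f \<in> E \<rightarrow>\<^sub>M borel_vec n" and g: "g \<in> E \<rightarrow>\<^sub>M borel_vec n"
  shows "{\<omega>\<in>space E. R (hc \<omega> w1) (gc \<omega> w2) (zc \<omega>) (f \<omega>) (g \<omega>)} \<in> sets E"
proof -
  have "(\<lambda>\<omega>. ((((hc \<omega> w1, gc \<omega> w2), zc \<omega>), f \<omega>), g \<omega>)) \<in> E \<rightarrow>\<^sub>M (vec3 \<Otimes>\<^sub>M borel_vec n) \<Otimes>\<^sub>M borel_vec n"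
    by (intro measurable_Pair codeword_measurable w1 w2 f g)
  from measurable_compose[OF this R] show ?thesis by (simp add: pred_def)
qed

lemma event_measurable:
  assumes G: "Measurable.pred vec3 (\<lambda>\<omega>. G (hc \<omega>) (gc \<omega>) (zc \<omega>))"
  shows "{\<omega>\<in>space E. \<not> G (hc \<omega> w1) (gc \<omega> w2) (zc \<omega>)} \<in> sets E"
proof -
  have "(\<lambda>\<omega>. ((hc \<omega> w1, gc \<omega> w2), zc \<omega>)) \<in> E \<rightarrow>\<^sub>M vec3"
    by (intro measurable_Pair codeword_measurable w1 w2)
  from measurable_compose[OF this G] have "Measurable.pred E (\<lambda>\<omega>. G (hc \<omega> w1) (gc \<omega> w2) (zc \<omega>))" by simp
  then show ?thesis by (simp add: pred_def pred_sets1) (measurable)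
qed

lemma union_bound:
  fixes k :: real
  assumes "finite W" "\<And>w. w \<in> W \<Longrightarrow> A w \<in> sets E" "\<And>w. w \<in> W \<Longrightarrow> measure E (A w) \<le> k"
  shows "(\<Union>w\<in>W. A w) \<in> sets E" "measure E (\<Union>w\<in>W. A w) \<le> card W * k"
proof -
  show "(\<Union>w\<in>W. A w) \<in> sets E" using assms by (intro sets.finite_UN) auto
  have "measure E (\<Union>w\<in>W. A w) \<le> (\<Sum>w\<in>W. measure E (A w))"
    by (rule ens.finite_measure_subadditive_finite) (use assms in auto)
  also have "\<dots> \<le> (\<Sum>w\<in>W. k)" by (rule sum_mono) (rule assms)
  finally show "measure E (\<Union>w\<in>W. A w) \<le> card W * k" by simp
qed

abbreviation "bad_prob_of G \<equiv> measure (true_law n (\<alpha> * P) ((1 - \<alpha>) * P))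
  {\<omega>\<in>space (true_law n (\<alpha> * P) ((1 - \<alpha>) * P)). \<not> G (hc \<omega>) (gc \<omega>) (zc \<omega>)}"

context
  fixes G :: "(nat \<Rightarrow> real) \<Rightarrow> (nat \<Rightarrow> real) \<Rightarrow> (nat \<Rightarrow> real) \<Rightarrow> bool"
  assumes G: "Measurable.pred vec3 (\<lambda>\<omega>. G (hc \<omega>) (gc \<omega>) (zc \<omega>))"
begin

lemma G_fst:
  "Measurable.pred (vec3 \<Otimes>\<^sub>M borel_vec n) (\<lambda>p. G (hc (fst p)) (gc (fst p)) (zc (fst p)))"
  "Measurable.pred ((vec3 \<Otimes>\<^sub>M borel_vec n) \<Otimes>\<^sub>M borel_vec n) (\<lambda>p. G (hc (fst (fst p))) (gc (fst (fst p))) (zc (fst (fst p))))"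
  by (rule measurable_compose[OF measurable_fst G])
    (rule measurable_compose[OF measurable_compose[OF measurable_fst measurable_fst] G])

definition "bad = {\<omega>\<in>space E. \<not> G (hc \<omega> w1) (gc \<omega> w2) (zc \<omega>)}"

lemma bad: "bad \<in> sets E" "measure E bad = bad_prob_of G"
  using event_measurable[OF G] ens_marginal[of "\<lambda>v u z. \<not> G v u z"] G
  unfolding bad_def by (auto intro: pred_intros_logic)

text \<open>The weak message is confused while the strong user's codeword acts as noise: the error
  of user 2 and of the first step of SIC.\<close>

definition "errU w = {\<omega>\<in>space E. G (hc \<omega> w1) (gc \<omega> w2) (zc \<omega>) \<and>
  sqnorm n (\<lambda>i. hc \<omega> w1 i + gc \<omega> w2 i + zc \<omega> i - gc \<omega> w i) \<le> sqnorm n (\<lambda>i. hc \<omega> w1 i + zc \<omega> i)}"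

text \<open>Under JNN with the strong message right, the strong user's codeword cancels and the
  residual is the noise alone.\<close>

definition "errU' w = {\<omega>\<in>space E. G (hc \<omega> w1) (gc \<omega> w2) (zc \<omega>) \<and>
  sqnorm n (\<lambda>i. gc \<omega> w2 i + zc \<omega> i - gc \<omega> w i) \<le> sqnorm n (zc \<omega>)}"

text \<open>The situation after a correct first step of SIC, and under JNN when only the strong
  message is wrong: the weak user's codeword has cancelled.\<close>

definition "errV w = {\<omega>\<in>space E. G (hc \<omega> w1) (gc \<omega> w2) (zc \<omega>) \<and>
  sqnorm n (\<lambda>i. hc \<omega> w1 i + zc \<omega> i - hc \<omega> w i) \<le> sqnorm n (zc \<omega>)}"

definition "errVU w w' = {\<omega>\<in>space E. G (hc \<omega> w1) (gc \<omega> w2) (zc \<omega>) \<and>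
  sqnorm n (\<lambda>i. hc \<omega> w1 i + gc \<omega> w2 i + zc \<omega> i - hc \<omega> w i - gc \<omega> w' i) \<le> sqnorm n (zc \<omega>)}"

lemma emeasure_conj_le:
  assumes "A \<Longrightarrow> emeasure M {x\<in>S. B x} \<le> k" shows "emeasure M {x\<in>S. A \<and> B x} \<le> k"
  using assms by (cases A) auto

lemma errU:
  assumes w: "w < M2" "w \<noteq> w2" and k: "0 \<le> k"
    and le: "\<And>v u z. G v u z \<Longrightarrow> emeasure SU {x\<in>space (borel_vec n). sqnorm n (\<lambda>i. v i + u i + z i - x i) \<le> sqnorm n (\<lambda>i. v i + z i)} \<le> ennreal k"
  shows "errU w \<in> sets E" "measure E (errU w) \<le> k"
proof -
  let ?R = "\<lambda>v u z x. G v u z \<and> sqnorm n (\<lambda>i. v i + u i + z i - x i) \<le> sqnorm n (\<lambda>i. v i + z i)"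
  have m: "{\<omega>\<in>space E. ?R (hc \<omega> w1) (gc \<omega> w2) (zc \<omega>) (gc \<omega> w)} \<in> sets E"
    by (rule pair_event_measurable[OF _ codeword_measurable(2)[OF w(1)], where R = ?R]) (intro pred_intros_logic G_fst pred_real_le, measurable)
  then show "errU w \<in> sets E" unfolding errU_def .
  show "measure E (errU w) \<le> k" unfolding errU_def
  proof (rule wrong_u[OF w k m])
    show "{x\<in>space SU. ?R v u z x} \<in> sets SU" for v u z by (intro sets_const_conj borel_measurable_le, measurable)
    show "emeasure SU {x\<in>space SU. ?R v u z x} \<le> ennreal k" for v u z
      unfolding space_sphere_unif by (rule emeasure_conj_le[OF le])
  qed
qed

lemma errU':
  assumes w: "w < M2" "w \<noteq> w2" and k: "0 \<le> k"
    and le: "\<And>v u z. G v u z \<Longrightarrow> emeasure SU {x\<in>space (borel_vec n). sqnorm n (\<lambda>i. u i + z i - x i) \<le> sqnorm n z} \<le> ennreal k"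
  shows "errU' w \<in> sets E" "measure E (errU' w) \<le> k"
proof -
  let ?R = "\<lambda>v u z x. G v u z \<and> sqnorm n (\<lambda>i. u i + z i - x i) \<le> sqnorm n z"
  have m: "{\<omega>\<in>space E. ?R (hc \<omega> w1) (gc \<omega> w2) (zc \<omega>) (gc \<omega> w)} \<in> sets E"
    by (rule pair_event_measurable[OF _ codeword_measurable(2)[OF w(1)], where R = ?R]) (intro pred_intros_logic G_fst pred_real_le, measurable)
  then show "errU' w \<in> sets E" unfolding errU'_def .
  show "measure E (errU' w) \<le> k" unfolding errU'_def
  proof (rule wrong_u[OF w k m])
    show "{x\<in>space SU. ?R v u z x} \<in> sets SU" for v u z by (intro sets_const_conj borel_measurable_le, measurable)
    show "emeasure SU {x\<in>space SU. ?R v u z x} \<le> ennreal k" for v u z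
      unfolding space_sphere_unif by (rule emeasure_conj_le[OF le])
  qed
qed

lemma errV:
  assumes w: "w < M1" "w \<noteq> w1" and k: "0 \<le> k"
    and le: "\<And>v u z. G v u z \<Longrightarrow> emeasure SV {x\<in>space (borel_vec n). sqnorm n (\<lambda>i. v i + z i - x i) \<le> sqnorm n z} \<le> ennreal k"
  shows "errV w \<in> sets E" "measure E (errV w) \<le> k"
proof -
  let ?R = "\<lambda>v u z x. G v u z \<and> sqnorm n (\<lambda>i. v i + z i - x i) \<le> sqnorm n z"
  have m: "{\<omega>\<in>space E. ?R (hc \<omega> w1) (gc \<omega> w2) (zc \<omega>) (hc \<omega> w)} \<in> sets E"
    by (rule pair_event_measurable[OF _ codeword_measurable(1)[OF w(1)], where R = ?R]) (intro pred_intros_logic G_fst pred_real_le, measurable)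
  then show "errV w \<in> sets E" unfolding errV_def .
  show "measure E (errV w) \<le> k" unfolding errV_def
  proof (rule wrong_v[OF w k m])
    show "{x\<in>space SV. ?R v u z x} \<in> sets SV" for v u z by (intro sets_const_conj borel_measurable_le, measurable)
    show "emeasure SV {x\<in>space SV. ?R v u z x} \<le> ennreal k" for v u z
      unfolding space_sphere_unif by (rule emeasure_conj_le[OF le])
  qed
qed

lemma errVU:
  assumes w: "w < M1" "w \<noteq> w1" and w': "w' < M2" "w' \<noteq> w2" and k: "0 \<le> k"
    and le: "\<And>v u z. G v u z \<Longrightarrow> (\<integral>\<^sup>+x. emeasure SU {y\<in>space (borel_vec n).
        sqnorm n (\<lambda>i. v i + u i + z i - x i - y i) \<le> sqnorm n z} \<partial>SV) \<le> ennreal k"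
  shows "errVU w w' \<in> sets E" "measure E (errVU w w') \<le> k"
proof -
  let ?R = "\<lambda>v u z x y. G v u z \<and> sqnorm n (\<lambda>i. v i + u i + z i - x i - y i) \<le> sqnorm n z"
  have m: "{\<omega>\<in>space E. ?R (hc \<omega> w1) (gc \<omega> w2) (zc \<omega>) (hc \<omega> w) (gc \<omega> w')} \<in> sets E"
    by (rule pair_event_measurable2[OF _ codeword_measurable(1)[OF w(1)] codeword_measurable(2)[OF w'(1)], where R = ?R]) (intro pred_intros_logic G_fst pred_real_le, measurable)
  then show "errVU w w' \<in> sets E" unfolding errVU_def .
  show "measure E (errVU w w') \<le> k" unfolding errVU_def
  proof (rule wrong_vu[OF w w' k m])
    show "{y\<in>space SU. ?R v u z x y} \<in> sets SU" for v u z x by measurable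
    show "(\<integral>\<^sup>+x. emeasure SU {y\<in>space SU. ?R v u z x y} \<partial>SV) \<le> ennreal k" for v u z
      using le[of v u z] unfolding space_sphere_unif by (cases "G v u z") auto
  qed
qed

text \<open>The weak inequality in \<open>errU\<close> is the right one because success asks for a
  strict minimiser, so a tie counts as an error.\<close>

lemma not_succ2_subset:
  "{\<omega>\<in>space E. \<not> succ2 n M2 (gc \<omega>) (\<lambda>i. hc \<omega> w1 i + gc \<omega> w2 i + zc \<omega> i) w2} \<subseteq> bad \<union> (\<Union>w\<in>{..<M2} - {w2}. errU w)"
proof
  fix \<omega> assume "\<omega> \<in> {\<omega>\<in>space E. \<not> succ2 n M2 (gc \<omega>) (\<lambda>i. hc \<omega> w1 i + gc \<omega> w2 i + zc \<omega> i) w2}"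
  then obtain w where \<omega>: "\<omega> \<in> space E" and w: "w < M2" "w \<noteq> w2"
    and le: "sqnorm n (\<lambda>i. hc \<omega> w1 i + gc \<omega> w2 i + zc \<omega> i - gc \<omega> w i) \<le>
      sqnorm n (\<lambda>i. hc \<omega> w1 i + gc \<omega> w2 i + zc \<omega> i - gc \<omega> w2 i)"
    unfolding succ2_def not_less[symmetric] by blast
  have e: "(\<lambda>i. hc \<omega> w1 i + gc \<omega> w2 i + zc \<omega> i - gc \<omega> w2 i) = (\<lambda>i. hc \<omega> w1 i + zc \<omega> i)" by auto
  show "\<omega> \<in> bad \<union> (\<Union>w\<in>{..<M2} - {w2}. errU w)"
  proof (cases "G (hc \<omega> w1) (gc \<omega> w2) (zc \<omega>)")
    case False then show ?thesis using \<omega> unfolding bad_def by blast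
  next
    case True
    then have "\<omega> \<in> errU w" using \<omega> le unfolding errU_def e by blast
    then show ?thesis using w by blast
  qed
qed

lemma user2_error:
  fixes k :: real
  assumes k: "0 \<le> k"
    and le: "\<And>v u z. G v u z \<Longrightarrow> emeasure SU {x\<in>space (borel_vec n). sqnorm n (\<lambda>i. v i + u i + z i - x i) \<le> sqnorm n (\<lambda>i. v i + z i)} \<le> ennreal k"
  shows "measure E {\<omega>\<in>space E. \<not> succ2 n M2 (gc \<omega>) (\<lambda>i. hc \<omega> w1 i + gc \<omega> w2 i + zc \<omega> i) w2} \<le>
    bad_prob_of G + real (M2 - 1) * k"
proof -
  let ?W = "{..<M2} - {w2}"
  note U = union_bound[of ?W errU k, OF _ errU(1)[OF _ _ k le] errU(2)[OF _ _ k le]]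
  have "measure E {\<omega>\<in>space E. \<not> succ2 n M2 (gc \<omega>) (\<lambda>i. hc \<omega> w1 i + gc \<omega> w2 i + zc \<omega> i) w2} \<le>
      measure E (bad \<union> (\<Union>w\<in>?W. errU w))"
    by (rule ens.finite_measure_mono[OF not_succ2_subset]) (intro sets.Un bad(1) U(1); simp)
  also have "\<dots> \<le> measure E bad + measure E (\<Union>w\<in>?W. errU w)"
    by (rule measure_Un_le) (rule bad(1), rule U(1), simp_all)
  also have "\<dots> \<le> bad_prob_of G + real (M2 - 1) * k"
  proof (rule add_mono)
    have "card ?W = M2 - 1" using w2 by simp
    moreover have "measure E (\<Union>w\<in>?W. errU w) \<le> real (card ?W) * k" by (rule U(2)) simp_all
    ultimately show "measure E (\<Union>w\<in>?W. errU w) \<le> real (M2 - 1) * k" by (simp only:)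
  qed (simp only: bad(2))
  finally show ?thesis .
qed

text \<open>One bound for both decoders: outside \<open>bad\<close>, SIC fails through
  \<open>errV\<close> or \<open>errU\<close>, and JNN through \<open>errV\<close>,
  \<open>errU'\<close> or \<open>errVU\<close>. The two ways of missing the weak message share
  k2.\<close>

lemma user1_error:
  fixes k1 k2 k3 :: real
  assumes k: "0 \<le> k1" "0 \<le> k2" "0 \<le> k3"
    and leV: "\<And>v u z. G v u z \<Longrightarrow> emeasure SV {x\<in>space (borel_vec n). sqnorm n (\<lambda>i. v i + z i - x i) \<le> sqnorm n z} \<le> ennreal k1"
    and leU: "\<And>v u z. G v u z \<Longrightarrow> emeasure SU {x\<in>space (borel_vec n). sqnorm n (\<lambda>i. v i + u i + z i - x i) \<le> sqnorm n (\<lambda>i. v i + z i)} \<le> ennreal k2"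
    and leU': "\<And>v u z. G v u z \<Longrightarrow> emeasure SU {x\<in>space (borel_vec n). sqnorm n (\<lambda>i. u i + z i - x i) \<le> sqnorm n z} \<le> ennreal k2"
    and leVU: "\<And>v u z. G v u z \<Longrightarrow> (\<integral>\<^sup>+x. emeasure SU {y\<in>space (borel_vec n).
        sqnorm n (\<lambda>i. v i + u i + z i - x i - y i) \<le> sqnorm n z} \<partial>SV) \<le> ennreal k3"
  shows "measure E {\<omega>\<in>space E. \<not> succ1 dec n M1 M2 (hc \<omega>) (gc \<omega>) (\<lambda>i. hc \<omega> w1 i + gc \<omega> w2 i + zc \<omega> i) w1 w2} \<le>
    bad_prob_of G + real (M1 - 1) * k1 + real (M2 - 1) * k2 + real (M1 - 1) * real (M2 - 1) * k3"
proof -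
  let ?W1 = "{..<M1} - {w1}" and ?W2 = "{..<M2} - {w2}"
  let ?V = "\<Union>w\<in>?W1. errV w" and ?U = "\<Union>w\<in>?W2. errU w" and ?U' = "\<Union>w\<in>?W2. errU' w"
  let ?VU = "\<Union>p\<in>?W1 \<times> ?W2. errVU (fst p) (snd p)"
  let ?S = "{\<omega>\<in>space E. \<not> succ1 dec n M1 M2 (hc \<omega>) (gc \<omega>) (\<lambda>i. hc \<omega> w1 i + gc \<omega> w2 i + zc \<omega> i) w1 w2}"
  note V = union_bound[of ?W1 errV k1, OF _ errV(1)[OF _ _ k(1) leV] errV(2)[OF _ _ k(1) leV]]
  note U = union_bound[of ?W2 errU k2, OF _ errU(1)[OF _ _ k(2) leU] errU(2)[OF _ _ k(2) leU]]
  note U' = union_bound[of ?W2 errU' k2, OF _ errU'(1)[OF _ _ k(2) leU'] errU'(2)[OF _ _ k(2) leU']]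
  have VU: "?VU \<in> sets E" "measure E ?VU \<le> card (?W1 \<times> ?W2) * k3"
  proof -
    have e: "errVU (fst p) (snd p) \<in> sets E" "measure E (errVU (fst p) (snd p)) \<le> k3" if "p \<in> ?W1 \<times> ?W2" for p
    proof -
      have w: "fst p < M1" "fst p \<noteq> w1" "snd p < M2" "snd p \<noteq> w2" using that by auto
      show "errVU (fst p) (snd p) \<in> sets E" "measure E (errVU (fst p) (snd p)) \<le> k3"
        by (rule errVU[OF w k(3) leVU], assumption)+
    qed
    show "?VU \<in> sets E" "measure E ?VU \<le> card (?W1 \<times> ?W2) * k3"
      by (rule union_bound; (rule e)?; simp)+
  qed
  have sets: "bad \<in> sets E" "?V \<in> sets E" "?U \<in> sets E" "?U' \<in> sets E" "?VU \<in> sets E"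
    by (rule bad(1), rule V(1), simp_all, rule U(1), simp_all, rule U'(1), simp_all, rule VU(1))
  have card: "card ?W1 = M1 - 1" "card ?W2 = M2 - 1" using w1 w2 by auto
  have mV: "measure E ?V \<le> real (M1 - 1) * k1" unfolding card(1)[symmetric] by (rule V(2)) simp_all
  have mU: "measure E ?U \<le> real (M2 - 1) * k2" unfolding card(2)[symmetric] by (rule U(2)) simp_all
  have mU': "measure E ?U' \<le> real (M2 - 1) * k2" unfolding card(2)[symmetric] by (rule U'(2)) simp_all
  have mVU: "measure E ?VU \<le> real (M1 - 1) * real (M2 - 1) * k3"
    using VU(2) unfolding card_cartesian_product card by simp
  have nn: "0 \<le> real (M1 - 1) * real (M2 - 1) * k3" using k by simp
  show ?thesis
  proof (cases dec)
    case SIC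
    have "?S \<subseteq> bad \<union> (?V \<union> ?U)"
    proof
      fix \<omega> assume w: "\<omega> \<in> ?S"
      show "\<omega> \<in> bad \<union> (?V \<union> ?U)"
      proof (cases "succ2 n M2 (gc \<omega>) (\<lambda>i. hc \<omega> w1 i + gc \<omega> w2 i + zc \<omega> i) w2")
        case False then show ?thesis using w not_succ2_subset by blast
      next
        case True
        then obtain w' where \<omega>: "\<omega> \<in> space E" and w': "w' < M1" "w' \<noteq> w1"
          and le: "sqnorm n (\<lambda>i. hc \<omega> w1 i + gc \<omega> w2 i + zc \<omega> i - gc \<omega> w2 i - hc \<omega> w' i) \<le>
            sqnorm n (\<lambda>i. hc \<omega> w1 i + gc \<omega> w2 i + zc \<omega> i - gc \<omega> w2 i - hc \<omega> w1 i)"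
          using w unfolding SIC succ1_def decoder.case not_less[symmetric] by blast
        have e: "(\<lambda>i. hc \<omega> w1 i + gc \<omega> w2 i + zc \<omega> i - gc \<omega> w2 i - hc \<omega> w' i) = (\<lambda>i. hc \<omega> w1 i + zc \<omega> i - hc \<omega> w' i)"
          "(\<lambda>i. hc \<omega> w1 i + gc \<omega> w2 i + zc \<omega> i - gc \<omega> w2 i - hc \<omega> w1 i) = zc \<omega>" by auto
        show ?thesis
        proof (cases "G (hc \<omega> w1) (gc \<omega> w2) (zc \<omega>)")
          case False then show ?thesis using \<omega> unfolding bad_def by blast
        next
          case True
          then have "\<omega> \<in> errV w'" using \<omega> le unfolding errV_def e by blast
          then show ?thesis using w' by blast
        qed
      qed
    qed
    then have "measure E ?S \<le> measure E (bad \<union> (?V \<union> ?U))"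
      by (rule ens.finite_measure_mono) (intro sets.Un sets)
    also have "\<dots> \<le> measure E bad + measure E (?V \<union> ?U)" by (rule measure_Un_le) (intro sets.Un sets)+
    also have "measure E (?V \<union> ?U) \<le> measure E ?V + measure E ?U" by (rule measure_Un_le) (intro sets.Un sets)+
    finally show ?thesis using mV mU bad(2) nn by linarith
  next
    case JNN
    have "?S \<subseteq> bad \<union> (?V \<union> (?U' \<union> ?VU))"
    proof
      fix \<omega> assume "\<omega> \<in> ?S"
      then obtain w w' where \<omega>: "\<omega> \<in> space E" and w: "w < M1" "w' < M2" "(w, w') \<noteq> (w1, w2)"
        and le: "sqnorm n (\<lambda>i. hc \<omega> w1 i + gc \<omega> w2 i + zc \<omega> i - gc \<omega> w' i - hc \<omega> w i) \<le>
          sqnorm n (\<lambda>i. hc \<omega> w1 i + gc \<omega> w2 i + zc \<omega> i - gc \<omega> w2 i - hc \<omega> w1 i)"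
        unfolding JNN succ1_def decoder.case not_less[symmetric] by blast
      have z: "(\<lambda>i. hc \<omega> w1 i + gc \<omega> w2 i + zc \<omega> i - gc \<omega> w2 i - hc \<omega> w1 i) = zc \<omega>"
        by auto
      show "\<omega> \<in> bad \<union> (?V \<union> (?U' \<union> ?VU))"
      proof (cases "G (hc \<omega> w1) (gc \<omega> w2) (zc \<omega>)")
        case False then show ?thesis using \<omega> unfolding bad_def by blast
      next
        case True
        consider "w' = w2" "w \<noteq> w1" | "w = w1" "w' \<noteq> w2" | "w \<noteq> w1" "w' \<noteq> w2" using w by auto
        then show ?thesis
        proof cases
          case 1
          have "(\<lambda>i. hc \<omega> w1 i + gc \<omega> w2 i + zc \<omega> i - gc \<omega> w2 i - hc \<omega> w i) = (\<lambda>i. hc \<omega> w1 i + zc \<omega> i - hc \<omega> w i)" by auto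
          then have "\<omega> \<in> errV w" using le \<omega> True unfolding z 1(1) errV_def by simp
          then show ?thesis using w 1 by auto
        next
          case 2
          have "(\<lambda>i. hc \<omega> w1 i + gc \<omega> w2 i + zc \<omega> i - gc \<omega> w' i - hc \<omega> w1 i) = (\<lambda>i. gc \<omega> w2 i + zc \<omega> i - gc \<omega> w' i)" by auto
          then have "\<omega> \<in> errU' w'" using le \<omega> True unfolding z 2(1) errU'_def by simp
          then show ?thesis using w 2 by auto
        next
          case 3
          have "(\<lambda>i. hc \<omega> w1 i + gc \<omega> w2 i + zc \<omega> i - gc \<omega> w' i - hc \<omega> w i) =
            (\<lambda>i. hc \<omega> w1 i + gc \<omega> w2 i + zc \<omega> i - hc \<omega> w i - gc \<omega> w' i)" by auto
          then have "\<omega> \<in> errVU w w'" using le \<omega> True unfolding z errVU_def by simp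
          then have "\<omega> \<in> errVU (fst (w, w')) (snd (w, w'))" by simp
          moreover have "(w, w') \<in> ?W1 \<times> ?W2" using w 3 by simp
          ultimately show ?thesis by blast
        qed
      qed
    qed
    then have "measure E ?S \<le> measure E (bad \<union> (?V \<union> (?U' \<union> ?VU)))"
      by (rule ens.finite_measure_mono) (intro sets.Un sets)
    also have "\<dots> \<le> measure E bad + measure E (?V \<union> (?U' \<union> ?VU))" by (rule measure_Un_le) (intro sets.Un sets)+
    also have "measure E (?V \<union> (?U' \<union> ?VU)) \<le> measure E ?V + measure E (?U' \<union> ?VU)" by (rule measure_Un_le) (intro sets.Un sets)+
    also have "measure E (?U' \<union> ?VU) \<le> measure E ?U' + measure E ?VU" by (rule measure_Un_le) (intro sets.Un sets)+
    finally show ?thesis using mV mU' mVU bad(2) by linarith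
  qed
qed

end

end

section \<open>Pairwise error probabilities, uniformly on favourable events\<close>

lemma sphere_error_le:
  fixes n :: nat and \<tau> b q T W :: real
  assumes n: "0 < n" and t: "0 < \<tau>" and b: "0 \<le> b"
    and q: "1 + sqnorm n y / n \<le> q" and T: "T \<le> info n \<tau> b (sqnorm n y) W"
  shows "emeasure (sphere_unif n (sqrt (n * b))) {u \<in> space (borel_vec n). sqnorm n (\<lambda>i. y i - u i) \<le> W} \<le>
    ennreal (exp (sph_const (1/(2*\<tau>)) b * q - T))"
proof -
  have "sph_const (1/(2*\<tau>)) b * (1 + sqnorm n y / n) \<le> sph_const (1/(2*\<tau>)) b * q"
    by (rule mult_left_mono[OF q]) (use t b in \<open>intro sph_const_nonneg; simp\<close>)
  then have "ennreal (exp (sph_const (1/(2*\<tau>)) b * (1 + sqnorm n y / n) - info n \<tau> b (sqnorm n y) W)) \<le>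
      ennreal (exp (sph_const (1/(2*\<tau>)) b * q - T))"
    using T by (intro ennreal_leI) simp
  with sphere_error[OF n t b] show ?thesis by (rule order_trans)
qed

lemma energy_ratio:
  fixes n :: nat and Y p c :: real
  assumes n: "0 < n" and Y: "\<bar>Y - n * p\<bar> \<le> c * real n powr (5/8)" and c: "0 \<le> c"
  shows "1 + Y / n \<le> 1 + p + c"
proof -
  have "real n powr (5/8) \<le> real n powr 1" using n by (intro powr_mono) auto
  then have "c * real n powr (5/8) \<le> c * n" using c n by (intro mult_left_mono) auto
  then have "Y \<le> (p + c) * n" using Y by (simp add: abs_le_iff algebra_simps)
  then show ?thesis using n by (simp add: divide_le_eq)
qed

lemma typ_const_nonneg: "0 \<le> a \<Longrightarrow> 0 \<le> b \<Longrightarrow> 0 \<le> typ_const a b"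
  by (simp add: typ_const_def)

context
  fixes n :: nat and a b s :: real
  assumes n: "0 < n" and a: "0 < a" and b: "0 < b" and s: "0 < s"
begin

lemma c0: "0 \<le> typ_const a b" using a b by (intro typ_const_nonneg) auto

lemma kappaV:
  assumes G: "good1 a b s L n v u z"
  shows "emeasure (sphere_unif n (sqrt (n * a))) {x \<in> space (borel_vec n). sqnorm n (\<lambda>i. v i + z i - x i) \<le> sqnorm n z} \<le>
    ennreal (exp (sph_const (1/(2 * s)) a * (1 + (a + s) + typ_const a b) - (n * Ccap (a / s) - sqrt n * L - real n powr (3/8))))"
  using G a unfolding good1_def balanced_def
  by (intro sphere_error_le energy_ratio n s c0) auto

lemma kappaU2:
  assumes G: "good2 a b s L n v u z"
  shows "emeasure (sphere_unif n (sqrt (n * b))) {x \<in> space (borel_vec n). sqnorm n (\<lambda>i. v i + u i + z i - x i) \<le> sqnorm n (\<lambda>i. v i + z i)} \<le>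
    ennreal (exp (sph_const (1/(2*(a+s))) b * (1 + (a + b + s) + typ_const a b) - (n * Ccap (b / (a + s)) - sqrt n * L - real n powr (3/8))))"
  using G a b s unfolding good2_def balanced_def
  by (intro sphere_error_le energy_ratio n c0) auto

text \<open>The constants for noise powers a + s and s are added instead of maximised, so that one
  exponent serves both \<open>errU\<close> and \<open>errU'\<close>.\<close>

definition "KU = sph_const (1/(2*(a+s))) b * (1 + (a + b + s) + typ_const a b) +
  sph_const (1/(2 * s)) b * (1 + (b + s) + typ_const a b)"

text \<open>The smaller of the two capacities, for noise powers a + s and s, with the larger of the
  two typicality losses.\<close>

definition "TU = n * Ccap (b / (a + s)) - typ_const a b / s * real n powr (5/8)"

lemma KU_ge: "sph_const (1/(2*(a+s))) b * (1 + (a + b + s) + typ_const a b) \<le> KU"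
  "sph_const (1/(2 * s)) b * (1 + (b + s) + typ_const a b) \<le> KU"
proof -
  have "0 \<le> sph_const (1/(2*(a+s))) b * (1 + (a + b + s) + typ_const a b)"
    "0 \<le> sph_const (1/(2 * s)) b * (1 + (b + s) + typ_const a b)"
    using a b s c0 by (intro mult_nonneg_nonneg sph_const_nonneg; simp)+
  then show "sph_const (1/(2*(a+s))) b * (1 + (a + b + s) + typ_const a b) \<le> KU"
    "sph_const (1/(2 * s)) b * (1 + (b + s) + typ_const a b) \<le> KU"
    unfolding KU_def by linarith+
qed

lemma kappaU:
  assumes G: "balanced n a b s (typ_const a b) v u z"
  shows "emeasure (sphere_unif n (sqrt (n * b))) {x \<in> space (borel_vec n). sqnorm n (\<lambda>i. v i + u i + z i - x i) \<le> sqnorm n (\<lambda>i. v i + z i)} \<le>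
    ennreal (exp (KU - TU))"
proof -
  let ?N = "real n powr (5/8)"
  have "n * Ccap (b / (a + s)) - typ_const a b * ?N / (a + s) \<le> info n (a + s) b (sqnorm n (\<lambda>i. v i + u i + z i)) (sqnorm n (\<lambda>i. v i + z i))"
    using G a b s unfolding balanced_def by (intro info_lower) (auto simp: add_ac)
  moreover have "typ_const a b * ?N / (a + s) \<le> typ_const a b / s * ?N"
  proof -
    have "typ_const a b * ?N / (a + s) \<le> typ_const a b * ?N / s"
      using a s c0 by (intro divide_left_mono mult_nonneg_nonneg mult_pos_pos) auto
    then show ?thesis by simp
  qed
  ultimately have T: "TU \<le> info n (a + s) b (sqnorm n (\<lambda>i. v i + u i + z i)) (sqnorm n (\<lambda>i. v i + z i))"
    unfolding TU_def by linarith
  have "emeasure (sphere_unif n (sqrt (n * b))) {x \<in> space (borel_vec n). sqnorm n (\<lambda>i. v i + u i + z i - x i) \<le> sqnorm n (\<lambda>i. v i + z i)} \<le>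
    ennreal (exp (sph_const (1/(2*(a+s))) b * (1 + (a + b + s) + typ_const a b) - TU))"
    using G a b s unfolding balanced_def by (intro sphere_error_le energy_ratio n c0 T) auto
  also have "\<dots> \<le> ennreal (exp (KU - TU))" using KU_ge(1) by (intro ennreal_leI) simp
  finally show ?thesis .
qed

lemma kappaU':
  assumes G: "balanced n a b s (typ_const a b) v u z"
  shows "emeasure (sphere_unif n (sqrt (n * b))) {x \<in> space (borel_vec n). sqnorm n (\<lambda>i. u i + z i - x i) \<le> sqnorm n z} \<le>
    ennreal (exp (KU - TU))"
proof -
  let ?N = "real n powr (5/8)"
  have "n * Ccap (b / s) - typ_const a b * ?N / s \<le> info n s b (sqnorm n (\<lambda>i. u i + z i)) (sqnorm n z)"
    using G b s unfolding balanced_def by (intro info_lower) (auto simp: add_ac)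
  moreover have "n * Ccap (b / (a + s)) \<le> n * Ccap (b / s)"
  proof -
    have "b / (a + s) \<le> b / s" using a b s by (intro divide_left_mono mult_pos_pos) auto
    moreover have "0 \<le> b / (a + s)" using a b s by simp
    ultimately have "ln (1 + b / (a + s)) \<le> ln (1 + b / s)" by (subst ln_le_cancel_iff) auto
    then show ?thesis by (intro mult_left_mono) (simp_all add: Ccap_def)
  qed
  ultimately have T: "TU \<le> info n s b (sqnorm n (\<lambda>i. u i + z i)) (sqnorm n z)"
    unfolding TU_def by simp
  have "emeasure (sphere_unif n (sqrt (n * b))) {x \<in> space (borel_vec n). sqnorm n (\<lambda>i. u i + z i - x i) \<le> sqnorm n z} \<le>
    ennreal (exp (sph_const (1/(2 * s)) b * (1 + (b + s) + typ_const a b) - TU))"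
    using G b s unfolding balanced_def by (intro sphere_error_le energy_ratio n c0 T) auto
  also have "\<dots> \<le> ennreal (exp (KU - TU))" using KU_ge(2) by (intro ennreal_leI) simp
  finally show ?thesis .
qed

lemma kappaVU:
  assumes G: "balanced n a b s (typ_const a b) v u z"
  shows "(\<integral>\<^sup>+x. emeasure (sphere_unif n (sqrt (n * b))) {y \<in> space (borel_vec n).
      sqnorm n (\<lambda>i. v i + u i + z i - x i - y i) \<le> sqnorm n z} \<partial>sphere_unif n (sqrt (n * a))) \<le>
    ennreal (exp (sph_const2 s a b * (1 + (a + b + s) + typ_const a b) -
      (n * Ccap ((b + a) / s) - typ_const a b / s * real n powr (5/8))))"
proof -
  let ?N = "real n powr (5/8)" and ?y = "\<lambda>i. v i + u i + z i"
  have i: "n * Ccap ((b + a) / s) - typ_const a b * ?N / s \<le> info n s (b + a) (sqnorm n ?y) (sqnorm n z)"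
    using G a b s unfolding balanced_def by (intro info_lower) (auto simp: add_ac)
  have r: "1 + sqnorm n ?y / n \<le> 1 + (a + b + s) + typ_const a b"
    using G unfolding balanced_def by (intro energy_ratio n c0) auto
  have "0 \<le> sph_const2 s a b"
    unfolding sph_const2_def using a b s by (intro add_nonneg_nonneg mult_nonneg_nonneg sph_const_nonneg) auto
  then have "sph_const2 s a b * (1 + sqnorm n ?y / n) \<le> sph_const2 s a b * (1 + (a + b + s) + typ_const a b)"
    using r by (intro mult_left_mono) auto
  then show ?thesis
    using i a b by (intro order_trans[OF sphere_error2[OF n s]]) (auto intro!: ennreal_leI)
qed

end

section \<open>Asymptotics of the error bounds\<close>

lemma Ccap_strict_mono: "0 \<le> x \<Longrightarrow> x < y \<Longrightarrow> Ccap x < Ccap y"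
  by (simp add: Ccap_def)

lemma exp_linear_gap:
  fixes K B \<Delta> :: real
  assumes d: "0 < \<Delta>"
  shows "(\<lambda>n. exp (K + B * real n powr (5/8) - \<Delta> * n)) \<longlonglongrightarrow> 0"
proof (rule tendsto_sandwich[of "\<lambda>_. 0"])
  have "(5/8::real) < 1" by simp
  \<comment> \<open>The factor 2 B / \<Delta> lets half of the linear term pay for the moderate
    one.\<close>
  from eventually_powr_le[OF this, of "2 * B / \<Delta>"] eventually_gt_at_top[of 0]
  show "\<forall>\<^sub>F n in sequentially. exp (K + B * real n powr (5/8) - \<Delta> * n) \<le> exp K * exp (- (\<Delta> / 2) * n)"
  proof eventually_elim
    case (elim n)
    then have "\<Delta> / 2 * (2 * B / \<Delta> * real n powr (5/8)) \<le> \<Delta> / 2 * n"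
      using d by (intro mult_left_mono) auto
    moreover have "\<Delta> / 2 * (2 * B / \<Delta> * real n powr (5/8)) = B * real n powr (5/8)" using d by simp
    ultimately have "K + B * real n powr (5/8) - \<Delta> * n \<le> K + - (\<Delta> / 2) * n" by simp
    then show ?case unfolding exp_add[symmetric] by simp
  qed
  have "(\<lambda>n. exp K * exp (- (\<Delta> / 2)) ^ n) \<longlonglongrightarrow> exp K * 0"
    by (intro tendsto_mult tendsto_const LIMSEQ_power_zero) (use d in simp)
  then show "(\<lambda>n. exp K * exp (- (\<Delta> / 2) * real n)) \<longlonglongrightarrow> 0"
    by (simp add: mult.commute flip: exp_of_nat_mult)
qed simp_all

lemma exp_powr_gap: "(\<lambda>n. exp (K - real n powr (3/8))) \<longlonglongrightarrow> 0"
proof -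
  have "filterlim (\<lambda>n. real n powr (3/8)) at_top sequentially"
    unfolding filterlim_at_top
  proof
    fix Z :: real
    have "(0::real) < 3/8" by simp
    from eventually_powr_le[OF this, of Z] eventually_gt_at_top[of 0]
    show "\<forall>\<^sub>F n in sequentially. Z \<le> real n powr (3/8)" by eventually_elim simp
  qed
  then have "filterlim (\<lambda>n. - (real n powr (3/8))) at_bot sequentially"
    by (simp add: filterlim_uminus_at_bot)
  then have "(\<lambda>n. exp (- (real n powr (3/8)))) \<longlonglongrightarrow> 0"
    by (rule filterlim_compose[OF exp_at_bot])
  then have "(\<lambda>n. exp K * exp (- (real n powr (3/8)))) \<longlonglongrightarrow> 0"
    by (rule tendsto_mult_right_zero)
  then show ?thesis unfolding exp_add[symmetric] by simp
qed

lemma sqrt_le_powr: "0 < n \<Longrightarrow> sqrt (real n) \<le> real n powr (5/8)"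
proof -
  assume n: "0 < n"
  have "sqrt (real n) = real n powr (1/2)" using n by (simp add: powr_half_sqrt)
  also have "\<dots> \<le> real n powr (5/8)" using n by (intro powr_mono) auto
  finally show ?thesis .
qed

lemma average_le:
  fixes f :: "nat \<Rightarrow> nat \<Rightarrow> real"
  assumes "1 \<le> M1" "1 \<le> M2" "\<And>i j. i < M1 \<Longrightarrow> j < M2 \<Longrightarrow> f i j \<le> B"
  shows "(\<Sum>i<M1. \<Sum>j<M2. f i j) / (real M1 * real M2) \<le> B"
proof -
  have "(\<Sum>i<M1. \<Sum>j<M2. f i j) \<le> (\<Sum>i<M1. \<Sum>j<M2. B)" using assms by (intro sum_mono) auto
  also have "\<dots> = B * (real M1 * real M2)" by simp
  finally show ?thesis using assms by (simp add: divide_le_eq)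
qed

text \<open>The union bound in exponents: log-count plus constant minus pairwise exponent.\<close>

lemma exp_sum_le:
  fixes X x K T U :: real
  assumes "0 \<le> x" "x \<le> exp X" "X + K - T \<le> U" shows "x * exp (K - T) \<le> exp U"
proof -
  have "x * exp (K - T) \<le> exp X * exp (K - T)" using assms by (intro mult_right_mono) auto
  also have "\<dots> = exp (X + K - T)" by (simp flip: exp_add)
  also have "\<dots> \<le> exp U" using assms by simp
  finally show ?thesis .
qed

context noise_law begin

text \<open>The limit comes from the event that \<open>good1\<close> fails. On \<open>good1\<close>,
  a wrong strong message alone has slack n powr (3/8), and every error that involves the weak
  message has slack linear in n, so all union bounds vanish.\<close>

lemma user1_limit:
  fixes P \<alpha> L1 L2 s :: real and M1 M2 :: "nat \<Rightarrow> nat"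
  assumes s: "(\<integral>z. z\<^sup>2 \<partial>D) = s" "0 < s" "s < 1" and P: "0 < P" "0 < \<alpha>" "\<alpha> < 1"
    and M: "\<And>n. 1 \<le> M1 n" "\<And>n. 1 \<le> M2 n"
    and M1: "\<And>n. real (M1 n - 1) \<le> exp (n * Ccap (\<alpha> * P / s) - sqrt n * L1 - 2 * real n powr (3/8))"
    and M2: "\<And>n. real (M2 n - 1) \<le> exp (n * Ccap ((1 - \<alpha>) * P / (\<alpha> * P + 1)) - sqrt n * L2 - 2 * real n powr (3/8))"
  shows "\<exists>R. R \<longlonglongrightarrow> Qfun (L1 / sqrt (V1 (\<alpha> * P) s (\<integral>z. z ^ 4 \<partial>D))) \<and>
    (\<forall>\<^sub>F n in sequentially. Pe1 dec n D P \<alpha> (M1 n) (M2 n) \<le> R n)"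
proof -
  define a b where "a = \<alpha> * P" and "b = (1 - \<alpha>) * P"
  have a: "0 < a" and b: "0 < b" using P by (simp_all add: a_def b_def)
  obtain R where R: "R \<longlonglongrightarrow> Qfun (L1 / sqrt (V1 a s (\<integral>z. z ^ 4 \<partial>D)))"
    and bad: "\<forall>\<^sub>F n in sequentially. measure (true_law n a b) {\<omega>\<in>space (true_law n a b). \<not> good1 a b s L1 n (hc \<omega>) (gc \<omega>) (zc \<omega>)} \<le> R n"
    using good1_prob[OF s(1,2) a b, of L1] by blast
  define c where "c = typ_const a b / s"
  define K1 where "K1 = sph_const (1/(2 * s)) a * (1 + (a + s) + typ_const a b)"
  define K3 where "K3 = sph_const2 s a b * (1 + (a + b + s) + typ_const a b)"
  \<comment> \<open>The weak message is coded for noise power 1 while the strong user has s < 1; the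
    capacities differ by this positive amount per symbol.\<close>
  define \<Delta> where "\<Delta> = Ccap (b / (a + s)) - Ccap (b / (a + 1))"
  have D: "0 < \<Delta>"
    unfolding \<Delta>_def using a b s Ccap_strict_mono[of "b / (a + 1)" "b / (a + s)"]
    by (simp add: divide_strict_left_mono)
  let ?R = "\<lambda>n. R n + exp (K1 - real n powr (3/8)) + exp (KU a b s + (c + \<bar>L2\<bar>) * real n powr (5/8) - \<Delta> * n) +
    exp (K3 + (c + \<bar>L1\<bar> + \<bar>L2\<bar>) * real n powr (5/8) - \<Delta> * n)"
  have lim: "?R \<longlonglongrightarrow> Qfun (L1 / sqrt (V1 a s (\<integral>z. z ^ 4 \<partial>D))) + 0 + 0 + 0"
    by (intro tendsto_add R exp_powr_gap exp_linear_gap D)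
  have "\<forall>\<^sub>F n in sequentially. Pe1 dec n D P \<alpha> (M1 n) (M2 n) \<le> ?R n"
    using bad eventually_gt_at_top[of 0]
  proof eventually_elim
    case (elim n)
    note n = elim(2)
    note kV = kappaV[OF n a b s(2), of L1]
    have bal: "balanced n a b s (typ_const a b) v u z" if "good1 a b s L1 n v u z" for v u z
      using that by (simp add: good1_def)
    let ?T1 = "n * Ccap (a / s) - sqrt n * L1 - real n powr (3/8)"
    let ?T3 = "n * Ccap ((b + a) / s) - c * real n powr (5/8)"
    let ?k1 = "exp (K1 - ?T1)" and ?k2 = "exp (KU a b s - TU n a b s)" and ?k3 = "exp (K3 - ?T3)"
    let ?X1 = "n * Ccap (a / s) - sqrt n * L1 - 2 * real n powr (3/8)"
    let ?X2 = "n * Ccap (b / (a + 1)) - sqrt n * L2 - 2 * real n powr (3/8)"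
    have X1: "real (M1 n - 1) \<le> exp ?X1" using M1[of n] by (simp add: a_def)
    have X2: "real (M2 n - 1) \<le> exp ?X2" using M2[of n] by (simp add: a_def b_def)
    have sL: "- (sqrt n * L) \<le> \<bar>L\<bar> * real n powr (5/8)" for L
    proof -
      have "- (sqrt n * L) \<le> sqrt n * \<bar>L\<bar>" using mult_left_mono[of "- L" "\<bar>L\<bar>" "sqrt n"] by simp
      also have "\<dots> \<le> real n powr (5/8) * \<bar>L\<bar>" by (intro mult_right_mono sqrt_le_powr n) simp
      finally show ?thesis by (simp add: mult.commute)
    qed
    have p: "0 \<le> real n powr (3/8)" by simp
    \<comment> \<open>Of the reduction 2 n powr (3/8) in the log-size, one half pays for the
      allowance in \<open>good1\<close> and the other drives this term to 0.\<close>
    have t1: "real (M1 n - 1) * ?k1 \<le> exp (K1 - real n powr (3/8))"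
      by (rule exp_sum_le[OF _ X1]) simp_all
    have t2: "real (M2 n - 1) * ?k2 \<le> exp (KU a b s + (c + \<bar>L2\<bar>) * real n powr (5/8) - \<Delta> * n)"
    proof (rule exp_sum_le[OF _ X2])
      show "?X2 + KU a b s - TU n a b s \<le> KU a b s + (c + \<bar>L2\<bar>) * real n powr (5/8) - \<Delta> * n"
        unfolding TU_def[OF n a b s(2)] c_def[symmetric] using sL[of L2] p
        by (simp only: \<Delta>_def algebra_simps; linarith)
    qed simp
    have "real (M1 n - 1) * real (M2 n - 1) \<le> exp ?X1 * exp ?X2"
      using X1 X2 by (intro mult_mono) auto
    then have X12: "real (M1 n - 1) * real (M2 n - 1) \<le> exp (?X1 + ?X2)" by (simp only: exp_add)
    \<comment> \<open>By the chain rule the joint capacity exceeds the sum of the two first-order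
      rates by the same \<Delta>.\<close>
    have Cs: "Ccap ((b + a) / s) = Ccap (a / s) + Ccap (b / (a + s))"
      using Ccap_add[of s a b] a b s by (simp add: add.commute)
    have t3: "real (M1 n - 1) * real (M2 n - 1) * ?k3 \<le> exp (K3 + (c + \<bar>L1\<bar> + \<bar>L2\<bar>) * real n powr (5/8) - \<Delta> * n)"
    proof (rule exp_sum_le[OF _ X12])
      show "?X1 + ?X2 + K3 - ?T3 \<le> K3 + (c + \<bar>L1\<bar> + \<bar>L2\<bar>) * real n powr (5/8) - \<Delta> * n"
        unfolding Cs using sL[of L1] sL[of L2] p
        by (simp only: \<Delta>_def algebra_simps; linarith)
    qed simp
    have main: "measure (ens n D P \<alpha> (M1 n) (M2 n))
       {((v, u), z) \<in> space (ens n D P \<alpha> (M1 n) (M2 n)).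
          \<not> succ1 dec n (M1 n) (M2 n) v u (\<lambda>i. v w1 i + u w2 i + z i) w1 w2} \<le> ?R n"
      if w: "w1 < M1 n" "w2 < M2 n" for w1 w2
    proof -
      interpret C: code_ensemble D n "M1 n" "M2 n" w1 w2 P \<alpha> by unfold_locales (use w in auto)
      have "measure C.E {\<omega>\<in>space C.E. \<not> succ1 dec n (M1 n) (M2 n) (hc \<omega>) (gc \<omega>) (\<lambda>i. hc \<omega> w1 i + gc \<omega> w2 i + zc \<omega> i) w1 w2} \<le>
        measure (true_law n (\<alpha> * P) ((1 - \<alpha>) * P)) {\<omega>\<in>space (true_law n (\<alpha> * P) ((1 - \<alpha>) * P)). \<not> good1 a b s L1 n (hc \<omega>) (gc \<omega>) (zc \<omega>)}
        + real (M1 n - 1) * ?k1 + real (M2 n - 1) * ?k2 + real (M1 n - 1) * real (M2 n - 1) * ?k3"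
        by (rule C.user1_error; (rule good_measurable | rule exp_ge_zero | fold a_def b_def))
          (use kV kappaU[OF n a b s(2) bal] kappaU'[OF n a b s(2) bal] kappaVU[OF n a b s(2) bal] in \<open>simp_all add: K1_def K3_def c_def\<close>)
      also have "\<dots> \<le> ?R n"
        using elim(1) t1 t2 t3 unfolding a_def[symmetric] b_def[symmetric] by linarith
      finally show ?thesis by (simp add: case_prod_beta')
    qed
    show ?case unfolding Pe1_def by (rule average_le[OF M main])
  qed
  then show ?thesis using lim unfolding a_def by auto
qed

lemma user2_limit:
  fixes P \<alpha> L2 :: real and M1 M2 :: "nat \<Rightarrow> nat"
  assumes s: "(\<integral>z. z\<^sup>2 \<partial>D) = 1" and P: "0 < P" "0 < \<alpha>" "\<alpha> < 1"
    and M: "\<And>n. 1 \<le> M1 n" "\<And>n. 1 \<le> M2 n"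
    and M2: "\<And>n. real (M2 n - 1) \<le> exp (n * Ccap ((1 - \<alpha>) * P / (\<alpha> * P + 1)) - sqrt n * L2 - 2 * real n powr (3/8))"
  shows "\<exists>R. R \<longlonglongrightarrow> Qfun (L2 / sqrt (V2 ((1 - \<alpha>) * P) (\<alpha> * P) (\<integral>z. z ^ 4 \<partial>D))) \<and>
    (\<forall>\<^sub>F n in sequentially. Pe2 n D P \<alpha> (M1 n) (M2 n) \<le> R n)"
proof -
  define a b where "a = \<alpha> * P" and "b = (1 - \<alpha>) * P"
  have a: "0 < a" and b: "0 < b" using P by (simp_all add: a_def b_def)
  obtain R where R: "R \<longlonglongrightarrow> Qfun (L2 / sqrt (V2 b a (\<integral>z. z ^ 4 \<partial>D)))"
    and bad: "\<forall>\<^sub>F n in sequentially. measure (true_law n a b) {\<omega>\<in>space (true_law n a b). \<not> good2 a b 1 L2 n (hc \<omega>) (gc \<omega>) (zc \<omega>)} \<le> R n"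
    using good2_prob[OF s refl a b, of L2] by blast
  define K where "K = sph_const (1/(2*(a+1))) b * (1 + (a + b + 1) + typ_const a b)"
  let ?R = "\<lambda>n. R n + exp (K - real n powr (3/8))"
  have lim: "?R \<longlonglongrightarrow> Qfun (L2 / sqrt (V2 b a (\<integral>z. z ^ 4 \<partial>D))) + 0"
    by (intro tendsto_add R exp_powr_gap)
  have "\<forall>\<^sub>F n in sequentially. Pe2 n D P \<alpha> (M1 n) (M2 n) \<le> ?R n"
    using bad eventually_gt_at_top[of 0]
  proof eventually_elim
    case (elim n)
    note n = elim(2)
    let ?T = "n * Ccap (b / (a + 1)) - sqrt n * L2 - real n powr (3/8)"
    have X: "real (M2 n - 1) \<le> exp (n * Ccap (b / (a + 1)) - sqrt n * L2 - 2 * real n powr (3/8))"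
      using M2[of n] by (simp add: a_def b_def)
    have t: "real (M2 n - 1) * exp (K - ?T) \<le> exp (K - real n powr (3/8))"
      by (rule exp_sum_le[OF _ X]) simp_all
    have main: "measure (ens n D P \<alpha> (M1 n) (M2 n))
       {((v, u), z) \<in> space (ens n D P \<alpha> (M1 n) (M2 n)).
          \<not> succ2 n (M2 n) u (\<lambda>i. v w1 i + u w2 i + z i) w2} \<le> ?R n"
      if w: "w1 < M1 n" "w2 < M2 n" for w1 w2
    proof -
      interpret C: code_ensemble D n "M1 n" "M2 n" w1 w2 P \<alpha> by unfold_locales (use w in auto)
      have "measure C.E {\<omega>\<in>space C.E. \<not> succ2 n (M2 n) (gc \<omega>) (\<lambda>i. hc \<omega> w1 i + gc \<omega> w2 i + zc \<omega> i) w2} \<le>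
        measure (true_law n (\<alpha> * P) ((1 - \<alpha>) * P)) {\<omega>\<in>space (true_law n (\<alpha> * P) ((1 - \<alpha>) * P)). \<not> good2 a b 1 L2 n (hc \<omega>) (gc \<omega>) (zc \<omega>)}
        + real (M2 n - 1) * exp (K - ?T)"
        by (rule C.user2_error; (rule good_measurable | rule exp_ge_zero | fold a_def b_def))
          (use kappaU2[OF n a b, of 1 L2] in \<open>simp_all add: K_def\<close>)
      also have "\<dots> \<le> ?R n"
        using elim(1) t unfolding a_def[symmetric] b_def[symmetric] by linarith
      finally show ?thesis by (simp add: case_prod_beta')
    qed
    show ?case unfolding Pe2_def by (rule average_le[OF M main])
  qed
  then show ?thesis using lim unfolding a_def b_def by auto
qed

end

section \<open>Rates, codebook sizes and the conclusion\<close>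

lemma limsup_real_le:
  fixes f g :: "nat \<Rightarrow> real"
  assumes "\<forall>\<^sub>F n in sequentially. f n \<le> g n" "g \<longlonglongrightarrow> l" "l \<le> e"
  shows "limsup (\<lambda>n. ereal (f n)) \<le> ereal e"
proof -
  have "limsup (\<lambda>n. ereal (f n)) \<le> limsup (\<lambda>n. ereal (g n))"
    by (rule Limsup_mono) (use assms(1) in simp)
  also have "\<dots> = ereal l"
    by (rule lim_imp_Limsup) (use assms(2) in simp_all)
  finally show ?thesis using assms(3) by (meson ereal_less_eq(3) order_trans)
qed

text \<open>The reduction 2 n powr (3/8) of the log-size becomes 2 n powr (-1/8) after division by
  sqrt n.\<close>

lemma rate_limsup:
  fixes M :: "nat \<Rightarrow> nat" and C L :: real
  assumes "\<And>n. n * C - sqrt n * L - 2 * real n powr (3/8) \<le> ln (real (M n))"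
  shows "limsup (\<lambda>n. ereal ((real n * C - ln (real (M n))) / sqrt (real n))) \<le> ereal L"
proof (rule limsup_real_le)
  have "(\<lambda>n. real n powr (-1/8)) \<longlonglongrightarrow> 0"
    by (rule tendsto_neg_powr) (auto simp: filterlim_real_sequentially)
  then have "(\<lambda>n. L + 2 * real n powr (-1/8)) \<longlonglongrightarrow> L + 2 * 0" by (intro tendsto_intros)
  then show "(\<lambda>n. L + 2 * real n powr (-1/8)) \<longlonglongrightarrow> L" by simp
  show "\<forall>\<^sub>F n in sequentially. (real n * C - ln (real (M n))) / sqrt (real n) \<le> L + 2 * real n powr (-1/8)"
    using eventually_gt_at_top[of 0]
  proof eventually_elim
    case (elim n)
    have "real n powr (-1/8) * real n powr (1/2) = real n powr (3/8)" by (simp flip: powr_add)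
    then have "real n powr (-1/8) * sqrt n = real n powr (3/8)" using elim by (simp add: powr_half_sqrt)
    then have "real n * C - ln (real (M n)) \<le> (L + 2 * real n powr (-1/8)) * sqrt n"
      using assms[of n] by (simp add: algebra_simps)
    then show ?case using elim by (simp add: pos_divide_le_eq)
  qed
qed simp

text \<open>Adding 1 to the floor serves both ends: the number M - 1 of wrong codewords is at most
  exp x, while M itself is at least exp x. The size is positive even when exp x < 1.\<close>

lemma codebook_size:
  fixes x :: real
  defines "M \<equiv> nat \<lfloor>exp x\<rfloor> + 1"
  shows "1 \<le> M" "real (M - 1) \<le> exp x" "x \<le> ln (real M)"
proof -
  show M: "1 \<le> M" by (simp add: M_def)
  show "real (M - 1) \<le> exp x" by (simp add: M_def)
  have "exp x \<le> real M" unfolding M_def using floor_correct[of "exp x"] by simp linarith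
  moreover have "0 < real M" using M by simp
  ultimately show "x \<le> ln (real M)" by (simp only: ln_ge_iff)
qed

lemma Qfun_le:
  assumes e: "0 < e" "e < 1" and V: "0 < V" and L: "sqrt V * Qinv e \<le> L"
  shows "Qfun (L / sqrt V) \<le> e"
proof -
  have "Qinv e \<le> L / sqrt V" using V L by (simp add: pos_le_divide_eq mult.commute)
  from Qfun_antimono[OF this] show ?thesis by (simp only: Qfun_Qinv[OF e])
qed

theorem theorem1:
  fixes \<epsilon>1 \<epsilon>2 P \<alpha> \<beta> L1 L2 :: real and D1 D2 :: "real measure" and dec :: decoder
  assumes "0 < \<epsilon>1" "\<epsilon>1 < 1" "0 < \<epsilon>2" "\<epsilon>2 < 1"
    and "0 < P" "0 < \<alpha>" "\<alpha> < 1" "0 < \<beta>" "\<beta> < 1"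
    and "prob_space D1" "sets D1 = sets borel"
    and "integrable D1 (\<lambda>z. z\<^sup>2)" "integrable D1 (\<lambda>z. z^4)" "integrable D1 (\<lambda>z. z^6)"
    and "(\<integral>z. z\<^sup>2 \<partial>D1) = \<beta>"
    and "prob_space D2" "sets D2 = sets borel"
    and "integrable D2 (\<lambda>z. z\<^sup>2)" "integrable D2 (\<lambda>z. z^4)" "integrable D2 (\<lambda>z. z^6)"
    and "(\<integral>z. z\<^sup>2 \<partial>D2) = 1"
    and "L1 \<ge> sqrt (V1 (\<alpha> * P) \<beta> (\<integral>z. z^4 \<partial>D1)) * Qinv \<epsilon>1"
    and "L2 \<ge> sqrt (V2 ((1 - \<alpha>) * P) (\<alpha> * P) (\<integral>z. z^4 \<partial>D2)) * Qinv \<epsilon>2"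
  shows "\<exists>M1 M2 :: nat \<Rightarrow> nat. (\<forall>n. 1 \<le> M1 n \<and> 1 \<le> M2 n) \<and>
    limsup (\<lambda>n. ereal ((real n * Ccap (\<alpha> * P / \<beta>) - ln (real (M1 n))) / sqrt (real n))) \<le> ereal L1 \<and>
    limsup (\<lambda>n. ereal ((real n * Ccap ((1 - \<alpha>) * P / (\<alpha> * P + 1)) - ln (real (M2 n))) / sqrt (real n))) \<le> ereal L2 \<and>
    limsup (\<lambda>n. ereal (Pe1 dec n D1 P \<alpha> (M1 n) (M2 n))) \<le> ereal \<epsilon>1 \<and>
    limsup (\<lambda>n. ereal (Pe2 n D2 P \<alpha> (M1 n) (M2 n))) \<le> ereal \<epsilon>2"
proof -
  interpret D1: noise_law D1
    using assms by (intro noise_law.intro noise_law_axioms.intro) auto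
  interpret D2: noise_law D2
    using assms by (intro noise_law.intro noise_law_axioms.intro) auto
  \<comment> \<open>The sizes depend neither on the decoder nor on the error targets; the targets
    enter through \<open>Qfun_le\<close> alone.\<close>
  define X1 where "X1 n = real n * Ccap (\<alpha> * P / \<beta>) - sqrt n * L1 - 2 * real n powr (3/8)" for n
  define X2 where "X2 n = real n * Ccap ((1 - \<alpha>) * P / (\<alpha> * P + 1)) - sqrt n * L2 - 2 * real n powr (3/8)" for n
  define M1 where "M1 n = nat \<lfloor>exp (X1 n)\<rfloor> + 1" for n
  define M2 where "M2 n = nat \<lfloor>exp (X2 n)\<rfloor> + 1" for n
  note M1 = codebook_size[of "X1 n" for n, folded M1_def] and M2 = codebook_size[of "X2 n" for n, folded M2_def]
  have a: "0 < \<alpha> * P" and b: "0 < (1 - \<alpha>) * P" using assms by auto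
  obtain R1 where R1: "R1 \<longlonglongrightarrow> Qfun (L1 / sqrt (V1 (\<alpha> * P) \<beta> (\<integral>z. z ^ 4 \<partial>D1)))"
      "\<forall>\<^sub>F n in sequentially. Pe1 dec n D1 P \<alpha> (M1 n) (M2 n) \<le> R1 n"
    using D1.user1_limit[where dec = dec, OF assms(15,8,9,5,6,7) M1(1) M2(1) M1(2)[unfolded X1_def] M2(2)[unfolded X2_def]] by blast
  obtain R2 where R2: "R2 \<longlonglongrightarrow> Qfun (L2 / sqrt (V2 ((1 - \<alpha>) * P) (\<alpha> * P) (\<integral>z. z ^ 4 \<partial>D2)))"
      "\<forall>\<^sub>F n in sequentially. Pe2 n D2 P \<alpha> (M1 n) (M2 n) \<le> R2 n"
    using D2.user2_limit[where ?M1.0 = M1, OF assms(21,5,6,7) M1(1) M2(1) M2(2)[unfolded X2_def]] by blast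
  have Q1: "Qfun (L1 / sqrt (V1 (\<alpha> * P) \<beta> (\<integral>z. z ^ 4 \<partial>D1))) \<le> \<epsilon>1"
    by (rule Qfun_le[OF assms(1,2) D1.V1_pos[OF assms(15,8) a] assms(22)])
  have Q2: "Qfun (L2 / sqrt (V2 ((1 - \<alpha>) * P) (\<alpha> * P) (\<integral>z. z ^ 4 \<partial>D2))) \<le> \<epsilon>2"
    by (rule Qfun_le[OF assms(3,4) D2.V2_pos[OF assms(21) a b] assms(23)])
  show ?thesis
  proof (intro exI conjI allI)
    show "1 \<le> M1 n" "1 \<le> M2 n" for n by (rule M1 M2)+
    show "limsup (\<lambda>n. ereal ((real n * Ccap (\<alpha> * P / \<beta>) - ln (real (M1 n))) / sqrt (real n))) \<le> ereal L1"
      by (rule rate_limsup) (rule M1(3)[unfolded X1_def])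
    show "limsup (\<lambda>n. ereal ((real n * Ccap ((1 - \<alpha>) * P / (\<alpha> * P + 1)) - ln (real (M2 n))) / sqrt (real n))) \<le> ereal L2"
      by (rule rate_limsup) (rule M2(3)[unfolded X2_def])
    show "limsup (\<lambda>n. ereal (Pe1 dec n D1 P \<alpha> (M1 n) (M2 n))) \<le> ereal \<epsilon>1"
      by (rule limsup_real_le[OF R1(2,1) Q1])
    show "limsup (\<lambda>n. ereal (Pe2 n D2 P \<alpha> (M1 n) (M2 n))) \<le> ereal \<epsilon>2"
      by (rule limsup_real_le[OF R2(2,1) Q2])
  qed
qed

end
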